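(* Let $p\in\mathbb{N}_0$, let $f$ be a boolean function and let $F$ be a UR-representation of $f$ all of whose clauses have length at most $p$. Then a forcing representation of $f$ can be computed from $F$ in time $O(n(f)\cdot p\cdot n(F)\cdot\ell(F))$.
   Context: Clauses are finite sets of literals without complementary pairs ($\bot$ empty clause), clause-sets are finite sets of clauses read as CNF ($\top$ the empty clause-set); $n(F)=|\mathrm{var}(F)|$, $\ell(F)=\sum_{C\in F}|C|$. For a partial assignment $\varphi$, $\varphi*F$ deletes clauses containing a literal set to $1$ and deletes literals set to $0$. A literal $x$ is forced for $F$ if $\langle x\to0\rangle*F$ is unsatisfiable. $r_1$ is unit-clause propagation ($r_1(F)=\{\bot\}$ if $\bot\in F$; else repeatedly apply $\langle x\to1\rangle$ for unit clauses $\{x\}$, returning $\{\bot\}$ if $\bot$ appears). A boolean function $f$ maps total assignments of a finite set $\mathrm{var}(f)$ to $\{0,1\}$, $n(f)=|\mathrm{var}(f)|$. A CNF-representation of $f$ is a clause-set $F$ with $\mathrm{var}(f)\subseteq\mathrm{var}(F)$ such that for every total assignment $\varphi$ of $\mathrm{var}(f)$, $\varphi*F$ is satisfiable iff $f(\varphi)=1$. It is a UR-representation if for every partial $\varphi$ with $\mathrm{var}(\varphi)\subseteq\mathrm{var}(f)$ and $\varphi*F$ unsatisfiable, $r_1(\varphi*F)=\{\bot\}$. It is a forcing representation if for every partial $\varphi$ with $\mathrm{var}(\varphi)\subseteq\mathrm{var}(f)$: if $\varphi*F$ is unsatisfiable then $r_1(\varphi*F)=\{\bot\}$, and if satisfiable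 then $r_1(\varphi*F)$ has no forced literal over $\mathrm{var}(f)$; and moreover for every total assignment $\varphi$ of $\mathrm{var}(f)$ with $\varphi*F$ satisfiable, $r_1(\varphi*F)=\top$.
   Formalization: In the bound O(n(f)·p·n(F)·ℓ(F)) a factor equal to 0 is read as 1: for n(f)=0 (e.g. F={⊥}) the literal product is 0, while every computation takes at least one step; for n(f)≥1 all factors are positive and the bound is literally the stated one. *)

theory Defs
  imports Main
begin

section \<open>Clause-sets, partial assignments, unit-clause propagation\<close>

type_synonym var = nat

text \<open>The literal \<open>(v, True)\<close> is the variable \<open>v\<close>, the literal \<open>(v, False)\<close> its complement.\<close>
type_synonym lit = "var \<times> bool"
type_synonym clause = "lit set"
type_synonym pass = "var \<rightharpoonup> bool"

definition compl :: "lit \<Rightarrow> lit" where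
  "compl x = (fst x, \<not> snd x)"

definition is_clause :: "clause \<Rightarrow> bool" where
  "is_clause C \<longleftrightarrow> finite C \<and> (\<forall>x\<in>C. compl x \<notin> C)"

definition clause_set :: "clause set \<Rightarrow> bool" where
  "clause_set F \<longleftrightarrow> finite F \<and> (\<forall>C\<in>F. is_clause C)"

definition vars :: "clause set \<Rightarrow> var set" where
  "vars F = fst ` \<Union>F"

definition nvars :: "clause set \<Rightarrow> nat" where
  "nvars F = card (vars F)"

definition nlits :: "clause set \<Rightarrow> nat" where
  "nlits F = (\<Sum>C\<in>F. card C)"

definition true_lits :: "pass \<Rightarrow> lit set" where
  "true_lits \<phi> = {x. \<phi> (fst x) = Some (snd x)}"

definition false_lits :: "pass \<Rightarrow> lit set" where
  "false_lits \<phi> = {x. \<phi> (fst x) = Some (\<not> snd x)}"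

definition apply_pass :: "pass \<Rightarrow> clause set \<Rightarrow> clause set" (infixr \<open>\<star>\<close> 75) where
  "\<phi> \<star> F = {C - false_lits \<phi> | C. C \<in> F \<and> C \<inter> true_lits \<phi> = {}}"

definition satisfiable :: "clause set \<Rightarrow> bool" where
  "satisfiable F \<longleftrightarrow> (\<exists>\<phi>. finite (dom \<phi>) \<and> \<phi> \<star> F = {})"

definition set_true :: "lit \<Rightarrow> pass" where
  "set_true x = [fst x \<mapsto> snd x]"

definition set_false :: "lit \<Rightarrow> pass" where
  "set_false x = [fst x \<mapsto> \<not> snd x]"

definition forced :: "lit \<Rightarrow> clause set \<Rightarrow> bool" where
  "forced x F \<longleftrightarrow> \<not> satisfiable (set_false x \<star> F)"

text \<open>Each propagation step on a finite clause-set removes a variable, so the recursion is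
  well-founded there; the final result does not depend on which unit-clause is chosen.\<close>
partial_function (tailrec) r1 :: "clause set \<Rightarrow> clause set" where
  "r1 F = (if {} \<in> F then {{}}
           else if \<exists>x. {x} \<in> F then r1 (set_true (SOME x. {x} \<in> F) \<star> F)
           else F)"


section \<open>Boolean functions and their representations\<close>

text \<open>Only the values of \<open>bval f\<close> on the total assignments of \<open>bvars f\<close>, that is, on the \<open>\<phi>\<close>
  with \<open>dom \<phi> = bvars f\<close>, are meaningful.\<close>
record boolfun =
  bvars :: "var set"
  bval :: "pass \<Rightarrow> bool"

definition boolean_function :: "boolfun \<Rightarrow> bool" where
  "boolean_function f \<longleftrightarrow> finite (bvars f)"

definition CNF_representation :: "clause set \<Rightarrow> boolfun \<Rightarrow> bool" where
  "CNF_representation F f \<longleftrightarrow> clause_set F \<and> bvars f \<subseteq> vars F \<and>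
     (\<forall>\<phi>. dom \<phi> = bvars f \<longrightarrow> (satisfiable (\<phi> \<star> F) \<longleftrightarrow> bval f \<phi>))"

definition UR_representation :: "clause set \<Rightarrow> boolfun \<Rightarrow> bool" where
  "UR_representation F f \<longleftrightarrow> CNF_representation F f \<and>
     (\<forall>\<phi>. dom \<phi> \<subseteq> bvars f \<and> \<not> satisfiable (\<phi> \<star> F) \<longrightarrow> r1 (\<phi> \<star> F) = {{}})"

definition forcing_representation :: "clause set \<Rightarrow> boolfun \<Rightarrow> bool" where
  "forcing_representation F f \<longleftrightarrow> CNF_representation F f \<and>
     (\<forall>\<phi>. dom \<phi> \<subseteq> bvars f \<longrightarrow>
        (\<not> satisfiable (\<phi> \<star> F) \<longrightarrow> r1 (\<phi> \<star> F) = {{}}) \<and>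
        (satisfiable (\<phi> \<star> F) \<longrightarrow> (\<forall>x. fst x \<in> bvars f \<longrightarrow> \<not> forced x (r1 (\<phi> \<star> F))))) \<and>
     (\<forall>\<phi>. dom \<phi> = bvars f \<and> satisfiable (\<phi> \<star> F) \<longrightarrow> r1 (\<phi> \<star> F) = {})"


section \<open>Random access machines with unit cost\<close>

text \<open>
  The machine has arrays numbered \<open>0, 1, 2, \<dots>\<close>, each with cells for all natural numbers.
  The array in an access is a constant of the program and only the index is computed, so a given
  program uses a fixed number \<open>k\<close> of arrays; storing cell \<open>i\<close> of array \<open>a\<close> at address \<open>k * i + a\<close>
  yields an ordinary random access machine with one memory, with constant-factor overhead. The
  arithmetic operations are addition and truncated subtraction. Every operation, constant, memory
  access and test costs one unit.
\<close>

type_synonym store = "nat \<Rightarrow> nat \<Rightarrow> nat"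

datatype aexp = Const nat | Read nat aexp | Add aexp aexp | Sub aexp aexp

datatype bexp = Less aexp aexp | Equal aexp aexp | Neg bexp | Conj bexp bexp

datatype com =
    Skip
  | Write nat aexp aexp
  | Seq com com
  | Cond bexp com com
  | While bexp com

fun aval :: "aexp \<Rightarrow> store \<Rightarrow> nat" where
  "aval (Const n) s = n"
| "aval (Read a e) s = s a (aval e s)"
| "aval (Add e1 e2) s = aval e1 s + aval e2 s"
| "aval (Sub e1 e2) s = aval e1 s - aval e2 s"

fun acost :: "aexp \<Rightarrow> nat" where
  "acost (Const n) = 1"
| "acost (Read a e) = 1 + acost e"
| "acost (Add e1 e2) = 1 + acost e1 + acost e2"
| "acost (Sub e1 e2) = 1 + acost e1 + acost e2"

fun btest :: "bexp \<Rightarrow> store \<Rightarrow> bool" where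
  "btest (Less e1 e2) s \<longleftrightarrow> aval e1 s < aval e2 s"
| "btest (Equal e1 e2) s \<longleftrightarrow> aval e1 s = aval e2 s"
| "btest (Neg b) s \<longleftrightarrow> \<not> btest b s"
| "btest (Conj b1 b2) s \<longleftrightarrow> btest b1 s \<and> btest b2 s"

fun bcost :: "bexp \<Rightarrow> nat" where
  "bcost (Less e1 e2) = 1 + acost e1 + acost e2"
| "bcost (Equal e1 e2) = 1 + acost e1 + acost e2"
| "bcost (Neg b) = 1 + bcost b"
| "bcost (Conj b1 b2) = 1 + bcost b1 + bcost b2"

definition upd :: "store \<Rightarrow> nat \<Rightarrow> nat \<Rightarrow> nat \<Rightarrow> store" where
  "upd s a i v = s(a := (s a)(i := v))"

text \<open>\<open>exec c s t s'\<close>: started in store \<open>s\<close>, program \<open>c\<close> halts after exactly \<open>t\<close> time units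
  in store \<open>s'\<close>.\<close>
inductive exec :: "com \<Rightarrow> store \<Rightarrow> nat \<Rightarrow> store \<Rightarrow> bool" where
  Skip: "exec Skip s 1 s"
| Write: "exec (Write a e1 e2) s (1 + acost e1 + acost e2) (upd s a (aval e1 s) (aval e2 s))"
| Seq: "exec c1 s t1 s' \<Longrightarrow> exec c2 s' t2 s'' \<Longrightarrow> exec (Seq c1 c2) s (t1 + t2) s''"
| CondTrue: "btest b s \<Longrightarrow> exec c1 s t s' \<Longrightarrow> exec (Cond b c1 c2) s (1 + bcost b + t) s'"
| CondFalse: "\<not> btest b s \<Longrightarrow> exec c2 s t s' \<Longrightarrow> exec (Cond b c1 c2) s (1 + bcost b + t) s'"
| WhileTrue: "btest b s \<Longrightarrow> exec c s t1 s' \<Longrightarrow> exec (While b c) s' t2 s'' \<Longrightarrow>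
    exec (While b c) s (1 + bcost b + t1 + t2) s''"
| WhileFalse: "\<not> btest b s \<Longrightarrow> exec (While b c) s (1 + bcost b) s"

inductive_cases exec_SkipE: "exec Skip s t s'"
inductive_cases exec_WriteE: "exec (Write a e1 e2) s t s'"
inductive_cases exec_SeqE: "exec (Seq c1 c2) s t s'"
inductive_cases exec_CondE: "exec (Cond b c1 c2) s t s'"
inductive_cases exec_WhileE: "exec (While b c) s t s'"

lemma exec_deterministic:
  "exec c s t s' \<Longrightarrow> exec c s u s'' \<Longrightarrow> u = t \<and> s'' = s'"
proof (induction arbitrary: u s'' rule: exec.induct)
  case (Skip s)
  then show ?case by (auto elim: exec_SkipE)
next
  case (Write a e1 e2 s)
  then show ?case by (auto elim: exec_WriteE)
next
  case (Seq c1 s t1 s1 c2 t2 s2)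
  from Seq.prems obtain v1 v2 r where
    "u = v1 + v2" "exec c1 s v1 r" "exec c2 r v2 s''"
    by (rule exec_SeqE)
  then show ?case using Seq.IH by metis
next
  case (CondTrue b s c1 t s1 c2)
  from CondTrue.prems CondTrue.hyps(1) obtain v where
    "u = 1 + bcost b + v" "exec c1 s v s''"
    by (auto elim: exec_CondE)
  then show ?case using CondTrue.IH by metis
next
  case (CondFalse b s c2 t s1 c1)
  from CondFalse.prems CondFalse.hyps(1) obtain v where
    "u = 1 + bcost b + v" "exec c2 s v s''"
    by (auto elim: exec_CondE)
  then show ?case using CondFalse.IH by metis
next
  case (WhileTrue b s c t1 s1 t2 s2)
  from WhileTrue.prems WhileTrue.hyps(1) obtain v1 v2 r where
    "u = 1 + bcost b + v1 + v2" "exec c s v1 r" "exec (While b c) r v2 s''"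
    by (auto elim: exec_WhileE)
  then show ?case using WhileTrue.IH by metis
next
  case (WhileFalse b s c)
  from WhileFalse.prems WhileFalse.hyps show ?case
    by (auto elim: exec_WhileE)
qed


section \<open>Input and output\<close>

text \<open>Finite sets of variables and clause-sets are given by listings without repetitions, in any
  order. Every list is preceded by its length and a literal occupies two cells, so a clause-set
  \<open>F\<close> has codes of length \<open>1 + card F + 2 * nlits F\<close>.\<close>

definition lit_word :: "lit \<Rightarrow> nat list" where
  "lit_word x = [fst x, of_bool (snd x)]"

definition clause_word :: "lit list \<Rightarrow> nat list" where
  "clause_word c = length c # concat (map lit_word c)"

definition codes_var_set :: "nat list \<Rightarrow> var set \<Rightarrow> bool" where
  "codes_var_set w V \<longleftrightarrow> (\<exists>vs. distinct vs \<and> set vs = V \<and> w = length vs # vs)"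

definition codes_clause_set :: "nat list \<Rightarrow> clause set \<Rightarrow> bool" where
  "codes_clause_set w F \<longleftrightarrow>
     (\<exists>cs. (\<forall>c\<in>set cs. distinct c) \<and> distinct (map set cs) \<and> set (map set cs) = F \<and>
           w = length cs # concat (map clause_word cs))"

text \<open>The input word is in array 0, and all other cells are 0.\<close>
definition input_store :: "nat list \<Rightarrow> store" where
  "input_store w = (\<lambda>a i. if a = 0 \<and> i < length w then w ! i else 0)"

text \<open>The output word is an initial segment of array 1; the length prefixes determine where
  it ends.\<close>
definition has_output :: "store \<Rightarrow> nat list \<Rightarrow> bool" where
  "has_output s w \<longleftrightarrow> (\<forall>i<length w. s 1 i = w ! i)"

end

theory Submission
  imports Defs
begin

text \<open>
  For a literal \<open>x\<close> over the variables of \<open>f\<close>, unit propagation on \<open>F\<close> from \<open>\<phi>\<close> and the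
  complement of \<open>x\<close> is monotone in \<open>\<phi>\<close>, so a monotone circuit computes whether it ends in a conflict:
  for each round, each clause \<open>C\<close> and each \<open>y \<in> C\<close> it has gates for "\<open>y\<close> was known, or the complements
  of all other literals of \<open>C\<close> are known". There are \<open>2 n(F) + 2\<close> simulated literals (one of
  them stands for the conflict), hence as many rounds reach the fixpoint. The representation consists of the
  definitional clauses of all gates of all these circuits, and one clause per circuit by which its
  output implies \<open>x\<close>. Unit propagation evaluates the gates from a total assignment, and from a
  partial one it propagates at least the value true upwards, so that exactly the literals \<open>x\<close> with
  an unsatisfiable \<open>(\<phi> \<union> \<langle>x \<rightarrow> 0\<rangle>) * F\<close> are derived.

  A variable \<open>T\<close> that is set to true by a unit clause takes part as if it were a variable of \<open>f\<close>.
  The circuit for the complement of \<open>T\<close> detects unsatisfiability, also if \<open>f\<close> has no variables.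
\<close>

section \<open>Unit propagation as a closure\<close>

text \<open>The circuits are bounded from above and from below by different means. From above: in a
  model of the gate clauses that agrees with a total \<open>\<phi>\<close>, a wire is true only if
  its literal is in the closure; so an output wire can be true against its \<open>x\<close> only if
  \<open>\<phi>\<close> itself is refuted, and the output clauses exclude no admissible assignment.
  From below: unit propagation reaches the closure after enough rounds. Only these two bounds are
  used, so a round may already read wires that it has itself renewed. Each gate has clauses in both
  directions because at a total assignment propagation must also fix the gates that are false, or
  else clauses would remain. The time bound counts gates. A clause \<open>C\<close> gets one
  conjunction for each of its literals as head and one for the conflict, each of at most
  \<open>|C|\<close> wires, hence O((|C| + 1)^2) gates; over all of \<open>F\<close> this is O(p *
  nlits F), up to a constant for the empty clause. Rounds contribute the factor n(F), circuits the
  factor n(f). The output must list clauses without repetition. A second constant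
  \<open>Suc T\<close> serves to keep them apart.\<close>

inductive_set derived :: "lit set \<Rightarrow> clause set \<Rightarrow> lit set" for A F where
  base: "x \<in> A \<Longrightarrow> x \<in> derived A F"
| step: "C \<in> F \<Longrightarrow> x \<in> C \<Longrightarrow> \<forall>y\<in>C - {x}. compl y \<in> derived A F \<Longrightarrow> x \<in> derived A F"

text \<open>The closure does not stop at a conflict and may contain complementary literals; a
  conflict is read off afterwards. So, unlike \<open>r1\<close>, both notions are monotone in
  \<open>A\<close>, which is what a monotone circuit needs.\<close>

definition refuted :: "lit set \<Rightarrow> clause set \<Rightarrow> bool" where
  "refuted A F \<longleftrightarrow> (\<exists>C\<in>F. \<forall>y\<in>C. compl y \<in> derived A F)"

definition models :: "(var \<Rightarrow> bool) \<Rightarrow> clause set \<Rightarrow> bool" where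
  "models \<beta> F \<longleftrightarrow> (\<forall>C\<in>F. \<exists>l\<in>C. \<beta> (fst l) = snd l)"

lemma compl_simps [simp]:
  "fst (compl x) = fst x" "snd (compl x) \<longleftrightarrow> \<not> snd x" "compl (compl x) = x" "compl x \<noteq> x"
  "compl x = compl y \<longleftrightarrow> x = y" "compl (v, b) = (v, \<not> b)"
  by (auto simp: compl_def prod_eq_iff)

lemma lit_eq_or_compl: "fst x = fst y \<Longrightarrow> y = x \<or> y = compl x"
  by (cases x; cases y) auto

text \<open>This lets a propagation run be followed step by step: what it has set so far may count
  as assumed.\<close>

lemma derived_cut:
  assumes "A' \<subseteq> derived A F" "F' \<subseteq> F"
  shows "derived A' F' \<subseteq> derived A F"
proof
  fix x assume "x \<in> derived A' F'"
  then show "x \<in> derived A F"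
    by induction (use assms in \<open>auto intro: derived.step\<close>)
qed

lemma derived_mono: "A' \<subseteq> A \<Longrightarrow> F' \<subseteq> F \<Longrightarrow> derived A' F' \<subseteq> derived A F"
  by (rule derived_cut) (auto intro: derived.base)

lemma refuted_mono: "refuted A' F \<Longrightarrow> A' \<subseteq> A \<Longrightarrow> refuted A F"
  unfolding refuted_def using derived_mono[of A' A F F] by blast

text \<open>The literal \<open>l\<close> complements no literal of a clause, so it supports no
  further step. This serves the circuits for \<open>T\<close>, which assume a literal over a
  variable outside \<open>F\<close>.\<close>

lemma derived_insert_foreign:
  assumes "fst l \<notin> vars F"
  shows "derived (insert l A) F \<subseteq> insert l (derived A F)"
proof
  fix x assume "x \<in> derived (insert l A) F"
  then show "x \<in> insert l (derived A F)"
  proof induction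
    case (base x)
    then show ?case by (auto intro: derived.base)
  next
    case (step C x)
    have "compl y \<in> derived A F" if "y \<in> C - {x}" for y
    proof -
      have "fst y \<in> vars F" using that step(1) by (auto simp: vars_def)
      then have "compl y \<noteq> l" using assms by auto
      then show ?thesis using step(3) that by auto
    qed
    then have "x \<in> derived A F" using step(1,2) by (blast intro: derived.step)
    then show ?case by blast
  qed
qed

lemma refuted_insert_foreign:
  assumes "fst l \<notin> vars F" "refuted (insert l A) F"
  shows "refuted A F"
proof -
  obtain C where C: "C \<in> F" "\<forall>y\<in>C. compl y \<in> derived (insert l A) F"
    using assms(2) by (auto simp: refuted_def)
  have "compl y \<in> derived A F" if "y \<in> C" for y
  proof -
    have "fst y \<in> vars F" using that C(1) by (auto simp: vars_def)
    then have "compl y \<noteq> l" using assms by auto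
    then show ?thesis using C(2) that derived_insert_foreign[OF assms(1), of A] by auto
  qed
  then show ?thesis using C(1) unfolding refuted_def by blast
qed

section \<open>Models against unit propagation\<close>

lemma derived_sound:
  assumes "models \<beta> F" "\<forall>l\<in>A. \<beta> (fst l) = snd l" "x \<in> derived A F"
  shows "\<beta> (fst x) = snd x"
  using assms(3)
proof induction
  case (base x)
  then show ?case using assms(2) by auto
next
  case (step C x)
  obtain l where l: "l \<in> C" "\<beta> (fst l) = snd l"
    using assms(1) step(1) by (auto simp: models_def)
  then show ?case using step(3) by fastforce
qed

lemma not_refuted_if_models:
  assumes "models \<beta> F" "\<forall>l\<in>A. \<beta> (fst l) = snd l"
  shows "\<not> refuted A F"
proof
  assume "refuted A F"
  then obtain C where C: "C \<in> F" "\<forall>y\<in>C. compl y \<in> derived A F"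
    by (auto simp: refuted_def)
  obtain l where "l \<in> C" "\<beta> (fst l) = snd l"
    using assms(1) C(1) by (auto simp: models_def)
  then show False using derived_sound[OF assms, of "compl l"] C(2) by auto
qed

lemma finite_vars: "clause_set F \<Longrightarrow> finite (vars F)"
  by (auto simp: clause_set_def is_clause_def vars_def)

text \<open>Total assignments are easier to modify and combine than residual clause-sets, so
  satisfiability after \<open>\<phi>\<close> is henceforth treated through models of
  \<open>F\<close> itself.\<close>

lemma satisfiable_apply_iff:
  assumes "clause_set F"
  shows "satisfiable (\<phi> \<star> F) \<longleftrightarrow> (\<exists>\<beta>. models \<beta> F \<and> (\<forall>l\<in>true_lits \<phi>. \<beta> (fst l) = snd l))"
proof
  assume "satisfiable (\<phi> \<star> F)"
  then obtain \<theta> where \<theta>: "\<theta> \<star> \<phi> \<star> F = {}" by (auto simp: satisfiable_def)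
  \<comment> \<open>A variable set by neither assignment gets the value false; every clause has a
    true literal among the set ones.\<close>
  define \<beta> where "\<beta> = (\<lambda>v. case \<phi> v of Some b \<Rightarrow> b | None \<Rightarrow> \<theta> v = Some True)"
  have "\<exists>l\<in>C. \<beta> (fst l) = snd l" if C: "C \<in> F" for C
  proof (cases "C \<inter> true_lits \<phi> = {}")
    case True
    then have "(C - false_lits \<phi>) \<in> \<phi> \<star> F" using C by (auto simp: apply_pass_def)
    then have "(C - false_lits \<phi>) \<inter> true_lits \<theta> \<noteq> {}"
      using \<theta> by (auto simp: apply_pass_def)
    then obtain l where l: "l \<in> C" "l \<notin> false_lits \<phi>" "l \<in> true_lits \<theta>" by auto
    with True have "l \<notin> true_lits \<phi>" by auto
    with l have "\<phi> (fst l) = None"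
      by (cases "\<phi> (fst l)") (auto simp: true_lits_def false_lits_def)
    with l show ?thesis by (auto simp: \<beta>_def true_lits_def intro!: bexI[of _ l])
  next
    case False
    then obtain l where "l \<in> C" "\<phi> (fst l) = Some (snd l)" by (auto simp: true_lits_def)
    then show ?thesis by (auto simp: \<beta>_def intro!: bexI[of _ l])
  qed
  then show "\<exists>\<beta>. models \<beta> F \<and> (\<forall>l\<in>true_lits \<phi>. \<beta> (fst l) = snd l)"
    by (intro exI[of _ \<beta>]) (auto simp: models_def true_lits_def \<beta>_def)
next
  assume "\<exists>\<beta>. models \<beta> F \<and> (\<forall>l\<in>true_lits \<phi>. \<beta> (fst l) = snd l)"
  then obtain \<beta> where \<beta>: "models \<beta> F" "\<forall>l\<in>true_lits \<phi>. \<beta> (fst l) = snd l" by auto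
  \<comment> \<open>The restriction to \<open>vars F\<close> gives the finite domain that
    \<open>satisfiable\<close> asks for.\<close>
  define \<theta> where "\<theta> = (\<lambda>v. if v \<in> vars F then Some (\<beta> v) else None)"
  have "dom \<theta> = vars F" by (auto simp: \<theta>_def dom_def)
  moreover have "\<theta> \<star> \<phi> \<star> F = {}"
  proof -
    have "(C - false_lits \<phi>) \<inter> true_lits \<theta> \<noteq> {}" if C: "C \<in> F" for C
    proof -
      obtain l where l: "l \<in> C" "\<beta> (fst l) = snd l" using \<beta>(1) C by (auto simp: models_def)
      have "l \<notin> false_lits \<phi>"
      proof
        assume "l \<in> false_lits \<phi>"
        then have "compl l \<in> true_lits \<phi>" by (auto simp: true_lits_def false_lits_def)
        then show False using \<beta>(2) l by fastforce
      qed
      moreover have "fst l \<in> vars F" using l C by (auto simp: vars_def)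
      then have "l \<in> true_lits \<theta>" using l by (auto simp: true_lits_def \<theta>_def)
      ultimately show ?thesis using l by auto
    qed
    then show ?thesis by (auto simp: apply_pass_def)
  qed
  ultimately show "satisfiable (\<phi> \<star> F)"
    using finite_vars[OF assms] unfolding satisfiable_def by metis
qed

section \<open>Unit propagation \<open>r1\<close> as the closure\<close>

lemma set_true_apply:
  assumes "\<phi> (fst x) = None"
  shows "set_true x \<star> \<phi> \<star> F = \<phi>(fst x \<mapsto> snd x) \<star> F"
proof -
  let ?\<psi> = "\<phi>(fst x \<mapsto> snd x)"
  have f: "false_lits ?\<psi> = false_lits \<phi> \<union> false_lits (set_true x)"
    using assms by (auto simp: false_lits_def set_true_def)
  have t: "true_lits ?\<psi> = true_lits \<phi> \<union> true_lits (set_true x)"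
    using assms by (auto simp: true_lits_def set_true_def)
  \<comment> \<open>As \<open>x\<close> is unassigned, \<open>\<phi>\<close> has deleted no literal
    that \<open>set_true x\<close> satisfies. With \<open>x\<close> assigned, the update could
    override the old value, while the composition keeps it.\<close>
  have "true_lits (set_true x) \<inter> false_lits \<phi> = {}"
    using assms by (auto simp: true_lits_def false_lits_def set_true_def split: if_splits)
  then have "(C - false_lits \<phi>) \<inter> true_lits (set_true x) = C \<inter> true_lits (set_true x)" for C
    by auto
  then have cond: "(C - false_lits \<phi>) \<inter> true_lits (set_true x) = {} \<longleftrightarrow>
      C \<inter> true_lits (set_true x) = {}" for C
    by simp
  have diff: "C - (false_lits \<phi> \<union> false_lits (set_true x)) =
      C - false_lits \<phi> - false_lits (set_true x)" for C
    by auto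
  have "set_true x \<star> \<phi> \<star> F = {C - false_lits \<phi> - false_lits (set_true x) | C.
      C \<in> F \<and> C \<inter> true_lits \<phi> = {} \<and> (C - false_lits \<phi>) \<inter> true_lits (set_true x) = {}}"
    unfolding apply_pass_def by blast
  then show ?thesis unfolding apply_pass_def f t diff cond Int_Un_distrib by simp
qed

lemma no_occurrence_after_apply:
  assumes "C \<in> \<phi> \<star> F" "x \<in> C"
  shows "\<phi> (fst x) = None"
proof (cases "\<phi> (fst x)")
  case (Some b)
  then show ?thesis
    using assms by (cases "b = snd x") (auto simp: apply_pass_def true_lits_def false_lits_def)
qed

text \<open>A run of \<open>r1\<close> is recorded by one growing assignment applied to the fixed
  \<open>F\<close>. Every step assigns a variable of \<open>F\<close>, which yields termination, and
  the literal set lies in the closure whichever unit clause is chosen.\<close>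

lemma r1_of_apply:
  assumes "clause_set F"
  shows "\<exists>\<psi>. \<phi> \<subseteq>\<^sub>m \<psi> \<and> true_lits \<psi> \<subseteq> derived (true_lits \<phi>) F \<and>
    (if {} \<in> \<psi> \<star> F then r1 (\<phi> \<star> F) = {{}} else r1 (\<phi> \<star> F) = \<psi> \<star> F \<and> (\<forall>x. {x} \<notin> \<psi> \<star> F))"
proof (induction "card (vars F - dom \<phi>)" arbitrary: \<phi> rule: less_induct)
  case less
  have base: "true_lits \<phi> \<subseteq> derived (true_lits \<phi>) F" by (auto intro: derived.base)
  show ?case
  proof (cases "{} \<notin> \<phi> \<star> F \<and> (\<exists>x. {x} \<in> \<phi> \<star> F)")
    case False
    then show ?thesis
      using base by (intro exI[of _ \<phi>]) (auto simp: r1.simps[of "\<phi> \<star> F"])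
  next
    case True
    define x where "x = (SOME x. {x} \<in> \<phi> \<star> F)"
    have x: "{x} \<in> \<phi> \<star> F" using True unfolding x_def by (metis someI_ex)
    have none: "\<phi> (fst x) = None" using no_occurrence_after_apply[OF x] by simp
    let ?\<psi> = "\<phi>(fst x \<mapsto> snd x)"
    have r1: "r1 (\<phi> \<star> F) = r1 (?\<psi> \<star> F)"
      using True by (simp add: r1.simps[of "\<phi> \<star> F"] set_true_apply[where \<phi> = \<phi>, OF none] flip: x_def)
    obtain C where C: "C \<in> F" "C - false_lits \<phi> = {x}" using x by (auto simp: apply_pass_def)
    have "compl y \<in> derived (true_lits \<phi>) F" if "y \<in> C - {x}" for y
    proof -
      have "y \<in> false_lits \<phi>" using that C(2) by blast
      then show ?thesis by (intro derived.base) (auto simp: true_lits_def false_lits_def)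
    qed
    then have dx: "x \<in> derived (true_lits \<phi>) F" using C by (blast intro: derived.step)
    have "true_lits ?\<psi> \<subseteq> insert x (true_lits \<phi>)"
      by (auto simp: true_lits_def prod_eq_iff split: if_splits)
    then have d: "derived (true_lits ?\<psi>) F \<subseteq> derived (true_lits \<phi>) F"
      using dx base by (intro derived_cut) auto
    have "fst x \<in> vars F" using C by (auto simp: vars_def)
    then have "card (vars F - dom ?\<psi>) < card (vars F - dom \<phi>)"
      using none finite_vars[OF assms] by (intro psubset_card_mono) auto
    from less[OF this] obtain \<psi>' where \<psi>':
      "?\<psi> \<subseteq>\<^sub>m \<psi>'" "true_lits \<psi>' \<subseteq> derived (true_lits ?\<psi>) F"
      "if {} \<in> \<psi>' \<star> F then r1 (\<phi> \<star> F) = {{}} else r1 (\<phi> \<star> F) = \<psi>' \<star> F \<and> (\<forall>x. {x} \<notin> \<psi>' \<star> F)"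
      unfolding r1 by blast
    have "\<phi> \<subseteq>\<^sub>m \<psi>'" using \<psi>'(1) none by (auto simp: map_le_def dom_def split: if_splits)
    with \<psi>' d show ?thesis by blast
  qed
qed

text \<open>At the end of a run without conflict no unit clause remains, so the assignment is closed
  under the rule \<open>step\<close>; hence the run has computed the whole closure and not just a
  part of it.\<close>

lemma r1_of_apply_cases:
  assumes "clause_set F"
  obtains
    (refuted) "refuted (true_lits \<phi>) F" "r1 (\<phi> \<star> F) = {{}}"
  | (closed) \<psi> where "\<not> refuted (true_lits \<phi>) F" "\<phi> \<subseteq>\<^sub>m \<psi>"
      "true_lits \<psi> = derived (true_lits \<phi>) F" "{} \<notin> \<psi> \<star> F" "r1 (\<phi> \<star> F) = \<psi> \<star> F"
proof -
  obtain \<psi> where \<psi>: "\<phi> \<subseteq>\<^sub>m \<psi>" "true_lits \<psi> \<subseteq> derived (true_lits \<phi>) F"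
    "if {} \<in> \<psi> \<star> F then r1 (\<phi> \<star> F) = {{}} else r1 (\<phi> \<star> F) = \<psi> \<star> F \<and> (\<forall>x. {x} \<notin> \<psi> \<star> F)"
    using r1_of_apply[OF assms, of \<phi>] by blast
  have false_iff: "y \<in> false_lits \<psi> \<longleftrightarrow> compl y \<in> true_lits \<psi>" for y
    by (auto simp: true_lits_def false_lits_def)
  show thesis
  proof (cases "{} \<in> \<psi> \<star> F")
    case True
    then obtain C where C: "C \<in> F" "C \<subseteq> false_lits \<psi>" by (auto simp: apply_pass_def)
    then have "\<forall>y\<in>C. compl y \<in> derived (true_lits \<phi>) F" using false_iff \<psi>(2) by blast
    with C(1) have "refuted (true_lits \<phi>) F" by (auto simp only: refuted_def)
    then show thesis using refuted \<psi>(3) True by auto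
  next
    case False
    have unit: "{x} \<notin> \<psi> \<star> F" for x using \<psi>(3) False by metis
    have sub: "derived (true_lits \<phi>) F \<subseteq> true_lits \<psi>"
    proof
      fix x assume "x \<in> derived (true_lits \<phi>) F"
      then show "x \<in> true_lits \<psi>"
      proof induction
        case (base x)
        then show ?case using \<psi>(1) by (force simp: map_le_def true_lits_def dom_def)
      next
        case (step C x)
        have oth: "y \<in> false_lits \<psi>" if "y \<in> C - {x}" for y using step(3) that false_iff by blast
        \<comment> \<open>If \<open>x\<close> were not set to true, \<open>C\<close> would survive
          and shrink to the empty clause or to the unit clause of \<open>x\<close>.\<close>
        show ?case
        proof (rule ccontr)
          assume nx: "x \<notin> true_lits \<psi>"
          have "y \<notin> true_lits \<psi>" if "y \<in> C" for y
            using oth[of y] nx that by (cases "y = x") (auto simp: true_lits_def false_lits_def)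
          then have "C - false_lits \<psi> \<in> \<psi> \<star> F" using step(1) by (auto simp: apply_pass_def)
          moreover have "C - false_lits \<psi> = {} \<or> C - false_lits \<psi> = {x}" using oth by blast
          ultimately show False using False unit by metis
        qed
      qed
    qed
    then have eq: "true_lits \<psi> = derived (true_lits \<phi>) F" using \<psi>(2) by blast
    have "\<not> refuted (true_lits \<phi>) F"
    proof
      assume "refuted (true_lits \<phi>) F"
      then obtain C where C: "C \<in> F" "\<forall>y\<in>C. compl y \<in> true_lits \<psi>"
        unfolding refuted_def eq by blast
      then have "C \<subseteq> false_lits \<psi>" using false_iff by blast
      moreover from this have "C \<inter> true_lits \<psi> = {}"
        by (auto simp: true_lits_def false_lits_def)
      ultimately have "{} \<in> \<psi> \<star> F" using C(1) by (auto simp: apply_pass_def)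
      with False show False by simp
    qed
    then show thesis using closed \<psi> False eq by simp
  qed
qed

lemma r1_eq_bot_iff:
  assumes "clause_set F"
  shows "r1 (\<phi> \<star> F) = {{}} \<longleftrightarrow> refuted (true_lits \<phi>) F"
  by (rule r1_of_apply_cases[OF assms, of \<phi>]) auto

lemma apply_pass_foreign:
  assumes "\<And>C l. C \<in> H \<Longrightarrow> l \<in> C \<Longrightarrow> \<theta> (fst l) = None"
  shows "\<theta> \<star> H = H"
proof -
  have "C - false_lits \<theta> = C" "C \<inter> true_lits \<theta> = {}" if "C \<in> H" for C
    using assms[OF that] by (auto simp: false_lits_def true_lits_def)
  then show ?thesis unfolding apply_pass_def by (auto, metis)
qed

text \<open>This reduces the task to closures on \<open>F\<close> and \<open>G\<close>. That
  \<open>F\<close> is a UR-representation turns an unrefuted \<open>\<phi>\<close> into a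
  satisfiable one; \<open>det\<close> empties the clause-set at total assignments;
  \<open>ext\<close> is asked for total assignments only, the partial ones being extended by a model
  of \<open>F\<close>.\<close>

lemma forcing_representationI:
  assumes UR: "UR_representation F f" and G: "clause_set G" "bvars f \<subseteq> vars G"
    and det: "\<And>\<phi> v. dom \<phi> = bvars f \<Longrightarrow> v \<in> vars G \<Longrightarrow> \<exists>b. (v, b) \<in> derived (true_lits \<phi>) G"
    and ext: "\<And>\<phi>. dom \<phi> = bvars f \<Longrightarrow> \<not> refuted (true_lits \<phi>) F \<Longrightarrow>
      \<exists>\<beta>. models \<beta> G \<and> (\<forall>l\<in>true_lits \<phi>. \<beta> (fst l) = snd l)"
    and bot: "\<And>\<phi>. dom \<phi> \<subseteq> bvars f \<Longrightarrow> refuted (true_lits \<phi>) F \<Longrightarrow> refuted (true_lits \<phi>) G"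
    and force: "\<And>\<phi> x. dom \<phi> \<subseteq> bvars f \<Longrightarrow> fst x \<in> bvars f \<Longrightarrow>
      refuted (insert (compl x) (true_lits \<phi>)) F \<Longrightarrow> x \<in> derived (true_lits \<phi>) G"
  shows "forcing_representation G f"
proof -
  have F: "clause_set F" using UR by (auto simp: UR_representation_def CNF_representation_def)
  have satF: "satisfiable (\<phi> \<star> F) \<longleftrightarrow> \<not> refuted (true_lits \<phi>) F" if "dom \<phi> \<subseteq> bvars f" for \<phi>
  proof
    assume "satisfiable (\<phi> \<star> F)"
    then show "\<not> refuted (true_lits \<phi>) F"
      unfolding satisfiable_apply_iff[OF F] using not_refuted_if_models by blast
  next
    assume "\<not> refuted (true_lits \<phi>) F"
    then have "r1 (\<phi> \<star> F) \<noteq> {{}}" using r1_eq_bot_iff[OF F] by blast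
    then show "satisfiable (\<phi> \<star> F)" using UR that by (auto simp: UR_representation_def)
  qed
  have satG: "satisfiable (\<phi> \<star> G) \<longleftrightarrow> \<not> refuted (true_lits \<phi>) F" if dom: "dom \<phi> \<subseteq> bvars f" for \<phi>
  proof
    assume "satisfiable (\<phi> \<star> G)"
    then have "\<not> refuted (true_lits \<phi>) G"
      unfolding satisfiable_apply_iff[OF G(1)] using not_refuted_if_models by blast
    then show "\<not> refuted (true_lits \<phi>) F" using bot[OF dom] by blast
  next
    assume "\<not> refuted (true_lits \<phi>) F"
    then obtain \<beta> where \<beta>: "models \<beta> F" "\<forall>l\<in>true_lits \<phi>. \<beta> (fst l) = snd l"
      using satF[OF dom] satisfiable_apply_iff[OF F] by blast
    \<comment> \<open>The total extension takes its values from a model of \<open>F\<close>, hence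
      it is again unrefuted.\<close>
    define \<phi>' where "\<phi>' = (\<lambda>v. if v \<in> bvars f then Some (\<beta> v) else None)"
    have dom': "dom \<phi>' = bvars f" by (auto simp: \<phi>'_def dom_def)
    have sub: "true_lits \<phi> \<subseteq> true_lits \<phi>'"
    proof
      fix l assume l: "l \<in> true_lits \<phi>"
      then have "fst l \<in> bvars f" using dom by (auto simp: true_lits_def)
      then show "l \<in> true_lits \<phi>'" using l \<beta>(2) by (auto simp: true_lits_def \<phi>'_def)
    qed
    have "\<forall>l\<in>true_lits \<phi>'. \<beta> (fst l) = snd l"
      by (auto simp: true_lits_def \<phi>'_def split: if_splits)
    then have "\<not> refuted (true_lits \<phi>') F" using not_refuted_if_models[OF \<beta>(1)] by blast
    from ext[OF dom' this] show "satisfiable (\<phi> \<star> G)"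
      unfolding satisfiable_apply_iff[OF G(1)] using sub by blast
  qed
  have "\<not> forced x (r1 (\<phi> \<star> G))"
    if dom: "dom \<phi> \<subseteq> bvars f" and sat: "satisfiable (\<phi> \<star> G)" and x: "fst x \<in> bvars f" for \<phi> x
  proof (rule r1_of_apply_cases[OF G(1), of \<phi>])
    assume "refuted (true_lits \<phi>) G"
    then show ?thesis
      using sat unfolding satisfiable_apply_iff[OF G(1)] using not_refuted_if_models by blast
  next
    fix \<psi> assume \<psi>: "\<phi> \<subseteq>\<^sub>m \<psi>" "true_lits \<psi> = derived (true_lits \<phi>) G" "r1 (\<phi> \<star> G) = \<psi> \<star> G"
    show ?thesis
    proof (cases "\<psi> (fst x)")
      case None
      have "\<phi> (fst x) = None" using \<psi>(1) None by (metis domIff map_le_def)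
      let ?\<phi> = "\<phi>(fst x \<mapsto> \<not> snd x)"
      let ?\<psi> = "\<psi>(fst x \<mapsto> \<not> snd x)"
      have tl: "true_lits (\<theta>(fst x \<mapsto> \<not> snd x)) = insert (compl x) (true_lits \<theta>)"
        if "\<theta> (fst x) = None" for \<theta> :: pass
        using that by (auto simp: true_lits_def compl_def prod_eq_iff split: if_splits)
      note tl\<phi> = tl[where \<theta> = \<phi>, OF \<open>\<phi> (fst x) = None\<close>]
      note tl\<psi> = tl[where \<theta> = \<psi>, OF None]
      \<comment> \<open>An unassigned \<open>x\<close> is not derived, so by \<open>force\<close>
        setting it to false is not refuted. A model of \<open>G\<close> for that assignment also
        satisfies, by soundness, all literals propagated from \<open>\<phi>\<close> alone, hence the
        residual clause-set with \<open>x\<close> false.\<close>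
      have "x \<notin> true_lits \<psi>" using None by (auto simp: true_lits_def)
      then have "\<not> refuted (true_lits ?\<phi>) F"
        unfolding tl\<phi> \<psi>(2) using force[OF dom x] by blast
      moreover have "dom ?\<phi> \<subseteq> bvars f" using dom x by auto
      ultimately obtain \<beta> where \<beta>: "models \<beta> G" "\<forall>l\<in>true_lits ?\<phi>. \<beta> (fst l) = snd l"
        using satG satisfiable_apply_iff[OF G(1)] by blast
      then have "\<forall>l\<in>true_lits \<phi>. \<beta> (fst l) = snd l"
        unfolding tl\<phi> by blast
      then have "\<forall>l\<in>true_lits \<psi>. \<beta> (fst l) = snd l"
        unfolding \<psi>(2) using derived_sound[OF \<beta>(1)] by blast
      then have "\<forall>l\<in>true_lits ?\<psi>. \<beta> (fst l) = snd l"
        using \<beta>(2) unfolding tl\<psi> tl\<phi> by blast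
      then have "satisfiable (?\<psi> \<star> G)" using \<beta>(1) satisfiable_apply_iff[OF G(1)] by blast
      moreover have "set_false x = set_true (compl x)" by (simp add: set_false_def set_true_def)
      then have "set_false x \<star> \<psi> \<star> G = ?\<psi> \<star> G"
        using set_true_apply[where \<phi> = \<psi> and x = "compl x" and F = G] None by simp
      ultimately show ?thesis by (simp add: forced_def \<psi>(3))
    next
      case (Some b)
      \<comment> \<open>The variable of \<open>x\<close> no longer occurs, so \<open>x\<close> would
        be forced only if the residual clause-set were unsatisfiable.\<close>
      have "set_false x \<star> \<psi> \<star> G = \<psi> \<star> G"
      proof (rule apply_pass_foreign)
        fix C l assume "C \<in> \<psi> \<star> G" "l \<in> C"
        then have "\<psi> (fst l) = None" by (rule no_occurrence_after_apply)
        then have "fst l \<noteq> fst x" using Some by auto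
        then show "set_false x (fst l) = None" by (simp add: set_false_def)
      qed
      moreover obtain \<beta> where \<beta>: "models \<beta> G" "\<forall>l\<in>true_lits \<phi>. \<beta> (fst l) = snd l"
        using sat satisfiable_apply_iff[OF G(1)] by blast
      then have "\<forall>l\<in>true_lits \<psi>. \<beta> (fst l) = snd l"
        unfolding \<psi>(2) using derived_sound[OF \<beta>] by blast
      then have "satisfiable (\<psi> \<star> G)" using \<beta>(1) satisfiable_apply_iff[OF G(1)] by blast
      ultimately show ?thesis by (simp add: forced_def \<psi>(3))
    qed
  qed
  moreover have "r1 (\<phi> \<star> G) = {{}}" if "dom \<phi> \<subseteq> bvars f" "\<not> satisfiable (\<phi> \<star> G)" for \<phi>
    using that satG bot r1_eq_bot_iff[OF G(1)] by blast
  moreover have "r1 (\<phi> \<star> G) = {}" if dom: "dom \<phi> = bvars f" and sat: "satisfiable (\<phi> \<star> G)" for \<phi>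
  proof (rule r1_of_apply_cases[OF G(1), of \<phi>])
    assume "refuted (true_lits \<phi>) G"
    then show ?thesis
      using sat unfolding satisfiable_apply_iff[OF G(1)] using not_refuted_if_models by blast
  next
    fix \<psi> assume \<psi>: "true_lits \<psi> = derived (true_lits \<phi>) G" "{} \<notin> \<psi> \<star> G" "r1 (\<phi> \<star> G) = \<psi> \<star> G"
    have False if C: "C \<in> \<psi> \<star> G" for C
    proof -
      obtain l where l: "l \<in> C" using C \<psi>(2) by (metis ex_in_conv)
      have "fst l \<in> vars G" using C l by (auto simp: apply_pass_def vars_def)
      then obtain b where "(fst l, b) \<in> true_lits \<psi>" using det[OF dom] \<psi>(1) by blast
      then show False using no_occurrence_after_apply[OF C l] by (simp add: true_lits_def)
    qed
    then show ?thesis using \<psi>(3) by auto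
  qed
  moreover have "CNF_representation G f"
    using UR G satF satG by (auto simp: CNF_representation_def UR_representation_def)
  ultimately show ?thesis unfolding forcing_representation_def by blast
qed

section \<open>The circuits\<close>

text \<open>State of the generator. Wires are variables: \<open>cur y\<close> carries the present
  value of \<open>y\<close>, \<open>acc\<close> the conjunction under construction, and
  \<open>nxt\<close> is the next fresh one. The construction is a sequence of state transformers so
  that the machine program can follow it step by step.\<close>

record gen =
  nxt :: nat
  acc :: nat
  cur :: "lit \<Rightarrow> nat"
  out :: "lit list list"

text \<open>Definitional clauses for \<open>g\<close> as the conjunction of \<open>l1\<close> and
  \<open>l2\<close>. With all three literals negated they define a disjunction, so one form of gate
  suffices.\<close>

definition gate :: "lit \<Rightarrow> lit \<Rightarrow> lit \<Rightarrow> lit list list" where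
  "gate g l1 l2 = [[compl g, l1], [compl g, l2], [g, compl l1, compl l2]]"

definition add_gate :: "bool \<Rightarrow> lit \<Rightarrow> lit \<Rightarrow> gen \<Rightarrow> gen" where
  "add_gate b l1 l2 S = S\<lparr>nxt := Suc (nxt S), out := out S @ gate (nxt S, b) l1 l2\<rparr>"

definition conj_step :: "lit \<Rightarrow> gen \<Rightarrow> gen" where
  "conj_step y S = (add_gate True (acc S, True) (cur S y, True) S)\<lparr>acc := nxt S\<rparr>"

definition disj_step :: "lit \<Rightarrow> gen \<Rightarrow> gen" where
  "disj_step y S = (add_gate False (cur S y, False) (acc S, False) S)\<lparr>cur := (cur S)(y := nxt S)\<rparr>"

text \<open>Inputs are copied by a gate because \<open>cur\<close> names variables, while the source
  may be a negative literal or the constant false. The second input is the constant true, over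
  another variable than the first, so that the gate clauses are proper and distinct. The complement
  of \<open>x\<close> is the assumption of the circuit; any other literal outside \<open>V\<close>
  starts as false.\<close>

definition init_step :: "nat \<Rightarrow> var set \<Rightarrow> lit \<Rightarrow> lit \<Rightarrow> gen \<Rightarrow> gen" where
  "init_step T V x y S =
     (add_gate True (if y = compl x then (T, True) else if fst y \<in> V then y else (T, False)) (Suc T, True) S)
       \<lparr>cur := (cur S)(y := nxt S)\<rparr>"

definition init_var :: "nat \<Rightarrow> var set \<Rightarrow> lit \<Rightarrow> var \<Rightarrow> gen \<Rightarrow> gen" where
  "init_var T V x v S = init_step T V x (v, True) (init_step T V x (v, False) S)"

definition rule_body :: "lit list \<Rightarrow> nat \<Rightarrow> nat \<Rightarrow> gen \<Rightarrow> gen" where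
  "rule_body c j n S =
     fold (\<lambda>k S. if k = j then S else conj_step (compl (c ! k)) S) [0..<n] S"

text \<open>The index \<open>length c\<close> stands for the conflict, encoded as the literal
  \<open>(Suc T, False)\<close>: for it no position is left out of the body.\<close>

definition rule_head :: "nat \<Rightarrow> lit list \<Rightarrow> nat \<Rightarrow> lit" where
  "rule_head T c j = (if j < length c then c ! j else (Suc T, False))"

definition rule_step :: "nat \<Rightarrow> lit list \<Rightarrow> nat \<Rightarrow> gen \<Rightarrow> gen" where
  "rule_step T c j S = disj_step (rule_head T c j) (rule_body c j (length c) (S\<lparr>acc := T\<rparr>))"

definition clause_step :: "nat \<Rightarrow> lit list \<Rightarrow> gen \<Rightarrow> gen" where
  "clause_step T c = fold (rule_step T c) [0..<Suc (length c)]"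

definition round_step :: "nat \<Rightarrow> lit list list \<Rightarrow> gen \<Rightarrow> gen" where
  "round_step T cs = fold (clause_step T) cs"

text \<open>\<open>Suc T\<close> is fixed to true, so the clause says that the conflict implies
  \<open>x\<close>. Without its third literal it could equal a clause of an input gate, for instance
  when \<open>F\<close> has no clauses.\<close>

definition final_step :: "nat \<Rightarrow> lit \<Rightarrow> gen \<Rightarrow> gen" where
  "final_step T x S = S\<lparr>out := out S @ [[(cur S (Suc T, False), False), x, (Suc T, False)]]\<rparr>"

definition circuit :: "nat \<Rightarrow> var set \<Rightarrow> var list \<Rightarrow> lit list list \<Rightarrow> lit \<Rightarrow> gen \<Rightarrow> gen" where
  "circuit T V ws cs x S =
     final_step T x ((round_step T cs ^^ (2 * length ws)) (fold (init_var T V x) ws S))"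

text \<open>The zeros are the contents of fresh memory cells; every circuit sets \<open>cur\<close>
  on the simulated literals, and every rule sets \<open>acc\<close>, before reading them.\<close>

definition start :: "nat \<Rightarrow> gen" where
  "start T = \<lparr>nxt = Suc (Suc T), acc = 0, cur = (\<lambda>_. 0), out = [[(T, True)], [(Suc T, True)]]\<rparr>"

definition circuits :: "nat \<Rightarrow> var set \<Rightarrow> var list \<Rightarrow> lit list list \<Rightarrow> var \<Rightarrow> gen \<Rightarrow> gen" where
  "circuits T V ws cs v S = circuit T V ws cs (v, True) (circuit T V ws cs (v, False) S)"

definition clset :: "gen \<Rightarrow> clause set" where
  "clset S = set ` set (out S)"

definition agrees :: "(var \<Rightarrow> bool) \<Rightarrow> pass \<Rightarrow> bool" where
  "agrees \<beta> \<phi> \<longleftrightarrow> (\<forall>l\<in>true_lits \<phi>. \<beta> (fst l) = snd l)"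

abbreviation ders :: "pass \<Rightarrow> gen \<Rightarrow> lit set" where
  "ders \<phi> S \<equiv> derived (true_lits \<phi>) (clset S)"

lemma clset_simps [simp]:
  "clset (S\<lparr>acc := a\<rparr>) = clset S" "clset (S\<lparr>cur := u\<rparr>) = clset S"
  "clset (add_gate b l1 l2 S) = clset S \<union>
     {{(nxt S, \<not> b), l1}, {(nxt S, \<not> b), l2}, {(nxt S, b), compl l1, compl l2}}"
  by (auto simp: clset_def add_gate_def gate_def)

lemma add_gate_simps [simp]:
  "nxt (add_gate b l1 l2 S) = Suc (nxt S)" "acc (add_gate b l1 l2 S) = acc S"
  "cur (add_gate b l1 l2 S) = cur S"
  by (auto simp: add_gate_def)

lemma models_add_gate:
  "models \<beta> (clset (add_gate b l1 l2 S)) \<longleftrightarrow> models \<beta> (clset S) \<and>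
     (\<beta> (nxt S) = b \<longleftrightarrow> \<beta> (fst l1) = snd l1 \<and> \<beta> (fst l2) = snd l2)"
  unfolding clset_simps models_def by (cases l1; cases l2) auto

lemma ders_gate_pos:
  assumes "l1 \<in> ders \<phi> S" "l2 \<in> ders \<phi> S"
  shows "(nxt S, b) \<in> ders \<phi> (add_gate b l1 l2 S)"
proof (rule derived.step)
  show "{(nxt S, b), compl l1, compl l2} \<in> clset (add_gate b l1 l2 S)" by simp
  have "ders \<phi> S \<subseteq> ders \<phi> (add_gate b l1 l2 S)" by (rule derived_mono) auto
  then have "compl (compl l1) \<in> ders \<phi> (add_gate b l1 l2 S)"
    "compl (compl l2) \<in> ders \<phi> (add_gate b l1 l2 S)"
    using assms by (auto simp del: clset_simps)
  then show "\<forall>y\<in>{(nxt S, b), compl l1, compl l2} - {(nxt S, b)}. compl y \<in> ders \<phi> (add_gate b l1 l2 S)"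
    by blast
qed simp

text \<open>For \<open>b\<close> false this is how the value true passes a disjunction; for
  \<open>b\<close> true it evaluates a conjunction to false.\<close>

lemma ders_gate_neg:
  assumes "compl l1 \<in> ders \<phi> S \<or> compl l2 \<in> ders \<phi> S"
  shows "(nxt S, \<not> b) \<in> ders \<phi> (add_gate b l1 l2 S)"
proof -
  have *: "ders \<phi> S \<subseteq> ders \<phi> (add_gate b l1 l2 S)" by (rule derived_mono) auto
  have "{(nxt S, \<not> b), l1} \<in> clset (add_gate b l1 l2 S)"
    "{(nxt S, \<not> b), l2} \<in> clset (add_gate b l1 l2 S)" by simp_all
  moreover have "(nxt S, \<not> b) \<in> ders \<phi> (add_gate b l1 l2 S)"
    if "{(nxt S, \<not> b), l} \<in> clset (add_gate b l1 l2 S)" "compl l \<in> ders \<phi> S" for l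
    by (rule derived.step[OF that(1)]) (use * that(2) in blast)+
  ultimately show ?thesis using assms by blast
qed

lemma ders_unit: "{x} \<in> clset S \<Longrightarrow> x \<in> ders \<phi> S"
  by (rule derived.step) auto

lemma fold_preserves:
  "(\<And>x S. x \<in> set xs \<Longrightarrow> P S \<Longrightarrow> P (f x S)) \<Longrightarrow> P S \<Longrightarrow> P (fold f xs S)"
  by (induction xs arbitrary: S) auto

text \<open>A step that produces \<open>y\<close> from \<open>B\<close> does so wherever it stands
  in the list: the steps before it only enlarge the set \<open>P\<close>, the steps after it keep
  \<open>y\<close>. This covers rules within a clause and clauses within a round.\<close>

lemma fold_progress:
  fixes P :: "'s \<Rightarrow> 'a set"
  assumes "\<And>x S. x \<in> set xs \<Longrightarrow> I S \<Longrightarrow> I (f x S) \<and> P S \<subseteq> P (f x S)" "I S"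
  shows "I (fold f xs S) \<and> P S \<subseteq> P (fold f xs S) \<and>
    (\<forall>x\<in>set xs. \<forall>B y. (\<forall>S. I S \<and> B \<subseteq> P S \<longrightarrow> y \<in> P (f x S)) \<and> B \<subseteq> P S \<longrightarrow> y \<in> P (fold f xs S))"
  using assms
proof (induction xs arbitrary: S)
  case Nil
  then show ?case by simp
next
  case (Cons x xs)
  have 1: "I (f x S)" "P S \<subseteq> P (f x S)" using Cons.prems by auto
  have "\<And>z S. z \<in> set xs \<Longrightarrow> I S \<Longrightarrow> I (f z S) \<and> P S \<subseteq> P (f z S)"
    using Cons.prems(1) by simp
  note IH = Cons.IH[OF this 1(1)]
  have 2: "I (fold f xs (f x S))" "P (f x S) \<subseteq> P (fold f xs (f x S))"
    "\<And>z B y. z \<in> set xs \<Longrightarrow> (\<forall>S. I S \<and> B \<subseteq> P S \<longrightarrow> y \<in> P (f z S)) \<Longrightarrow> B \<subseteq> P (f x S) \<Longrightarrow>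
      y \<in> P (fold f xs (f x S))"
    using IH by blast+
  show ?case
  proof (intro conjI ballI allI impI)
    show "I (fold f (x # xs) S)" using 2(1) by simp
    show "P S \<subseteq> P (fold f (x # xs) S)" using 1(2) 2(2) by simp
    fix z B y assume z: "z \<in> set (x # xs)"
      and B: "(\<forall>S. I S \<and> B \<subseteq> P S \<longrightarrow> y \<in> P (f z S)) \<and> B \<subseteq> P S"
    show "y \<in> P (fold f (x # xs) S)"
    proof (cases "z = x")
      case True
      then have "y \<in> P (f x S)" using B Cons.prems(2) by blast
      then show ?thesis using 2(2) by auto
    next
      case False
      then show ?thesis using 2(3)[of z B y] z B 1(2) by auto
    qed
  qed
qed

section \<open>Invariants of the construction: true wires are justified\<close>

locale simulation =
  fixes V :: "var set" and cs :: "lit list list" and T :: nat and ws :: "var list"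
    and F :: "clause set"
  assumes F_def: "F = set ` set cs"
    and below_T: "v \<in> vars F \<Longrightarrow> v < T"
    and V_sub: "V \<subseteq> vars F"
    and set_ws: "set ws = insert (Suc T) (vars F)"
    and distinct_cs: "c \<in> set cs \<Longrightarrow> distinct c"
begin

abbreviation Y :: "lit set" where
  "Y \<equiv> set ws \<times> UNIV"

text \<open>The intended value of the wire of \<open>y\<close> in the circuit for \<open>x\<close>.
  The variable \<open>Suc T\<close> lies outside \<open>F\<close>, so its negative literal is free
  to stand for the conflict.\<close>

definition sim :: "pass \<Rightarrow> lit \<Rightarrow> lit \<Rightarrow> bool" where
  "sim \<phi> x y \<longleftrightarrow> y \<in> derived (insert (compl x) (true_lits \<phi>)) F \<or>
     y = (Suc T, False) \<and> refuted (insert (compl x) (true_lits \<phi>)) F"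

text \<open>The condition on the literal \<open>(Suc T, False)\<close> keeps the output clauses of the circuits,
  which contain it, apart from all other clauses.\<close>

definition shape :: "nat \<Rightarrow> gen \<Rightarrow> bool" where
  "shape h S \<longleftrightarrow> distinct (map set (out S)) \<and>
     (\<forall>d\<in>set (out S). distinct d \<and> is_clause (set d) \<and> fst ` set d \<subseteq> V \<union> {T..<nxt S} \<and>
       ((Suc T, False) \<in> set d \<longrightarrow>
        (\<exists>i\<ge>T + 2. (i, True) \<in> set d) \<or> (\<exists>i\<ge>T + 2. i < h \<and> (i, False) \<in> set d)))"

definition determined :: "gen \<Rightarrow> bool" where
  "determined S \<longleftrightarrow> (\<forall>\<phi> v. dom \<phi> = V \<longrightarrow> v \<in> {T..<nxt S} \<longrightarrow> (\<exists>b. (v, b) \<in> ders \<phi> S))"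

definition extensible :: "gen \<Rightarrow> bool" where
  "extensible S \<longleftrightarrow>
     (\<forall>\<phi>. dom \<phi> = V \<longrightarrow> \<not> refuted (true_lits \<phi>) F \<longrightarrow> (\<exists>\<beta>. models \<beta> (clset S) \<and> agrees \<beta> \<phi>))"

definition has_units :: "gen \<Rightarrow> bool" where
  "has_units S \<longleftrightarrow> {(T, True)} \<in> clset S \<and> {(Suc T, True)} \<in> clset S"

text \<open>\<open>h\<close> is the first variable of the circuit in progress. Output clauses of
  earlier circuits have their wire below \<open>h\<close>, whereas the wire of the next output
  clause will be at least \<open>h\<close>; that makes the next one new.\<close>

definition base_inv :: "nat \<Rightarrow> gen \<Rightarrow> bool" where
  "base_inv h S \<longleftrightarrow> T + 2 \<le> h \<and> h \<le> nxt S \<and>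
     shape h S \<and> determined S \<and> extensible S \<and> has_units S"

lemma V_below: "v \<in> V \<Longrightarrow> v < T"
  using V_sub below_T by blast

lemma shape_add_gate:
  assumes inv: "shape h S" and h: "T + 2 \<le> h" "h \<le> nxt S" and ne: "fst l1 \<noteq> fst l2"
    and l1: "fst l1 \<in> V \<union> {T..<nxt S}" "l1 \<noteq> (Suc T, \<not> b)"
    and l2: "fst l2 \<in> V \<union> {T..<nxt S}" "l2 \<noteq> (Suc T, \<not> b)"
  shows "shape h (add_gate b l1 l2 S)"
proof -
  let ?S = "add_gate b l1 l2 S"
  let ?h = "nxt S"
  have old: "distinct d \<and> is_clause (set d) \<and> fst ` set d \<subseteq> V \<union> {T..<nxt S} \<and>
       ((Suc T, False) \<in> set d \<longrightarrow>
        (\<exists>i\<ge>T + 2. (i, True) \<in> set d) \<or> (\<exists>i\<ge>T + 2. i < h \<and> (i, False) \<in> set d))"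
    if "d \<in> set (out S)" for d
    using inv that unfolding shape_def by blast
  have fresh: "?h \<notin> V \<union> {T..<?h}" using h V_below[of ?h] by auto
  then have ne': "fst l1 \<noteq> ?h" "fst l2 \<noteq> ?h" using l1 l2 by auto
  have fresh': "(?h, c) \<notin> set d" if "d \<in> set (out S)" for d c
    using old[OF that] fresh by force
  have o: "out ?S = out S @ gate (?h, b) l1 l2" by (simp add: add_gate_def)
  have g: "distinct d \<and> is_clause (set d) \<and> fst ` set d \<subseteq> V \<union> {T..<Suc ?h}"
    if "d \<in> set (gate (?h, b) l1 l2)" for d
    using that ne ne' l1(1) l2(1) h by (cases l1; cases l2) (auto simp: gate_def is_clause_def)
  have dist: "distinct (map set (gate (?h, b) l1 l2))"
  proof -
    have "l1 \<noteq> l2" using ne by auto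
    then have "{(?h, \<not> b), l1} \<noteq> {(?h, \<not> b), l2}" by (auto simp: doubleton_eq_iff)
    moreover have "(?h, b) \<notin> {(?h, \<not> b), l1}" "(?h, b) \<notin> {(?h, \<not> b), l2}"
      using ne' by auto
    moreover have "(?h, b) \<in> {(?h, b), compl l1, compl l2}" by simp
    ultimately have "{(?h, \<not> b), l1} \<noteq> {(?h, \<not> b), l2}"
      "{(?h, \<not> b), l1} \<noteq> {(?h, b), compl l1, compl l2}"
      "{(?h, \<not> b), l2} \<noteq> {(?h, b), compl l1, compl l2}" by metis+
    then show ?thesis by (simp add: gate_def)
  qed
  have disj: "set ` set (out S) \<inter> set ` set (gate (?h, b) l1 l2) = {}"
  proof -
    have "\<exists>c. (?h, c) \<in> set d" if "d \<in> set (gate (?h, b) l1 l2)" for d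
      using that by (auto simp: gate_def)
    then have "set d \<noteq> set d'" if "d \<in> set (out S)" "d' \<in> set (gate (?h, b) l1 l2)" for d d'
      using fresh'[OF that(1)] that(2) by blast
    then show ?thesis by blast
  qed
  \<comment> \<open>The sign conditions on \<open>l1\<close> and \<open>l2\<close> at
    \<open>Suc T\<close> ensure that \<open>(Suc T, False)\<close> occurs only in those gate clauses
    that contain the fresh variable positively.\<close>
  have g': "\<exists>i\<ge>T + 2. (i, True) \<in> set d"
    if "d \<in> set (gate (?h, b) l1 l2)" "(Suc T, False) \<in> set d" for d
  proof -
    have "(?h, True) \<in> set d"
      using that h l1(2) l2(2) by (cases l1; cases l2; cases b) (auto simp: gate_def)
    then show ?thesis using h by (intro exI[of _ ?h]) simp
  qed
  show ?thesis
    unfolding shape_def o set_append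
  proof (intro conjI ballI)
    show "distinct (map set (out S @ gate (?h, b) l1 l2))"
      using inv dist disj by (simp add: shape_def)
    have mono: "V \<union> {T..<?h} \<subseteq> V \<union> {T..<nxt ?S}" by auto
    fix d assume "d \<in> set (out S) \<union> set (gate (?h, b) l1 l2)"
    then consider "d \<in> set (out S)" | "d \<in> set (gate (?h, b) l1 l2)" by blast
    note d = this
    show "distinct d" "is_clause (set d)" using d old g by metis+
    show "fst ` set d \<subseteq> V \<union> {T..<nxt ?S}"
      using d
    proof cases
      case 1
      then show ?thesis using old[of d] mono by blast
    next
      case 2
      then show ?thesis using g[of d] by simp
    qed
    show "(Suc T, False) \<in> set d \<longrightarrow>
        (\<exists>i\<ge>T + 2. (i, True) \<in> set d) \<or> (\<exists>i\<ge>T + 2. i < h \<and> (i, False) \<in> set d)"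
      using d
    proof cases
      case 1
      then show ?thesis using old[of d] by blast
    next
      case 2
      then show ?thesis using g'[of d] by blast
    qed
  qed
qed

text \<open>Each input is derived with one sign or the other, so one of the gate clauses fires. This
  is the point that requires the gate clauses in both directions.\<close>

lemma determined_add_gate:
  assumes inv: "determined S"
    and l1: "fst l1 \<in> V \<union> {T..<nxt S}" and l2: "fst l2 \<in> V \<union> {T..<nxt S}"
  shows "determined (add_gate b l1 l2 S)"
  unfolding determined_def
proof (intro allI impI)
  let ?S = "add_gate b l1 l2 S"
  fix \<phi> :: pass and v assume dom: "dom \<phi> = V" and v: "v \<in> {T..<nxt ?S}"
  have det: "\<exists>c. (v, c) \<in> ders \<phi> S" if "v \<in> V \<union> {T..<nxt S}" for v
  proof (cases "v \<in> V")
    case True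
    then obtain c where "\<phi> v = Some c" using dom by blast
    then have "(v, c) \<in> true_lits \<phi>" by (simp add: true_lits_def)
    then show ?thesis by (blast intro: derived.base)
  next
    case False
    then show ?thesis using inv dom that unfolding determined_def by blast
  qed
  have lit: "l \<in> ders \<phi> S \<or> compl l \<in> ders \<phi> S" if "fst l \<in> V \<union> {T..<nxt S}" for l
    using det[OF that] lit_eq_or_compl[of l] by force
  show "\<exists>c. (v, c) \<in> ders \<phi> ?S"
  proof (cases "v = nxt S")
    case True
    then show ?thesis
      using lit[OF l1] lit[OF l2] ders_gate_pos[of l1 \<phi> S l2 b] ders_gate_neg[of l1 \<phi> S l2 b]
      by blast
  next
    case False
    then have "v \<in> V \<union> {T..<nxt S}" using v by auto
    moreover have "ders \<phi> S \<subseteq> ders \<phi> ?S" by (rule derived_mono) auto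
    ultimately show ?thesis using det by blast
  qed
qed

lemma extensible_add_gate:
  assumes inv: "extensible S" and sh: "shape h S" and h: "T \<le> nxt S"
    and l1: "fst l1 \<in> V \<union> {T..<nxt S}" and l2: "fst l2 \<in> V \<union> {T..<nxt S}"
  shows "extensible (add_gate b l1 l2 S)"
  unfolding extensible_def
proof (intro allI impI)
  let ?S = "add_gate b l1 l2 S"
  let ?h = "nxt S"
  fix \<phi> assume dom: "dom \<phi> = V" and nr: "\<not> refuted (true_lits \<phi>) F"
  have fresh: "?h \<notin> V \<union> {T..<?h}" using h V_below[of ?h] by auto
  have fresh': "fst l \<noteq> ?h" if "d \<in> set (out S)" "l \<in> set d" for d l
  proof -
    have "fst ` set d \<subseteq> V \<union> {T..<nxt S}" using sh that(1) by (simp add: shape_def)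
    then show ?thesis using that(2) fresh by force
  qed
  obtain \<beta> where \<beta>: "models \<beta> (clset S)" "agrees \<beta> \<phi>"
    using inv dom nr unfolding extensible_def by blast
  \<comment> \<open>Comparing with \<open>b\<close> yields the conjunction for a positive gate
    literal and its negation for a negative one.\<close>
  define \<gamma> where "\<gamma> = \<beta>(?h := ((\<beta> (fst l1) = snd l1 \<and> \<beta> (fst l2) = snd l2) = b))"
  have "\<exists>l\<in>set d. \<gamma> (fst l) = snd l" if d: "d \<in> set (out S)" for d
  proof -
    have "set d \<in> clset S" using d by (simp add: clset_def)
    then obtain l where "l \<in> set d" "\<beta> (fst l) = snd l"
      using \<beta>(1) unfolding models_def by blast
    then show ?thesis using fresh'[OF d] by (intro bexI[of _ l]) (simp_all add: \<gamma>_def)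
  qed
  then have "models \<gamma> (clset S)" by (auto simp: models_def clset_def)
  moreover have "fst l1 \<noteq> ?h" "fst l2 \<noteq> ?h" using l1 l2 fresh by auto
  ultimately have "models \<gamma> (clset ?S)"
    unfolding models_add_gate by (auto simp: \<gamma>_def)
  moreover have "agrees \<gamma> \<phi>"
  proof -
    have "fst l \<noteq> ?h" if "l \<in> true_lits \<phi>" for l
      using that dom fresh by (auto simp: true_lits_def)
    then show ?thesis using \<beta>(2) by (simp add: agrees_def \<gamma>_def)
  qed
  ultimately show "\<exists>\<beta>. models \<beta> (clset ?S) \<and> agrees \<beta> \<phi>" by blast
qed

lemma base_inv_add_gate:
  assumes "base_inv h S" "fst l1 \<noteq> fst l2"
    "fst l1 \<in> V \<union> {T..<nxt S}" "l1 \<noteq> (Suc T, \<not> b)"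
    "fst l2 \<in> V \<union> {T..<nxt S}" "l2 \<noteq> (Suc T, \<not> b)"
  shows "base_inv h (add_gate b l1 l2 S)"
proof -
  have "has_units (add_gate b l1 l2 S)"
    using assms(1) unfolding base_inv_def has_units_def clset_simps by blast
  then show ?thesis
    using assms shape_add_gate[of h S l1 l2 b] determined_add_gate[of S l1 l2 b]
      extensible_add_gate[of S h l1 l2 b]
    unfolding base_inv_def by simp
qed

lemma base_inv_simps [simp]:
  "base_inv h (S\<lparr>acc := a\<rparr>) = base_inv h S" "base_inv h (S\<lparr>cur := u\<rparr>) = base_inv h S"
  by (simp_all add: base_inv_def shape_def determined_def extensible_def has_units_def)

text \<open>Only an upper bound is kept: a wire may still be false although its literal is in the
  closure. \<open>Z\<close> collects the literals already wired in this circuit;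
  \<open>h \<le> cur S y\<close> says that they no longer use a wire of an earlier circuit.\<close>

definition circ_inv :: "nat \<Rightarrow> lit \<Rightarrow> lit set \<Rightarrow> gen \<Rightarrow> bool" where
  "circ_inv h x Z S \<longleftrightarrow> base_inv h S \<and> (\<forall>y\<in>Z. h \<le> cur S y \<and> cur S y < nxt S) \<and>
     (\<forall>\<phi> \<beta>. dom \<phi> = V \<longrightarrow> models \<beta> (clset S) \<longrightarrow> agrees \<beta> \<phi> \<longrightarrow>
       (\<forall>y\<in>Z. \<beta> (cur S y) \<longrightarrow> sim \<phi> x y))"

lemma circ_inv_init_step:
  assumes inv: "circ_inv h x Z S"
  shows "circ_inv h x (insert y Z) (init_step T V x y S)"
proof -
  define l where "l = (if y = compl x then (T, True) else if fst y \<in> V then y else (T, False))"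
  let ?G = "add_gate True l (Suc T, True) S"
  have S': "init_step T V x y S = ?G\<lparr>cur := (cur S)(y := nxt S)\<rparr>"
    by (simp add: init_step_def l_def)
  have b: "base_inv h S" using inv by (simp add: circ_inv_def)
  have h: "T + 2 \<le> h" "h \<le> nxt S" and u: "{(T, True)} \<in> clset S"
    using b by (simp_all add: base_inv_def has_units_def)
  have l: "fst l \<in> insert T V" by (auto simp: l_def)
  have "fst l \<noteq> Suc T" using l V_below[of "Suc T"] by auto
  then have "base_inv h ?G" using l h
    by (intro base_inv_add_gate[OF b]) auto
  moreover have "sim \<phi> x y"
    if dom: "dom \<phi> = V" and "models \<beta> (clset ?G)" "agrees \<beta> \<phi>" "\<beta> (nxt S)" for \<phi> \<beta>
  proof -
    have "models \<beta> (clset S)" "\<beta> (fst l) = snd l"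
      using that(2,4) unfolding models_add_gate by simp_all
    \<comment> \<open>The unit clause of \<open>T\<close> excludes the constant false as the source
      of a true wire.\<close>
    then have "\<beta> T" using u by (auto simp: models_def)
    have "y \<in> insert (compl x) (true_lits \<phi>)"
    proof (cases "y = compl x")
      case False
      then have "fst y \<in> V" "l = y" using \<open>\<beta> T\<close> \<open>\<beta> (fst l) = snd l\<close> by (auto simp: l_def split: if_splits)
      then obtain c where c: "\<phi> (fst y) = Some c" using dom by blast
      then have "(fst y, c) \<in> true_lits \<phi>" by (simp add: true_lits_def)
      then have "\<beta> (fst y) = c" using that(3) by (auto simp: agrees_def)
      then show ?thesis using c \<open>\<beta> (fst l) = snd l\<close> \<open>l = y\<close> by (simp add: true_lits_def)
    qed simp
    then show ?thesis unfolding sim_def by (blast intro: derived.base)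
  qed
  moreover have "h \<le> ((cur S)(y := nxt S)) z \<and> ((cur S)(y := nxt S)) z < Suc (nxt S)"
    if "z \<in> insert y Z" for z
  proof (cases "z = y")
    case False
    then have "h \<le> cur S z \<and> cur S z < nxt S" using inv that unfolding circ_inv_def by blast
    then show ?thesis using False by simp
  qed (use h in simp)
  moreover have "sim \<phi> x z"
    if "dom \<phi> = V" "models \<beta> (clset ?G)" "agrees \<beta> \<phi>" "z \<in> Z" "\<beta> (cur S z)" for \<phi> \<beta> z
  proof -
    have "models \<beta> (clset S)" using that(2) unfolding models_add_gate by blast
    then show ?thesis using inv that unfolding circ_inv_def by blast
  qed
  ultimately show ?thesis
    unfolding circ_inv_def S' by (simp del: clset_simps(3))
qed

text \<open>Unless \<open>acc\<close> is the constant \<open>T\<close>, it lies beyond all wires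
  \<open>cur S y\<close>. This makes the two inputs of every conjunction and disjunction different
  variables, as gates require.\<close>

definition body_inv :: "nat \<Rightarrow> lit \<Rightarrow> lit set \<Rightarrow> gen \<Rightarrow> bool" where
  "body_inv h x B S \<longleftrightarrow> circ_inv h x Y S \<and>
     (acc S = T \<or> T + 2 \<le> acc S \<and> acc S < nxt S \<and> (\<forall>y\<in>Y. cur S y < acc S)) \<and>
     (\<forall>\<phi> \<beta>. dom \<phi> = V \<longrightarrow> models \<beta> (clset S) \<longrightarrow> agrees \<beta> \<phi> \<longrightarrow> \<beta> (acc S) \<longrightarrow>
       (\<forall>y\<in>B. sim \<phi> x y))"

lemma body_inv_conj_step:
  assumes inv: "body_inv h x B S" and y: "y \<in> Y"
  shows "body_inv h x (insert y B) (conj_step y S)"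
proof -
  let ?G = "add_gate True (acc S, True) (cur S y, True) S"
  have S': "conj_step y S = ?G\<lparr>acc := nxt S\<rparr>" by (simp add: conj_step_def)
  have c: "circ_inv h x Y S" using inv by (simp add: body_inv_def)
  then have b: "base_inv h S" and cy: "h \<le> cur S y" "cur S y < nxt S"
    using y unfolding circ_inv_def by blast+
  have h: "T + 2 \<le> h" "h \<le> nxt S" using b by (simp_all add: base_inv_def)
  have a: "acc S = T \<or> T + 2 \<le> acc S \<and> acc S < nxt S \<and> cur S y < acc S"
    using inv y unfolding body_inv_def by blast
  have "base_inv h ?G" using a h cy by (intro base_inv_add_gate[OF b]) auto
  then have "circ_inv h x Y ?G"
    using c unfolding circ_inv_def add_gate_simps models_add_gate by (blast intro: less_SucI)
  moreover have "\<forall>z\<in>Y. cur S z < nxt S" using c unfolding circ_inv_def by blast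
  moreover have "\<forall>z\<in>insert y B. sim \<phi> x z"
    if "dom \<phi> = V" "models \<beta> (clset ?G)" "agrees \<beta> \<phi>" "\<beta> (nxt S)" for \<phi> \<beta>
  proof -
    have m: "models \<beta> (clset S)" "\<beta> (acc S)" "\<beta> (cur S y)"
      using that(2,4) unfolding models_add_gate by simp_all
    then have "sim \<phi> x y" using c that y unfolding circ_inv_def by blast
    moreover have "\<forall>z\<in>B. sim \<phi> x z" using m inv that unfolding body_inv_def by blast
    ultimately show ?thesis by blast
  qed
  ultimately show ?thesis
    using h unfolding body_inv_def S'
    by (simp add: circ_inv_def del: clset_simps(3))
qed

lemma circ_inv_disj_step:
  assumes inv: "body_inv h x B S" and y: "y \<in> Y"
    and rule: "\<And>\<phi>. \<forall>z\<in>B. sim \<phi> x z \<Longrightarrow> sim \<phi> x y"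
  shows "circ_inv h x Y (disj_step y S)"
proof -
  let ?G = "add_gate False (cur S y, False) (acc S, False) S"
  have S': "disj_step y S = ?G\<lparr>cur := (cur S)(y := nxt S)\<rparr>" by (simp add: disj_step_def)
  have c: "circ_inv h x Y S" using inv by (simp add: body_inv_def)
  then have b: "base_inv h S" and cy: "h \<le> cur S y" "cur S y < nxt S"
    using y unfolding circ_inv_def by blast+
  have h: "T + 2 \<le> h" "h \<le> nxt S" using b by (simp_all add: base_inv_def)
  have a: "acc S = T \<or> T + 2 \<le> acc S \<and> acc S < nxt S \<and> cur S y < acc S"
    using inv y unfolding body_inv_def by blast
  have "base_inv h ?G" using a h cy by (intro base_inv_add_gate[OF b]) auto
  moreover have "sim \<phi> x z"
    if "dom \<phi> = V" "models \<beta> (clset ?G)" "agrees \<beta> \<phi>" "z \<in> Y"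
      "\<beta> (((cur S)(y := nxt S)) z)" for \<phi> \<beta> z
  proof -
    have m: "models \<beta> (clset S)" "\<not> \<beta> (nxt S) \<longleftrightarrow> \<not> \<beta> (cur S y) \<and> \<not> \<beta> (acc S)"
      using that(2) unfolding models_add_gate by simp_all
    have cs: "sim \<phi> x z" if "z \<in> Y" "\<beta> (cur S z)" for z
      using c m(1) that \<open>dom \<phi> = V\<close> \<open>agrees \<beta> \<phi>\<close> unfolding circ_inv_def by blast
    show ?thesis
    proof (cases "z = y")
      case True
      then have "\<beta> (cur S y) \<or> \<beta> (acc S)" using that(5) m(2) by auto
      then show ?thesis
      proof
        assume "\<beta> (acc S)"
        then have "\<forall>z\<in>B. sim \<phi> x z" using inv m(1) that(1,3) unfolding body_inv_def by blast
        then show ?thesis using rule True by blast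
      qed (use cs True y in blast)
    next
      case False
      then show ?thesis using cs that(4,5) by auto
    qed
  qed
  moreover have "h \<le> ((cur S)(y := nxt S)) z \<and> ((cur S)(y := nxt S)) z < Suc (nxt S)"
    if "z \<in> Y" for z
  proof -
    have "h \<le> cur S z \<and> cur S z < nxt S" using c that unfolding circ_inv_def by blast
    then show ?thesis using h by simp
  qed
  ultimately show ?thesis
    unfolding circ_inv_def S' by (simp del: clset_simps(3))
qed

lemma occurring_in_Y: "c \<in> set cs \<Longrightarrow> z \<in> set c \<Longrightarrow> z \<in> Y \<and> fst z \<in> vars F"
proof -
  assume "c \<in> set cs" "z \<in> set c"
  then have "fst z \<in> vars F" unfolding vars_def F_def by blast
  then show ?thesis using set_ws by (cases z) auto
qed

lemma rule_head_in_Y: "c \<in> set cs \<Longrightarrow> rule_head T c j \<in> Y"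
  using occurring_in_Y[of c "c ! j"] set_ws by (auto simp: rule_head_def)

lemma compl_in_Y_iff [simp]: "compl z \<in> Y \<longleftrightarrow> z \<in> Y"
  by (cases z) auto

lemma body_inv_rule_body:
  assumes "body_inv h x {} S" "c \<in> set cs" "n \<le> length c"
  shows "body_inv h x {compl (c ! k) | k. k < n \<and> k \<noteq> j} (rule_body c j n S)"
  using assms(3)
proof (induction n)
  case 0
  then show ?case using assms(1) by (simp add: rule_body_def)
next
  case (Suc n)
  let ?B = "\<lambda>n. {compl (c ! k) | k. k < n \<and> k \<noteq> j}"
  have IH: "body_inv h x (?B n) (rule_body c j n S)" using Suc by simp
  show ?case
  proof (cases "n = j")
    case True
    then have "?B (Suc n) = ?B n" by (auto simp: less_Suc_eq)
    then show ?thesis using IH True by (simp add: rule_body_def)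
  next
    case False
    have "compl (c ! n) \<in> Y" using Suc.prems occurring_in_Y[OF assms(2), of "c ! n"] by simp
    then have "body_inv h x (insert (compl (c ! n)) (?B n)) (rule_body c j (Suc n) S)"
      using body_inv_conj_step[OF IH] False by (simp add: rule_body_def)
    moreover have "insert (compl (c ! n)) (?B n) = ?B (Suc n)"
      using False by (auto simp: less_Suc_eq)
    ultimately show ?thesis by simp
  qed
qed

text \<open>One rule is matched with one propagation step of \<open>F\<close>; with \<open>j\<close>
  out of range all literals of the clause are falsified and the head is the conflict.\<close>

lemma sim_rule:
  assumes c: "c \<in> set cs" and body: "\<forall>z\<in>{compl (c ! k) | k. k < length c \<and> k \<noteq> j}. sim \<phi> x z"
  shows "sim \<phi> x (rule_head T c j)"
proof -
  let ?D = "derived (insert (compl x) (true_lits \<phi>)) F"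
  have cF: "set c \<in> F" using c by (auto simp: F_def)
  have d: "compl (c ! k) \<in> ?D" if "k < length c" "k \<noteq> j" for k
  proof -
    \<comment> \<open>The variables of clauses lie below \<open>T\<close>, so a complement in the
      body is never the conflict literal and is truly derived.\<close>
    have "fst (c ! k) < T" using occurring_in_Y[OF c, of "c ! k"] below_T that by simp
    then have "compl (c ! k) \<noteq> (Suc T, False)" by (metis compl_simps(1) fst_conv not_less_eq less_Suc_eq)
    moreover have "sim \<phi> x (compl (c ! k))" using body that by blast
    ultimately show ?thesis unfolding sim_def by blast
  qed
  show ?thesis
  proof (cases "j < length c")
    case True
    have "\<forall>y\<in>set c - {c ! j}. compl y \<in> ?D" using d by (metis Diff_iff in_set_conv_nth singletonI)
    then have "c ! j \<in> ?D" using True cF by (intro derived.step[of "set c"]) auto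
    then show ?thesis using True by (simp add: rule_head_def sim_def)
  next
    case False
    then have "\<forall>y\<in>set c. compl y \<in> ?D" using d by (metis in_set_conv_nth)
    then have "refuted (insert (compl x) (true_lits \<phi>)) F" unfolding refuted_def using cF by blast
    then show ?thesis using False by (simp add: rule_head_def sim_def)
  qed
qed

lemma circ_inv_rule_step:
  assumes "circ_inv h x Y S" "c \<in> set cs"
  shows "circ_inv h x Y (rule_step T c j S)"
proof -
  have "circ_inv h x Y (S\<lparr>acc := T\<rparr>)" using assms(1) by (simp add: circ_inv_def)
  then have "body_inv h x {} (S\<lparr>acc := T\<rparr>)" by (simp add: body_inv_def)
  from body_inv_rule_body[OF this assms(2) order_refl, of j] show ?thesis
    unfolding rule_step_def
    using circ_inv_disj_step rule_head_in_Y[OF assms(2)] sim_rule[OF assms(2)] by blast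
qed

lemma circ_inv_round_step:
  assumes "circ_inv h x Y S"
  shows "circ_inv h x Y (round_step T cs S)"
proof -
  have "circ_inv h x Y (clause_step T c S)" if c: "c \<in> set cs" and inv: "circ_inv h x Y S" for c S
    unfolding clause_step_def
    by (rule fold_preserves[where P = "circ_inv h x Y"], rule circ_inv_rule_step) (use c inv in simp_all)
  then show ?thesis unfolding round_step_def
    by (intro fold_preserves[where P = "circ_inv h x Y"] assms)
qed

lemma circ_inv_init_var:
  assumes "circ_inv h x (set us \<times> UNIV) S"
  shows "circ_inv h x (set (us @ [u]) \<times> UNIV) (init_var T V x u S)"
proof -
  have "circ_inv h x (insert (u, True) (insert (u, False) (set us \<times> UNIV))) (init_var T V x u S)"
    unfolding init_var_def by (intro circ_inv_init_step assms)
  moreover have "insert (u, True) (insert (u, False) (set us \<times> UNIV)) = set (us @ [u]) \<times> UNIV"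
    by (auto simp: UNIV_bool)
  ultimately show ?thesis by simp
qed

lemma circ_inv_init:
  assumes "base_inv h S"
  shows "circ_inv h x (set us \<times> UNIV) (fold (init_var T V x) us S)"
proof (induction us rule: rev_induct)
  case Nil
  then show ?case using assms by (simp add: circ_inv_def)
next
  case (snoc u us)
  then show ?case using circ_inv_init_var by simp
qed

lemma circ_inv_rounds: "circ_inv h x Y S \<Longrightarrow> circ_inv h x Y ((round_step T cs ^^ n) S)"
proof (induction n)
  case (Suc n)
  then show ?case using circ_inv_round_step by simp
qed simp

lemma Bot_in_Y: "(Suc T, False) \<in> Y"
  using set_ws by simp

text \<open>An output clause does not define a fresh variable, so it could destroy models. If it is
  violated at a total \<open>\<phi>\<close>, the invariant yields a refutation of \<open>F\<close>
  from \<open>\<phi>\<close> and the complement of \<open>x\<close>; that complement is already in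
  \<open>\<phi>\<close>, or is over \<open>T\<close> and hence foreign to \<open>F\<close>, so
  \<open>\<phi>\<close> itself is refuted.\<close>

lemma base_inv_final_step:
  assumes inv: "circ_inv h x Y S" and x: "fst x \<in> insert T V"
  shows "base_inv (nxt (final_step T x S)) (final_step T x S)"
proof -
  let ?c = "cur S (Suc T, False)"
  let ?d = "[(?c, False), x, (Suc T, False)]"
  let ?S = "final_step T x S"
  have b: "base_inv h S" and c: "h \<le> ?c" "?c < nxt S"
    using inv Bot_in_Y by (simp_all add: circ_inv_def)
  have h: "T + 2 \<le> h" "h \<le> nxt S" and sh: "shape h S" and ex: "extensible S"
    and det: "determined S" and un: "has_units S"
    using b by (simp_all add: base_inv_def)
  have nxt: "nxt ?S = nxt S" and out: "out ?S = out S @ [?d]" by (simp_all add: final_step_def)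
  have cl: "clset ?S = insert (set ?d) (clset S)" by (simp add: clset_def out)
  have x': "fst x \<le> T" using x V_below by force
  have d: "distinct ?d" "is_clause (set ?d)" "fst ` set ?d \<subseteq> V \<union> {T..<nxt S}"
    using x x' c h by (cases x, auto simp: is_clause_def)+
  have d': "\<exists>i\<ge>T + 2. i < nxt S \<and> (i, False) \<in> set ?d"
    using c h by (intro exI[of _ ?c]) auto
  \<comment> \<open>An older clause with the literal \<open>(Suc T, False)\<close> contains a
    positive wire or a negative one below \<open>h\<close>; the new clause has neither.\<close>
  have new: "set e \<noteq> set ?d" if e: "e \<in> set (out S)" for e
  proof
    assume eq: "set e = set ?d"
    then have "(Suc T, False) \<in> set e" by simp
    then have "(\<exists>i\<ge>T + 2. (i, True) \<in> set e) \<or> (\<exists>i\<ge>T + 2. i < h \<and> (i, False) \<in> set e)"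
      using sh e unfolding shape_def by blast
    then show False unfolding eq using x' c by auto
  qed
  \<comment> \<open>The bound moves up to \<open>nxt S\<close>, as the next circuit begins
    there.\<close>
  have "shape (nxt S) ?S"
    unfolding shape_def out nxt set_append
  proof (intro conjI ballI)
    have "set ?d \<notin> set ` set (out S)" using new by blast
    then show "distinct (map set (out S @ [?d]))" using sh by (simp add: shape_def)
    fix e assume "e \<in> set (out S) \<union> set [?d]"
    then consider "e \<in> set (out S)" | "e = ?d" by auto
    then have "distinct e \<and> is_clause (set e) \<and> fst ` set e \<subseteq> V \<union> {T..<nxt S} \<and>
        ((Suc T, False) \<in> set e \<longrightarrow>
        (\<exists>i\<ge>T + 2. (i, True) \<in> set e) \<or> (\<exists>i\<ge>T + 2. i < nxt S \<and> (i, False) \<in> set e))"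
    proof cases
      case 1
      then have e: "distinct e" "is_clause (set e)" "fst ` set e \<subseteq> V \<union> {T..<nxt S}"
        "(Suc T, False) \<in> set e \<longrightarrow>
        (\<exists>i\<ge>T + 2. (i, True) \<in> set e) \<or> (\<exists>i\<ge>T + 2. i < h \<and> (i, False) \<in> set e)"
        using sh unfolding shape_def by blast+
      then show ?thesis using h(2) by (meson less_le_trans)
    next
      case 2
      show ?thesis unfolding 2 using d d' by blast
    qed
    then show "distinct e" "is_clause (set e)" "fst ` set e \<subseteq> V \<union> {T..<nxt S}"
      "(Suc T, False) \<in> set e \<longrightarrow>
        (\<exists>i\<ge>T + 2. (i, True) \<in> set e) \<or> (\<exists>i\<ge>T + 2. i < nxt S \<and> (i, False) \<in> set e)"
      by blast+
  qed
  moreover have "determined ?S"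
    unfolding determined_def nxt
  proof (intro allI impI)
    fix \<phi> :: pass and v assume "dom \<phi> = V" "v \<in> {T..<nxt S}"
    then have "\<exists>b. (v, b) \<in> ders \<phi> S" using det unfolding determined_def by blast
    moreover have "ders \<phi> S \<subseteq> ders \<phi> ?S" unfolding cl by (rule derived_mono) auto
    ultimately show "\<exists>b. (v, b) \<in> ders \<phi> ?S" by blast
  qed
  moreover have "extensible ?S"
    unfolding extensible_def
  proof (intro allI impI)
    fix \<phi> :: pass assume dom: "dom \<phi> = V" and nr: "\<not> refuted (true_lits \<phi>) F"
    obtain \<beta> where \<beta>: "models \<beta> (clset S)" "agrees \<beta> \<phi>"
      using ex dom nr unfolding extensible_def by blast
    have "\<beta> (fst x) = snd x \<or> \<not> \<beta> ?c"
    proof (rule ccontr)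
      assume "\<not> ?thesis"
      then have nx: "\<beta> (fst x) \<noteq> snd x" and "\<beta> ?c" by auto
      then have "sim \<phi> x (Suc T, False)"
        using inv dom \<beta> Bot_in_Y unfolding circ_inv_def by blast
      \<comment> \<open>The conflict literal itself cannot be derived, its variable being neither
        assigned nor in a clause.\<close>
      moreover have "(Suc T, False) \<notin> derived (insert (compl x) (true_lits \<phi>)) F"
      proof
        assume "(Suc T, False) \<in> derived (insert (compl x) (true_lits \<phi>)) F"
        then show False
        proof cases
          case base
          then show False
            using x' dom V_below[of "Suc T"] by (auto simp: compl_def true_lits_def)
        next
          case (step C)
          then have "Suc T \<in> vars F" unfolding vars_def by force
          then show False using below_T[of "Suc T"] by simp
        qed
      qed
      ultimately have r: "refuted (insert (compl x) (true_lits \<phi>)) F" unfolding sim_def by blast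
      show False
      proof (cases "fst x \<in> V")
        case True
        then obtain b where b: "(fst x, b) \<in> true_lits \<phi>" using dom unfolding true_lits_def by force
        then have "\<beta> (fst x) = b" using \<beta>(2) unfolding agrees_def by force
        then have "b = (\<not> snd x)" using nx by auto
        then have "compl x \<in> true_lits \<phi>" using b by (simp add: compl_def)
        then show False using r nr by (simp add: insert_absorb)
      next
        case False
        then have "fst (compl x) \<notin> vars F" using x below_T[of T] by auto
        then show False using refuted_insert_foreign r nr by blast
      qed
    qed
    then have "models \<beta> (clset ?S)" using \<beta>(1) unfolding cl models_def by auto
    then show "\<exists>\<beta>. models \<beta> (clset ?S) \<and> agrees \<beta> \<phi>" using \<beta>(2) by blast
  qed
  moreover have "has_units ?S" using un unfolding has_units_def cl by blast
  ultimately show ?thesis using h unfolding base_inv_def nxt by auto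
qed

lemma base_inv_circuit:
  assumes "base_inv (nxt S) S" "fst x \<in> insert T V"
  shows "base_inv (nxt (circuit T V ws cs x S)) (circuit T V ws cs x S)"
  unfolding circuit_def
  by (rule base_inv_final_step[OF circ_inv_rounds[OF circ_inv_init[OF assms(1)]] assms(2)])

section \<open>Completeness: propagation reaches the conflict\<close>

definition reached :: "pass \<Rightarrow> gen \<Rightarrow> lit set" where
  "reached \<phi> S = {y \<in> Y. (cur S y, True) \<in> ders \<phi> S}"

text \<open>The old wire of \<open>y\<close> feeds the new one, so redirecting \<open>cur\<close>
  loses nothing already derived.\<close>

lemma reached_disj_step:
  shows "reached \<phi> S \<subseteq> reached \<phi> (disj_step y S)"
    and "(acc S, True) \<in> ders \<phi> S \<Longrightarrow> y \<in> Y \<Longrightarrow> y \<in> reached \<phi> (disj_step y S)"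
    and "clset S \<subseteq> clset (disj_step y S)"
proof -
  let ?G = "add_gate False (cur S y, False) (acc S, False) S"
  have cl: "clset (disj_step y S) = clset ?G" and cur: "cur (disj_step y S) = (cur S)(y := nxt S)"
    by (simp_all add: disj_step_def)
  show sub: "clset S \<subseteq> clset (disj_step y S)" unfolding cl by auto
  then have mono: "ders \<phi> S \<subseteq> ders \<phi> (disj_step y S)" by (intro derived_mono) auto
  have new: "(nxt S, True) \<in> ders \<phi> (disj_step y S)"
    if "(cur S y, True) \<in> ders \<phi> S \<or> (acc S, True) \<in> ders \<phi> S"
    unfolding cl using ders_gate_neg[of "(cur S y, False)" \<phi> S "(acc S, False)" False] that by simp
  show "reached \<phi> S \<subseteq> reached \<phi> (disj_step y S)"
  proof
    fix z assume "z \<in> reached \<phi> S"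
    then show "z \<in> reached \<phi> (disj_step y S)"
      using new mono unfolding reached_def cur by (cases "z = y") auto
  qed
  show "y \<in> reached \<phi> (disj_step y S)" if "(acc S, True) \<in> ders \<phi> S" "y \<in> Y"
    using new that unfolding reached_def cur by simp
qed

lemma rule_body_frame:
  "cur (rule_body c j n S) = cur S \<and> clset S \<subseteq> clset (rule_body c j n S)"
proof (induction n)
  case (Suc n)
  have "rule_body c j (Suc n) S =
      (if n = j then rule_body c j n S else conj_step (compl (c ! n)) (rule_body c j n S))"
    by (simp add: rule_body_def)
  then show ?case using Suc by (auto simp: conj_step_def)
qed (simp add: rule_body_def)

lemma rule_body_complete:
  assumes "(acc S, True) \<in> ders \<phi> S"
    and "\<And>k. k < n \<Longrightarrow> k \<noteq> j \<Longrightarrow> (cur S (compl (c ! k)), True) \<in> ders \<phi> S"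
  shows "(acc (rule_body c j n S), True) \<in> ders \<phi> (rule_body c j n S)"
  using assms(2)
proof (induction n)
  case 0
  then show ?case using assms(1) by (simp add: rule_body_def)
next
  case (Suc n)
  let ?S = "rule_body c j n S"
  let ?G = "add_gate True (acc ?S, True) (cur ?S (compl (c ! n)), True) ?S"
  have IH: "(acc ?S, True) \<in> ders \<phi> ?S" using Suc by simp
  show ?case
  proof (cases "n = j")
    case True
    then show ?thesis using IH by (simp add: rule_body_def)
  next
    case False
    have "ders \<phi> S \<subseteq> ders \<phi> ?S" using rule_body_frame by (intro derived_mono) auto
    then have "(cur ?S (compl (c ! n)), True) \<in> ders \<phi> ?S"
      using Suc.prems[of n] False rule_body_frame by auto
    then have "(nxt ?S, True) \<in> ders \<phi> ?G" using IH by (intro ders_gate_pos)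
    moreover have "rule_body c j (Suc n) S = ?G\<lparr>acc := nxt ?S\<rparr>"
      using False by (simp add: rule_body_def conj_step_def)
    ultimately show ?thesis by (simp del: clset_simps(3))
  qed
qed

lemma rule_step_complete:
  assumes "has_units S" "c \<in> set cs"
  shows "has_units (rule_step T c j S)" "reached \<phi> S \<subseteq> reached \<phi> (rule_step T c j S)"
    "{compl (c ! k) | k. k < length c \<and> k \<noteq> j} \<subseteq> reached \<phi> S \<Longrightarrow>
      rule_head T c j \<in> reached \<phi> (rule_step T c j S)"
    "clset S \<subseteq> clset (rule_step T c j S)"
proof -
  let ?U = "S\<lparr>acc := T\<rparr>"
  let ?S = "rule_body c j (length c) ?U"
  have fr: "cur ?S = cur S" "clset S \<subseteq> clset ?S"
    using rule_body_frame[of c j "length c" ?U] by simp_all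
  then have mono: "ders \<phi> S \<subseteq> ders \<phi> ?S" by (intro derived_mono) auto
  show cl: "clset S \<subseteq> clset (rule_step T c j S)"
    using fr(2) reached_disj_step(3) unfolding rule_step_def by blast
  then show "has_units (rule_step T c j S)" using assms(1) unfolding has_units_def by blast
  have "reached \<phi> S \<subseteq> reached \<phi> ?S" using mono fr(1) unfolding reached_def by auto
  then show "reached \<phi> S \<subseteq> reached \<phi> (rule_step T c j S)"
    using reached_disj_step(1) unfolding rule_step_def by blast
  assume B: "{compl (c ! k) | k. k < length c \<and> k \<noteq> j} \<subseteq> reached \<phi> S"
  have "(acc ?S, True) \<in> ders \<phi> ?S"
  proof (rule rule_body_complete)
    show "(acc ?U, True) \<in> ders \<phi> ?U"
      using assms(1) by (simp add: has_units_def ders_unit)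
    fix k assume "k < length c" "k \<noteq> j"
    then have "compl (c ! k) \<in> reached \<phi> S" using B by blast
    then show "(cur ?U (compl (c ! k)), True) \<in> ders \<phi> ?U" by (simp add: reached_def)
  qed
  then show "rule_head T c j \<in> reached \<phi> (rule_step T c j S)"
    unfolding rule_step_def using reached_disj_step(2) rule_head_in_Y[OF assms(2)] by blast
qed

lemma clause_step_complete:
  assumes "has_units S" "c \<in> set cs"
  shows "has_units (clause_step T c S)" "reached \<phi> S \<subseteq> reached \<phi> (clause_step T c S)"
    "j \<le> length c \<Longrightarrow> {compl (c ! k) | k. k < length c \<and> k \<noteq> j} \<subseteq> reached \<phi> S \<Longrightarrow>
      rule_head T c j \<in> reached \<phi> (clause_step T c S)"
    "clset S \<subseteq> clset (clause_step T c S)"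
proof -
  note step = rule_step_complete[OF _ assms(2)]
  have prog: "has_units (clause_step T c S) \<and> reached \<phi> S \<subseteq> reached \<phi> (clause_step T c S) \<and>
    (\<forall>j\<in>set [0..<Suc (length c)]. \<forall>B y. (\<forall>S. has_units S \<and> B \<subseteq> reached \<phi> S \<longrightarrow>
      y \<in> reached \<phi> (rule_step T c j S)) \<and> B \<subseteq> reached \<phi> S \<longrightarrow> y \<in> reached \<phi> (clause_step T c S))"
    unfolding clause_step_def
    using step assms(1) by (intro fold_progress[where I = has_units and P = "reached \<phi>"]) blast+
  then show "has_units (clause_step T c S)" "reached \<phi> S \<subseteq> reached \<phi> (clause_step T c S)" by blast+
  show "rule_head T c j \<in> reached \<phi> (clause_step T c S)"
    if "j \<le> length c" "{compl (c ! k) | k. k < length c \<and> k \<noteq> j} \<subseteq> reached \<phi> S"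
  proof -
    have "j \<in> set [0..<Suc (length c)]" using that(1) by auto
    then show ?thesis using prog step(3) that(2) by blast
  qed
  have "has_units (clause_step T c S) \<and> clset S \<subseteq> clset (clause_step T c S)"
    unfolding clause_step_def
    by (rule fold_preserves[where P = "\<lambda>S'. has_units S' \<and> clset S \<subseteq> clset S'"])
      (use step assms(1) in blast)+
  then show "clset S \<subseteq> clset (clause_step T c S)" by blast
qed

lemma round_step_complete:
  assumes "has_units S"
  shows "has_units (round_step T cs S)" "reached \<phi> S \<subseteq> reached \<phi> (round_step T cs S)"
    "c \<in> set cs \<Longrightarrow> j \<le> length c \<Longrightarrow> {compl (c ! k) | k. k < length c \<and> k \<noteq> j} \<subseteq> reached \<phi> S \<Longrightarrow>
      rule_head T c j \<in> reached \<phi> (round_step T cs S)"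
    "clset S \<subseteq> clset (round_step T cs S)"
proof -
  note step = clause_step_complete
  have prog: "has_units (round_step T cs S) \<and> reached \<phi> S \<subseteq> reached \<phi> (round_step T cs S) \<and>
    (\<forall>c\<in>set cs. \<forall>B y. (\<forall>S. has_units S \<and> B \<subseteq> reached \<phi> S \<longrightarrow>
      y \<in> reached \<phi> (clause_step T c S)) \<and> B \<subseteq> reached \<phi> S \<longrightarrow> y \<in> reached \<phi> (round_step T cs S))"
    unfolding round_step_def
    using step assms(1) by (intro fold_progress[where I = has_units and P = "reached \<phi>"]) blast+
  then show "has_units (round_step T cs S)" "reached \<phi> S \<subseteq> reached \<phi> (round_step T cs S)" by blast+
  show "rule_head T c j \<in> reached \<phi> (round_step T cs S)"
    if "c \<in> set cs" "j \<le> length c" "{compl (c ! k) | k. k < length c \<and> k \<noteq> j} \<subseteq> reached \<phi> S"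
    using prog step(3)[OF _ that(1,2)] that(1,3) by blast
  have "has_units (round_step T cs S) \<and> clset S \<subseteq> clset (round_step T cs S)"
    unfolding round_step_def
    by (rule fold_preserves[where P = "\<lambda>S'. has_units S' \<and> clset S \<subseteq> clset S'"])
      (use step assms(1) in blast)+
  then show "clset S \<subseteq> clset (round_step T cs S)" by blast
qed

lemma rounds_mono:
  assumes "has_units S"
  shows "has_units ((round_step T cs ^^ n) S)" "clset S \<subseteq> clset ((round_step T cs ^^ n) S)"
proof -
  have "has_units ((round_step T cs ^^ n) S) \<and> clset S \<subseteq> clset ((round_step T cs ^^ n) S)"
  proof (induction n)
    case (Suc n)
    then show ?case using round_step_complete(1,4)[of "(round_step T cs ^^ n) S"] by auto
  qed (use assms in simp)
  then show "has_units ((round_step T cs ^^ n) S)" "clset S \<subseteq> clset ((round_step T cs ^^ n) S)" by blast+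
qed

text \<open>The sets of reached literals grow within \<open>Y\<close>, so during
  \<open>2 * length ws\<close> rounds they either stand still once or exhaust \<open>Y\<close>.
  Standing still means closed under all rules, since a round reaches at least what each rule yields
  from the state at its beginning. Members of \<open>A\<close> outside \<open>Y\<close> are over
  variables of no clause.\<close>

lemma rounds_complete:
  assumes un: "has_units S" and A: "\<And>y. y \<in> A \<Longrightarrow> y \<in> Y \<Longrightarrow> y \<in> reached \<phi> S"
    and ref: "refuted A F"
  shows "(Suc T, False) \<in> reached \<phi> ((round_step T cs ^^ (2 * length ws)) S)"
proof -
  define R where "R i = reached \<phi> ((round_step T cs ^^ i) S)" for i
  let ?n = "2 * length ws"
  have un': "has_units ((round_step T cs ^^ i) S)" for i using rounds_mono(1)[OF un] .
  have suc: "R i \<subseteq> R (Suc i)" for i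
    unfolding R_def using round_step_complete(2)[OF un'] by simp
  have mono: "R i \<subseteq> R j" if "i \<le> j" for i j
    using that by (rule lift_Suc_mono_le[of R, OF suc])
  have RY: "R i \<subseteq> Y" for i by (auto simp: R_def reached_def)
  have finY: "finite Y" by simp
  have "card Y = card (set ws) * 2" by (simp add: card_cartesian_product)
  then have cardY: "card Y \<le> ?n" using card_length[of ws] by simp
  show ?thesis
  proof (cases "\<exists>i<?n. R (Suc i) = R i")
    case True
    then obtain i where i: "i < ?n" "R (Suc i) = R i" by blast
    \<comment> \<open>A rule whose body is reached before the round has its head reached after it,
      and this round added nothing.\<close>
    have closed: "rule_head T c j \<in> R i"
      if "c \<in> set cs" "j \<le> length c" "\<And>k. k < length c \<Longrightarrow> k \<noteq> j \<Longrightarrow> compl (c ! k) \<in> R i" for c j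
    proof -
      have "{compl (c ! k) | k. k < length c \<and> k \<noteq> j} \<subseteq> R i" using that(3) by blast
      then have "rule_head T c j \<in> R (Suc i)"
        using round_step_complete(3)[OF un' that(1,2)] by (simp add: R_def)
      then show ?thesis using i(2) by simp
    qed
    have der: "y \<in> R i" if "y \<in> derived A F" "y \<in> Y" for y
      using that
    proof induction
      case (base y)
      then show ?case using A mono[of 0 i] by (auto simp: R_def)
    next
      case (step C y)
      then obtain c where c: "c \<in> set cs" "C = set c" by (auto simp: F_def)
      then obtain j where j: "j < length c" "c ! j = y" using step(2) by (auto simp: in_set_conv_nth)
      have ex: "compl z \<in> R i" if "z \<in> C - {y}" for z
        using step(3) that occurring_in_Y[OF c(1), of z] c(2) by simp
      \<comment> \<open>Distinctness of \<open>c\<close> identifies the literals other than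
        \<open>y\<close> with the positions other than \<open>j\<close>.\<close>
      have "compl (c ! k) \<in> R i" if "k < length c" "k \<noteq> j" for k
        using that ex[of "c ! k"] c(2) j distinct_cs[OF c(1)] by (auto simp: nth_eq_iff_index_eq)
      then have "rule_head T c j \<in> R i" using closed[OF c(1), of j] j by simp
      then show ?case using j by (simp add: rule_head_def)
    qed
    obtain c where c: "c \<in> set cs" "\<forall>y\<in>set c. compl y \<in> derived A F"
      using ref by (auto simp: refuted_def F_def)
    have "compl (c ! k) \<in> R i" if "k < length c" for k
    proof (rule der)
      show "compl (c ! k) \<in> derived A F" using c(2) nth_mem[OF that] by blast
      show "compl (c ! k) \<in> Y" using occurring_in_Y[OF c(1) nth_mem[OF that]] by simp
    qed
    \<comment> \<open>At index \<open>length c\<close> the body is the whole clause and the head is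
      the conflict.\<close>
    then have "rule_head T c (length c) \<in> R i" using closed[OF c(1), of "length c"] by simp
    then have "(Suc T, False) \<in> R i" by (simp add: rule_head_def)
    then show ?thesis using mono[of i ?n] i(1) by (auto simp: R_def)
  next
    case False
    \<comment> \<open>Every round adds a literal, so after all rounds each simulated literal is
      reached, the conflict included.\<close>
    have "i \<le> card (R i)" if "i \<le> ?n" for i
      using that
    proof (induction i)
      case (Suc i)
      have "R i \<subset> R (Suc i)" using suc[of i] False Suc_le_lessD[OF Suc.prems] by (metis psubsetI)
      then have "card (R i) < card (R (Suc i))"
        using finite_subset[OF RY finY] by (intro psubset_card_mono)
      then show ?case using Suc by simp
    qed simp
    then have "card Y \<le> card (R ?n)" using cardY order_trans by blast
    then have "R ?n = Y" using RY finY by (intro card_seteq)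
    then show ?thesis using Bot_in_Y by (simp add: R_def)
  qed
qed

lemma init_step_complete:
  assumes un: "has_units S" and dom: "dom \<phi> \<subseteq> V"
  shows "has_units (init_step T V x y S)" "clset S \<subseteq> clset (init_step T V x y S)"
    "cur (init_step T V x y S) = (cur S)(y := nxt S)"
    "y \<in> insert (compl x) (true_lits \<phi>) \<Longrightarrow> (nxt S, True) \<in> ders \<phi> (init_step T V x y S)"
proof -
  define l where "l = (if y = compl x then (T, True) else if fst y \<in> V then y else (T, False))"
  let ?G = "add_gate True l (Suc T, True) S"
  have S': "init_step T V x y S = ?G\<lparr>cur := (cur S)(y := nxt S)\<rparr>"
    by (simp add: init_step_def l_def)
  show cl: "clset S \<subseteq> clset (init_step T V x y S)" unfolding S' by auto
  then show "has_units (init_step T V x y S)" using un unfolding has_units_def by blast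
  show "cur (init_step T V x y S) = (cur S)(y := nxt S)" by (simp add: S')
  assume y: "y \<in> insert (compl x) (true_lits \<phi>)"
  have "l \<in> ders \<phi> S"
  proof (cases "y = compl x")
    case True
    then show ?thesis using un by (simp add: l_def has_units_def ders_unit)
  next
    case False
    then have "y \<in> true_lits \<phi>" using y by blast
    then have "fst y \<in> V" using dom by (auto simp: true_lits_def)
    then show ?thesis using False \<open>y \<in> true_lits \<phi>\<close> by (simp add: l_def derived.base)
  qed
  moreover have "(Suc T, True) \<in> ders \<phi> S" using un by (simp add: has_units_def ders_unit)
  ultimately have "(nxt S, True) \<in> ders \<phi> ?G" by (rule ders_gate_pos)
  then show "(nxt S, True) \<in> ders \<phi> (init_step T V x y S)" unfolding S' by (simp del: clset_simps(3))
qed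

definition inputs_set :: "pass \<Rightarrow> lit \<Rightarrow> lit set \<Rightarrow> gen \<Rightarrow> bool" where
  "inputs_set \<phi> x Z S \<longleftrightarrow> has_units S \<and>
     (\<forall>y\<in>insert (compl x) (true_lits \<phi>) \<inter> Z. (cur S y, True) \<in> ders \<phi> S)"

lemma inputs_set_init_step:
  assumes inv: "inputs_set \<phi> x Z S" and dom: "dom \<phi> \<subseteq> V"
  shows "inputs_set \<phi> x (insert y Z) (init_step T V x y S)"
proof -
  have un: "has_units S" using inv by (simp add: inputs_set_def)
  note st = init_step_complete[OF un dom, where x = x and y = y]
  have "ders \<phi> S \<subseteq> ders \<phi> (init_step T V x y S)" using st(2) by (intro derived_mono) auto
  then show ?thesis
    using st inv unfolding inputs_set_def st(3) by (metis Int_iff fun_upd_apply insert_iff subsetD)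
qed

lemma inputs_set_init:
  assumes "has_units S" "dom \<phi> \<subseteq> V"
  shows "inputs_set \<phi> x (set us \<times> UNIV) (fold (init_var T V x) us S)"
proof (induction us rule: rev_induct)
  case Nil
  then show ?case using assms by (simp add: inputs_set_def)
next
  case (snoc u us)
  have "inputs_set \<phi> x (insert (u, True) (insert (u, False) (set us \<times> UNIV)))
      (fold (init_var T V x) (us @ [u]) S)"
    using inputs_set_init_step[OF inputs_set_init_step[OF snoc assms(2)] assms(2)]
    by (simp add: init_var_def[of _ _ _ u])
  moreover have "insert (u, True) (insert (u, False) (set us \<times> UNIV)) = set (us @ [u]) \<times> UNIV"
    by (auto simp: UNIV_bool)
  ultimately show ?case by simp
qed

lemma circuit_mono:
  assumes un: "has_units S"
  shows "clset S \<subseteq> clset (circuit T V ws cs x S)"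
proof -
  \<comment> \<open>The facts taken from the lemma hold for every assignment; the empty one
    instantiates it.\<close>
  have dom: "dom Map.empty \<subseteq> V" by simp
  note st = init_step_complete(1,2)[OF _ dom]
  let ?S = "fold (init_var T V x) ws S"
  have "has_units ?S \<and> clset S \<subseteq> clset ?S"
  proof (rule fold_preserves[where P = "\<lambda>S'. has_units S' \<and> clset S \<subseteq> clset S'"])
    fix u S' assume "has_units S' \<and> clset S \<subseteq> clset S'"
    then show "has_units (init_var T V x u S') \<and> clset S \<subseteq> clset (init_var T V x u S')"
      unfolding init_var_def using st order_trans by meson
  qed (use un in simp)
  then have "clset S \<subseteq> clset ((round_step T cs ^^ (2 * length ws)) ?S)"
    using rounds_mono(2) by blast
  then show ?thesis unfolding circuit_def final_step_def by (auto simp: clset_def)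
qed

lemma circuit_complete:
  assumes un: "has_units S" and dom: "dom \<phi> \<subseteq> V"
    and ref: "refuted (insert (compl x) (true_lits \<phi>)) F"
  shows "x \<in> ders \<phi> (circuit T V ws cs x S)"
proof -
  define U where "U = fold (init_var T V x) ws S"
  define R where "R = (round_step T cs ^^ (2 * length ws)) U"
  let ?D = "ders \<phi> (circuit T V ws cs x S)"
  have inp: "inputs_set \<phi> x Y U" unfolding U_def by (rule inputs_set_init[OF un dom])
  then have un': "has_units U" by (simp add: inputs_set_def)
  have "(Suc T, False) \<in> reached \<phi> R"
    unfolding R_def
  proof (rule rounds_complete[OF un' _ ref])
    fix y assume "y \<in> insert (compl x) (true_lits \<phi>)" "y \<in> Y"
    then show "y \<in> reached \<phi> U" using inp unfolding inputs_set_def reached_def by simp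
  qed
  then have c: "(cur R (Suc T, False), True) \<in> ders \<phi> R" by (simp add: reached_def)
  have cl: "clset (circuit T V ws cs x S) =
      insert {(cur R (Suc T, False), False), x, (Suc T, False)} (clset R)"
    by (simp add: circuit_def final_step_def clset_def R_def U_def)
  have mono: "ders \<phi> R \<subseteq> ?D" unfolding cl by (rule derived_mono) auto
  have "(Suc T, True) \<in> ders \<phi> R"
    using rounds_mono(1)[OF un'] by (simp add: has_units_def ders_unit R_def)
  then have "compl (cur R (Suc T, False), False) \<in> ?D" "compl (Suc T, False) \<in> ?D"
    using c mono by auto
  then show ?thesis
    by (intro derived.step[of "{(cur R (Suc T, False), False), x, (Suc T, False)}"])
      (auto simp: cl)
qed

section \<open>Assembling all circuits into a representation\<close>

lemma base_inv_start: "base_inv (nxt (start T)) (start T)"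
proof -
  have cl: "clset (start T) = {{(T, True)}, {(Suc T, True)}}" by (simp add: start_def clset_def)
  have un: "has_units (start T)" by (simp add: has_units_def cl)
  have "shape (nxt (start T)) (start T)" by (auto simp: shape_def start_def is_clause_def)
  moreover have "determined (start T)"
    unfolding determined_def
  proof (intro allI impI)
    fix \<phi> :: pass and v assume "v \<in> {T..<nxt (start T)}"
    then have "v = T \<or> v = Suc T" by (auto simp: start_def)
    then have "{(v, True)} \<in> clset (start T)" by (auto simp: cl)
    then show "\<exists>b. (v, b) \<in> ders \<phi> (start T)" using ders_unit by blast
  qed
  moreover have "extensible (start T)"
    unfolding extensible_def
  proof (intro allI impI)
    fix \<phi> :: pass assume dom: "dom \<phi> = V"
    define \<beta> where "\<beta> v = (v \<ge> T \<or> \<phi> v = Some True)" for v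
    have "\<beta> v = b" if "\<phi> v = Some b" for v b
    proof -
      have "v < T" using that dom by (intro V_below) blast
      then show ?thesis using that by (simp add: \<beta>_def)
    qed
    then have "agrees \<beta> \<phi>" by (simp add: agrees_def true_lits_def)
    moreover have "models \<beta> (clset (start T))" by (simp add: cl models_def \<beta>_def)
    ultimately show "\<exists>\<beta>. models \<beta> (clset (start T)) \<and> agrees \<beta> \<phi>" by blast
  qed
  ultimately show ?thesis using un by (simp add: base_inv_def start_def)
qed

definition ok :: "gen \<Rightarrow> bool" where
  "ok S \<longleftrightarrow> base_inv (nxt S) S"

text \<open>The second conjunct serves to show that every variable of the function occurs in the
  representation.\<close>

definition forces :: "lit \<Rightarrow> gen \<Rightarrow> bool" where
  "forces x S \<longleftrightarrow> (\<forall>\<phi>. dom \<phi> \<subseteq> V \<longrightarrow> refuted (insert (compl x) (true_lits \<phi>)) F \<longrightarrow> x \<in> ders \<phi> S) \<and>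
     fst x \<in> vars (clset S)"

lemma forces_mono: "forces x S \<Longrightarrow> clset S \<subseteq> clset S' \<Longrightarrow> forces x S'"
  using derived_mono[OF order_refl, of "clset S" "clset S'"] unfolding forces_def vars_def by blast

lemma circuit_ok:
  assumes "ok S" "fst x \<in> insert T V"
  shows "ok (circuit T V ws cs x S)" "forces x (circuit T V ws cs x S)"
    "clset S \<subseteq> clset (circuit T V ws cs x S)"
proof -
  have un: "has_units S" using assms(1) by (simp add: ok_def base_inv_def)
  show "ok (circuit T V ws cs x S)" using base_inv_circuit assms by (simp add: ok_def)
  show "clset S \<subseteq> clset (circuit T V ws cs x S)" using circuit_mono[OF un] .
  have "fst x \<in> vars (clset (circuit T V ws cs x S))"
    by (simp add: circuit_def final_step_def clset_def vars_def)
  then show "forces x (circuit T V ws cs x S)"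
    using circuit_complete[OF un] unfolding forces_def by blast
qed

lemma circuits_ok:
  assumes "ok S" "v \<in> insert T V"
  shows "ok (circuits T V ws cs v S)" "forces (v, b) (circuits T V ws cs v S)"
    "clset S \<subseteq> clset (circuits T V ws cs v S)"
proof -
  let ?U = "circuit T V ws cs (v, False) S"
  have v: "fst (v, c) \<in> insert T V" for c :: bool using assms(2) by simp
  note 1 = circuit_ok[OF assms(1) v, of False]
  note 2 = circuit_ok[OF 1(1) v, of True]
  show "ok (circuits T V ws cs v S)" unfolding circuits_def using 2(1) .
  show "clset S \<subseteq> clset (circuits T V ws cs v S)" unfolding circuits_def using 1(3) 2(3) by (rule order_trans)
  show "forces (v, b) (circuits T V ws cs v S)"
    unfolding circuits_def using 2(2) forces_mono[OF 1(2) 2(3)] by (cases b) auto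
qed

lemma fold_circuits_ok:
  assumes "set us \<subseteq> insert T V"
  shows "ok (fold (circuits T V ws cs) us (start T)) \<and>
    (\<forall>v\<in>set us. \<forall>b. forces (v, b) (fold (circuits T V ws cs) us (start T)))"
  using assms
proof (induction us rule: rev_induct)
  case Nil
  then show ?case using base_inv_start by (simp add: ok_def)
next
  case (snoc u us)
  let ?U = "fold (circuits T V ws cs) us (start T)"
  have U: "ok ?U" "\<And>v b. v \<in> set us \<Longrightarrow> forces (v, b) ?U" and u: "u \<in> insert T V"
    using snoc by auto
  note st = circuits_ok[OF U(1) u]
  have "forces (v, b) (circuits T V ws cs u ?U)" if "v \<in> set (us @ [u])" for v b
    using that st(2) forces_mono[OF U(2) st(3)] by auto
  then show ?case using st(1) by simp
qed

lemma generated_forcing: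
  assumes UR: "UR_representation F f" and V: "V = bvars f" and us: "set us = insert T V"
    and S: "S = fold (circuits T V ws cs) us (start T)"
  shows "forcing_representation (clset S) f" "distinct (map set (out S))" "\<forall>c\<in>set (out S). distinct c"
proof -
  have ok: "ok S" and forces: "\<And>v b. v \<in> insert T V \<Longrightarrow> forces (v, b) S"
    using fold_circuits_ok[of us] us S by auto
  have sh: "shape (nxt S) S" and det: "determined S" and ex: "extensible S" and un: "has_units S"
    using ok by (simp_all add: ok_def base_inv_def)
  show "distinct (map set (out S))" "\<forall>c\<in>set (out S). distinct c"
    using sh by (simp_all add: shape_def)
  show "forcing_representation (clset S) f"
  proof (rule forcing_representationI[OF UR])
    show "clause_set (clset S)"
      using sh by (auto simp: clause_set_def clset_def shape_def)
    show "bvars f \<subseteq> vars (clset S)"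
    proof
      fix v assume "v \<in> bvars f"
      then have "forces (v, True) S" using forces V by blast
      then show "v \<in> vars (clset S)" by (simp add: forces_def)
    qed
    show "\<exists>b. (v, b) \<in> ders \<phi> S" if dom: "dom \<phi> = bvars f" and v: "v \<in> vars (clset S)" for \<phi> v
    proof -
      obtain d where d: "d \<in> set (out S)" "v \<in> fst ` set d" using v by (auto simp: vars_def clset_def)
      then have "v \<in> V \<union> {T..<nxt S}" using sh unfolding shape_def by blast
      then show ?thesis
      proof
        assume "v \<in> V"
        then obtain b where "\<phi> v = Some b" using dom V by blast
        then have "(v, b) \<in> true_lits \<phi>" by (simp add: true_lits_def)
        then show ?thesis by (blast intro: derived.base)
      qed (use det dom V in \<open>unfold determined_def, blast\<close>)
    qed
    show "\<exists>\<beta>. models \<beta> (clset S) \<and> (\<forall>l\<in>true_lits \<phi>. \<beta> (fst l) = snd l)"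
      if "dom \<phi> = bvars f" "\<not> refuted (true_lits \<phi>) F" for \<phi>
      using ex that V unfolding extensible_def agrees_def by blast
    show "x \<in> ders \<phi> S"
      if "dom \<phi> \<subseteq> bvars f" "fst x \<in> bvars f" "refuted (insert (compl x) (true_lits \<phi>)) F" for \<phi> x
    proof -
      have "forces (fst x, snd x) S" using forces that V by blast
      then show ?thesis using that V unfolding forces_def by simp
    qed
    show "refuted (true_lits \<phi>) (clset S)"
      if "dom \<phi> \<subseteq> bvars f" "refuted (true_lits \<phi>) F" for \<phi>
    proof -
      \<comment> \<open>The circuit for \<open>(T, False)\<close> assumes its complement in
        addition, so monotonicity carries the refutation over; the derived literal then clashes with
        the unit clause of \<open>T\<close>.\<close>
      have "refuted (insert (compl (T, False)) (true_lits \<phi>)) F"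
        using that(2) by (rule refuted_mono) blast
      then have "(T, False) \<in> ders \<phi> S" using forces[of T False] that(1) V unfolding forces_def by blast
      then show ?thesis using un unfolding refuted_def has_units_def
        by (intro bexI[of _ "{(T, True)}"]) auto
    qed
  qed
qed

end

section \<open>Reasoning about programs\<close>

text \<open>Total correctness with an upper bound for the time: \<open>exec\<close> counts exactly,
  but estimates must be able to ignore which branch is taken.\<close>

definition runs :: "com \<Rightarrow> store \<Rightarrow> nat \<Rightarrow> (store \<Rightarrow> bool) \<Rightarrow> bool" where
  "runs c s t Q \<longleftrightarrow> (\<exists>t' s'. exec c s t' s' \<and> t' \<le> t \<and> Q s')"

lemma runs_conseq: "runs c s t Q \<Longrightarrow> t \<le> t' \<Longrightarrow> (\<And>s'. Q s' \<Longrightarrow> Q' s') \<Longrightarrow> runs c s t' Q'"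
  unfolding runs_def using order_trans by blast

lemma runs_Seq:
  assumes "runs c1 s t1 Q1" "\<And>s'. Q1 s' \<Longrightarrow> runs c2 s' t2 Q"
  shows "runs (Seq c1 c2) s (t1 + t2) Q"
proof -
  obtain u1 s1 where 1: "exec c1 s u1 s1" "u1 \<le> t1" "Q1 s1"
    using assms(1) by (auto simp: runs_def)
  obtain u2 s2 where 2: "exec c2 s1 u2 s2" "u2 \<le> t2" "Q s2"
    using assms(2)[OF 1(3)] by (auto simp: runs_def)
  show ?thesis
    unfolding runs_def using exec.Seq[OF 1(1) 2(1)] 1(2) 2(2,3) add_mono by blast
qed

text \<open>The invariant carries the iteration number, so each iteration may have its own bound
  \<open>\<tau> k\<close>; in the clause loop this yields a sum over the clauses instead of their
  number times the longest. The last summand is the failing test.\<close>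

lemma runs_While:
  assumes "I 0 s"
    and "\<And>k s. k < N \<Longrightarrow> I k s \<Longrightarrow> btest b s"
    and "\<And>k s. k < N \<Longrightarrow> I k s \<Longrightarrow> runs c s (\<tau> k) (I (Suc k))"
    and "\<And>s. I N s \<Longrightarrow> \<not> btest b s"
  shows "runs (While b c) s ((\<Sum>k<N. 1 + bcost b + \<tau> k) + (1 + bcost b)) (I N)"
proof -
  \<comment> \<open>Generalised to start at any \<open>k\<close>, for induction on the number of
    remaining iterations.\<close>
  have "runs (While b c) s ((\<Sum>k\<in>{k..<N}. 1 + bcost b + \<tau> k) + (1 + bcost b)) (I N)"
    if "k \<le> N" "I k s" for k s
    using that
  proof (induction "N - k" arbitrary: k s)
    case 0
    then have "k = N" by simp
    then show ?case
      using exec.WhileFalse[of b s c] assms(4) 0 unfolding runs_def by auto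
  next
    case (Suc n)
    then have k: "k < N" by simp
    obtain u1 s1 where 1: "exec c s u1 s1" "u1 \<le> \<tau> k" "I (Suc k) s1"
      using assms(3)[OF k Suc.prems(2)] by (auto simp: runs_def)
    have "n = N - Suc k" "Suc k \<le> N" using Suc.hyps(2) k by simp_all
    from Suc.hyps(1)[OF this 1(3)] obtain u2 s2 where 2: "exec (While b c) s1 u2 s2"
      "u2 \<le> (\<Sum>k\<in>{Suc k..<N}. 1 + bcost b + \<tau> k) + (1 + bcost b)" "I N s2"
      by (auto simp: runs_def)
    have "exec (While b c) s (1 + bcost b + u1 + u2) s2"
      using exec.WhileTrue[OF assms(2)[OF k Suc.prems(2)] 1(1) 2(1)] .
    moreover have "1 + bcost b + u1 + u2 \<le>
        (\<Sum>k\<in>{k..<N}. 1 + bcost b + \<tau> k) + (1 + bcost b)"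
      unfolding sum.atLeast_Suc_lessThan[OF k] using 1(2) 2(2) by linarith
    ultimately show ?case using 2(3) unfolding runs_def by blast
  qed
  from this[OF _ assms(1)] show ?thesis by (simp add: lessThan_atLeast0)
qed

lemma runs_While_const:
  assumes "I 0 s"
    and "\<And>k s. k < N \<Longrightarrow> I k s \<Longrightarrow> btest b s"
    and "\<And>k s. k < N \<Longrightarrow> I k s \<Longrightarrow> runs c s t (I (Suc k))"
    and "\<And>s. I N s \<Longrightarrow> \<not> btest b s"
  shows "runs (While b c) s (Suc N * (1 + bcost b + t)) (I N)"
  by (rule runs_conseq[OF runs_While[where \<tau> = "\<lambda>_. t" and I = I]]) (use assms in auto)

fun writes :: "com \<Rightarrow> nat set" where
  "writes Skip = {}"
| "writes (Write a e1 e2) = {a}"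
| "writes (Seq c1 c2) = writes c1 \<union> writes c2"
| "writes (Cond b c1 c2) = writes c1 \<union> writes c2"
| "writes (While b c) = writes c"

text \<open>Array numbers are constants of the program text, so a syntactic set of written arrays
  bounds all changes.\<close>

lemma exec_frame: "exec c s t s' \<Longrightarrow> a \<notin> writes c \<Longrightarrow> s' a = s a"
  by (induction rule: exec.induct) (auto simp: upd_def)

lemma runs_frame:
  assumes "runs c s t Q"
  shows "runs c s t (\<lambda>s'. Q s' \<and> (\<forall>a. a \<notin> writes c \<longrightarrow> s' a = s a))"
  using assms exec_frame unfolding runs_def by blast

fun loopfree :: "com \<Rightarrow> bool" where
  "loopfree (Seq c1 c2) \<longleftrightarrow> loopfree c1 \<and> loopfree c2"
| "loopfree (Cond b c1 c2) \<longleftrightarrow> loopfree c1 \<and> loopfree c2"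
| "loopfree (While b c) \<longleftrightarrow> False"
| "loopfree _ \<longleftrightarrow> True"

text \<open>Straight-line code becomes a function on stores, which the simplifier can evaluate. The
  values for loops here and in \<open>cost\<close> are dummies, as both are applied to loop-free
  programs only.\<close>

fun run :: "com \<Rightarrow> store \<Rightarrow> store" where
  "run (Write a e1 e2) s = upd s a (aval e1 s) (aval e2 s)"
| "run (Seq c1 c2) s = run c2 (run c1 s)"
| "run (Cond b c1 c2) s = (if btest b s then run c1 s else run c2 s)"
| "run _ s = s"

text \<open>The costs of the two branches are added, which bounds either of them without a
  maximum.\<close>

fun cost :: "com \<Rightarrow> nat" where
  "cost Skip = 1"
| "cost (Write a e1 e2) = 1 + acost e1 + acost e2"
| "cost (Seq c1 c2) = cost c1 + cost c2"
| "cost (Cond b c1 c2) = 1 + bcost b + cost c1 + cost c2"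
| "cost (While b c) = 0"

lemma exec_loopfree: "loopfree c \<Longrightarrow> \<exists>t\<le>cost c. exec c s t (run c s)"
proof (induction c arbitrary: s)
  case Skip
  show ?case using exec.Skip by auto
next
  case (Write a e1 e2)
  show ?case using exec.Write[of a e1 e2 s] by auto
next
  case (Seq c1 c2)
  obtain t1 t2 where "t1 \<le> cost c1" "exec c1 s t1 (run c1 s)"
    "t2 \<le> cost c2" "exec c2 (run c1 s) t2 (run c2 (run c1 s))"
    using Seq by fastforce
  then show ?case using exec.Seq by (intro exI[of _ "t1 + t2"]) auto
next
  case (Cond b c1 c2)
  obtain t1 t2 where t: "t1 \<le> cost c1" "exec c1 s t1 (run c1 s)"
    "t2 \<le> cost c2" "exec c2 s t2 (run c2 s)"
    using Cond by fastforce
  show ?case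
  proof (cases "btest b s")
    case True
    then show ?thesis using t exec.CondTrue[OF True t(2)] by (intro exI[of _ "1 + bcost b + t1"]) auto
  next
    case False
    then show ?thesis using t exec.CondFalse[OF False t(4)] by (intro exI[of _ "1 + bcost b + t2"]) auto
  qed
qed simp

lemma runs_loopfree: "loopfree c \<Longrightarrow> Q (run c s) \<Longrightarrow> runs c s (cost c) Q"
  using exec_loopfree[of c s] unfolding runs_def by blast

lemma runs_prefix: "loopfree c1 \<Longrightarrow> runs c2 (run c1 s) t Q \<Longrightarrow> runs (Seq c1 c2) s (cost c1 + t) Q"
  by (rule runs_Seq[where ?Q1.0 = "\<lambda>s'. s' = run c1 s"]) (auto intro: runs_loopfree)

lemma runs_suffix: "loopfree c2 \<Longrightarrow> runs c1 s t (\<lambda>s'. Q (run c2 s')) \<Longrightarrow> runs (Seq c1 c2) s (t + cost c2) Q"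
  by (rule runs_Seq[where ?Q1.0 = "\<lambda>s'. Q (run c2 s')"]) (auto intro: runs_loopfree)

lemma run_frame: "loopfree c \<Longrightarrow> a \<notin> writes c \<Longrightarrow> run c s a = s a"
  using exec_loopfree exec_frame by blast

fun areads :: "aexp \<Rightarrow> nat set" where
  "areads (Const n) = {}"
| "areads (Read a e) = insert a (areads e)"
| "areads (Add e1 e2) = areads e1 \<union> areads e2"
| "areads (Sub e1 e2) = areads e1 \<union> areads e2"

lemma aval_cong: "(\<And>a. a \<in> areads e \<Longrightarrow> s' a = s a) \<Longrightarrow> aval e s' = aval e s"
  by (induction e) auto

lemma upd_apply: "upd s a i v b = (if b = a then (s a)(i := v) else s b)"
  by (simp add: upd_def)

abbreviation reg :: "nat \<Rightarrow> aexp" where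
  "reg r \<equiv> Read r (Const 0)"

abbreviation set_reg :: "nat \<Rightarrow> aexp \<Rightarrow> com" where
  "set_reg r e \<equiv> Write r (Const 0) e"

abbreviation incr :: "nat \<Rightarrow> com" where
  "incr r \<equiv> set_reg r (Add (reg r) (Const 1))"


section \<open>Output\<close>

text \<open>Registers are cells 0 of arrays of their own. The next free output cell is in register 6,
  the number of clauses written so far in register 7.\<close>

primrec emit :: "aexp list \<Rightarrow> com" where
  "emit [] = Skip"
| "emit (e # es) = Seq (Write 1 (reg 6) e) (Seq (incr 6) (emit es))"

text \<open>Cell 0 of the output is left free for the number of clauses, which is known only at the
  end; hence the shift by one.\<close>

definition emitted_word :: "store \<Rightarrow> nat list \<Rightarrow> bool" where
  "emitted_word s w \<longleftrightarrow> s 6 0 = Suc (length w) \<and> (\<forall>i<length w. s 1 (Suc i) = w ! i)"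

definition emitted :: "store \<Rightarrow> lit list list \<Rightarrow> bool" where
  "emitted s ds \<longleftrightarrow> emitted_word s (concat (map clause_word ds)) \<and> s 7 0 = length ds"

lemma loopfree_emit [simp]: "loopfree (emit es)"
  by (induction es) auto

lemma writes_emit [simp]: "writes (emit es) = (if es = [] then {} else {1, 6})"
  by (induction es) auto

lemma run_emit_frame: "a \<notin> {1, 6} \<Longrightarrow> run (emit es) s a = s a"
  by (rule run_frame) auto

text \<open>Arrays 1 and 6 change while the list is written; expressions that avoid them keep the
  values they have in the initial store.\<close>

lemma emitted_word_emit:
  assumes "emitted_word s w" "\<forall>e\<in>set es. areads e \<inter> {1, 6} = {}"
  shows "emitted_word (run (emit es) s) (w @ map (\<lambda>e. aval e s) es)"
  using assms
proof (induction es arbitrary: s w)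
  case (Cons e es)
  define s' where "s' = run (incr 6) (run (Write 1 (reg 6) e) s)"
  have frame: "s' a = s a" if "a \<notin> {1, 6}" for a using that by (simp add: s'_def upd_apply)
  have "aval e' s' = aval e' s" if "e' \<in> set es" for e'
  proof (intro aval_cong frame)
    fix a assume "a \<in> areads e'"
    then show "a \<notin> {1, 6}" using that Cons.prems(2) by auto
  qed
  then have vals: "map (\<lambda>e. aval e s') es = map (\<lambda>e. aval e s) es" by simp
  have "emitted_word s' (w @ [aval e s])"
    using Cons.prems(1) by (auto simp: emitted_word_def s'_def upd_apply nth_append less_Suc_eq)
  from Cons.IH[OF this] Cons.prems(2) have "emitted_word (run (emit es) s')
      (w @ aval e s # map (\<lambda>e. aval e s) es)"
    by (simp add: vals)
  then show ?case by (simp add: s'_def)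
qed simp

declare emit.simps [simp del]

text \<open>Signs are kept as 0 or 1, on which truncated subtraction from 1 is negation.\<close>

definition neg :: "aexp \<Rightarrow> aexp" where
  "neg e = Sub (Const 1) e"

lemma aval_neg: "aval e s = of_bool b \<Longrightarrow> aval (neg e) s = of_bool (\<not> b)"
  by (cases b) (simp_all add: neg_def)

lemma areads_neg [simp]: "areads (neg e) = areads e"
  by (simp add: neg_def)

definition gate_com :: "aexp \<Rightarrow> aexp \<Rightarrow> aexp \<Rightarrow> aexp \<Rightarrow> aexp \<Rightarrow> aexp \<Rightarrow> com" where
  "gate_com v0 b0 v1 b1 v2 b2 = Seq
     (emit [Const 2, v0, neg b0, v1, b1, Const 2, v0, neg b0, v2, b2,
            Const 3, v0, b0, v1, neg b1, v2, neg b2])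
     (set_reg 7 (Add (reg 7) (Const 3)))"

lemma gate_com_simps [simp]:
  "loopfree (gate_com v0 b0 v1 b1 v2 b2)" "writes (gate_com v0 b0 v1 b1 v2 b2) = {1, 6, 7}"
  by (auto simp: gate_com_def)

lemma run_gate_com_frame [simp]:
  "a \<noteq> 1 \<Longrightarrow> a \<noteq> 6 \<Longrightarrow> a \<noteq> 7 \<Longrightarrow> run (gate_com v0 b0 v1 b1 v2 b2) s a = s a"
  by (rule run_frame) auto

definition denotes :: "aexp \<Rightarrow> aexp \<Rightarrow> store \<Rightarrow> lit \<Rightarrow> bool" where
  "denotes v b s l \<longleftrightarrow> aval v s = fst l \<and> aval b s = of_bool (snd l) \<and>
     (areads v \<union> areads b) \<inter> {1, 6, 7} = {}"

lemma emitted_gate_com: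
  assumes em: "emitted s ds" and l0: "denotes v0 b0 s l0" and l1: "denotes v1 b1 s l1"
    and l2: "denotes v2 b2 s l2"
  shows "emitted (run (gate_com v0 b0 v1 b1 v2 b2) s) (ds @ gate l0 l1 l2)"
proof -
  let ?es = "[Const 2, v0, neg b0, v1, b1, Const 2, v0, neg b0, v2, b2,
            Const 3, v0, b0, v1, neg b1, v2, neg b2]"
  have "map (\<lambda>e. aval e s) ?es = concat (map clause_word (gate l0 l1 l2))"
    using l0 l1 l2 by (simp add: denotes_def gate_def clause_word_def lit_word_def aval_neg)
  moreover have "emitted_word (run (emit ?es) s)
      (concat (map clause_word ds) @ map (\<lambda>e. aval e s) ?es)"
    using em l0 l1 l2 by (intro emitted_word_emit) (auto simp: emitted_def denotes_def)
  ultimately have ew: "emitted_word (run (emit ?es) s) (concat (map clause_word (ds @ gate l0 l1 l2)))"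
    by simp
  have "run (emit ?es) s 7 = s 7" by (rule run_emit_frame) simp
  moreover have "length (gate l0 l1 l2) = 3" by (simp add: gate_def)
  ultimately show ?thesis
    using ew em unfolding gate_com_def emitted_def emitted_word_def
    by (simp add: upd_apply)
qed


section \<open>The program\<close>

text \<open>Array 2 holds the field \<open>cur\<close> of the generator state, registers 8 and 9 its fields
  \<open>nxt\<close> and \<open>acc\<close>. Array 3 marks the variables of \<open>f\<close>, array 4 those of \<open>F\<close> seen so far, and
  array 5 lists the latter. Registers 10 to 14 hold \<open>T\<close>, the number of variables of \<open>f\<close>, the number
  of clauses, the position of the first clause and the length of the list in array 5. The counters are
  15 for the position in the input, 16 for clauses (17 is the length of the current one), 18 and 19
  for literals of a clause, 20 for the variables of \<open>f\<close> and 22 for rounds; 23 to 26 are scratch.\<close>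

definition litkey :: "lit \<Rightarrow> nat" where
  "litkey y = fst y + fst y + of_bool (snd y)"

text \<open>Quotient and remainder by 2 recover the literal; therefore writing one wire into array 2
  leaves the others intact.\<close>

lemma litkey_inj [simp]: "litkey y = litkey z \<longleftrightarrow> y = z"
proof
  assume "litkey y = litkey z"
  then have "litkey y div 2 = litkey z div 2" "litkey y mod 2 = litkey z mod 2" by simp_all
  moreover have "litkey y div 2 = fst y" "litkey y mod 2 = of_bool (snd y)" for y
    unfolding litkey_def by (cases "snd y"; simp; presburger)+
  ultimately have "fst y = fst z" "of_bool (snd y) = (of_bool (snd z) :: nat)" by metis+
  then show "y = z" by (cases "snd y"; cases "snd z") (simp_all add: prod_eq_iff)
qed simp

text \<open>The simulation relation: each program part is shown to carry it from one generator state
  to the next.\<close>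

definition rel :: "store \<Rightarrow> gen \<Rightarrow> bool" where
  "rel s S \<longleftrightarrow> s 8 0 = nxt S \<and> s 9 0 = acc S \<and> (\<forall>y. s 2 (litkey y) = cur S y) \<and> emitted s (out S)"

lemma rel_cong:
  "(\<And>a. a \<in> {1, 2, 6, 7, 8, 9} \<Longrightarrow> s' a = s a) \<Longrightarrow> rel s' S = rel s S"
  by (simp add: rel_def emitted_def emitted_word_def)

lemma rel_upd [simp]:
  "a \<notin> {1, 2, 6, 7, 8, 9} \<Longrightarrow> rel (upd s a i v) S = rel s S"
  by (rule rel_cong) (auto simp: upd_apply)

definition conj_com :: "aexp \<Rightarrow> com" where
  "conj_com e = Seq (gate_com (reg 8) (Const 1) (reg 9) (Const 1) e (Const 1))
     (Seq (set_reg 9 (reg 8)) (incr 8))"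

definition disj_com :: "aexp \<Rightarrow> com" where
  "disj_com key = Seq (gate_com (reg 8) (Const 0) (Read 2 key) (Const 0) (reg 9) (Const 0))
     (Seq (Write 2 key (reg 8)) (incr 8))"

definition init_com :: "aexp \<Rightarrow> aexp \<Rightarrow> aexp \<Rightarrow> com" where
  "init_com key v b = Seq (gate_com (reg 8) (Const 1) v b (Add (reg 10) (Const 1)) (Const 1))
     (Seq (Write 2 key (reg 8)) (incr 8))"

lemma com_simps [simp]:
  "loopfree (conj_com e)" "writes (conj_com e) = {1, 6, 7, 8, 9}"
  "loopfree (disj_com e)" "writes (disj_com e) = {1, 2, 6, 7, 8}"
  "loopfree (init_com e v b)" "writes (init_com e v b) = {1, 2, 6, 7, 8}"
  by (auto simp: conj_com_def disj_com_def init_com_def)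

lemma emitted_upd [simp]: "a \<notin> {1, 6, 7} \<Longrightarrow> emitted (upd s a i v) ds = emitted s ds"
  by (auto simp: emitted_def emitted_word_def upd_apply)

lemma rel_conj_com:
  assumes "rel s S" "aval e s = cur S y" "areads e \<inter> {1, 6, 7} = {}"
  shows "rel (run (conj_com e) s) (conj_step y S)"
proof -
  let ?g = "gate_com (reg 8) (Const 1) (reg 9) (Const 1) e (Const 1)"
  have "emitted (run ?g s) (out S @ gate (nxt S, True) (acc S, True) (cur S y, True))"
    using assms by (intro emitted_gate_com) (auto simp: rel_def denotes_def)
  then show ?thesis
    using assms(1) unfolding rel_def conj_com_def conj_step_def add_gate_def
    by (simp add: upd_apply)
qed

lemma rel_disj_com:
  assumes "rel s S" "aval key s = litkey y" "areads key \<inter> {1, 2, 6, 7} = {}"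
  shows "rel (run (disj_com key) s) (disj_step y S)"
proof -
  let ?g = "gate_com (reg 8) (Const 0) (Read 2 key) (Const 0) (reg 9) (Const 0)"
  have "s 2 (litkey y) = cur S y" using assms(1) unfolding rel_def by blast
  then have "emitted (run ?g s) (out S @ gate (nxt S, False) (cur S y, False) (acc S, False))"
    using assms by (intro emitted_gate_com) (auto simp: rel_def denotes_def)
  \<comment> \<open>The key is evaluated again after the gate has been written, so it must not read
    arrays changed meanwhile.\<close>
  moreover have "aval key (run ?g s) = litkey y"
    unfolding assms(2)[symmetric] using assms(3) by (intro aval_cong run_gate_com_frame) auto
  ultimately show ?thesis
    using assms(1) unfolding rel_def disj_com_def disj_step_def add_gate_def
    by (simp add: upd_apply)
qed

lemma rel_init_com:
  assumes "rel s S" "aval key s = litkey y" "areads key \<inter> {1, 2, 6, 7} = {}" "denotes v b s l"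
    "l = (if y = compl x then (T, True) else if fst y \<in> V then y else (T, False))" "s 10 0 = T"
  shows "rel (run (init_com key v b) s) (init_step T V x y S)"
proof -
  let ?g = "gate_com (reg 8) (Const 1) v b (Add (reg 10) (Const 1)) (Const 1)"
  have "emitted (run ?g s) (out S @ gate (nxt S, True) l (Suc T, True))"
    using assms by (intro emitted_gate_com) (auto simp: rel_def denotes_def)
  moreover have "aval key (run ?g s) = litkey y"
    unfolding assms(2)[symmetric] using assms(3) by (intro aval_cong run_gate_com_frame) auto
  ultimately show ?thesis
    using assms(1) unfolding rel_def init_com_def init_step_def add_gate_def assms(5)[symmetric]
    by (simp add: upd_apply)
qed

abbreviation frame :: "nat set \<Rightarrow> store \<Rightarrow> store \<Rightarrow> bool" where
  "frame A s s' \<equiv> \<forall>a. a \<notin> A \<longrightarrow> s' a = s a"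

section \<open>Programs for rules, clauses and rounds\<close>

definition lit_pos :: "nat \<Rightarrow> aexp" where
  "lit_pos r = Add (reg 15) (Add (reg r) (reg r))"

definition lits_at :: "store \<Rightarrow> nat \<Rightarrow> lit list \<Rightarrow> bool" where
  "lits_at s p c \<longleftrightarrow> (\<forall>k<length c. s 0 (p + (k + k)) = fst (c ! k) \<and>
     s 0 (p + (k + k) + 1) = of_bool (snd (c ! k)))"

definition body_com :: com where
  "body_com = Seq
     (Cond (Equal (reg 19) (reg 18)) Skip
       (conj_com (Read 2 (Add (Add (Read 0 (lit_pos 19)) (Read 0 (lit_pos 19)))
          (neg (Read 0 (Add (lit_pos 19) (Const 1))))))))
     (incr 19)"

definition rule_pre :: com where
  "rule_pre = Seq (set_reg 9 (reg 10)) (set_reg 19 (Const 0))"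

definition rule_post :: com where
  "rule_post = Seq
     (Cond (Less (reg 18) (reg 17))
       (set_reg 26 (Add (Add (Read 0 (lit_pos 18)) (Read 0 (lit_pos 18))) (Read 0 (Add (lit_pos 18) (Const 1)))))
       (set_reg 26 (Add (Add (reg 10) (Const 1)) (Add (reg 10) (Const 1)))))
     (disj_com (reg 26))"

definition rule_com :: com where
  "rule_com = Seq rule_pre (Seq (While (Less (reg 19) (reg 17)) body_com) rule_post)"

text \<open>Here and below, the summands 6, 8 and 9 are the costs of a loop test. The constants are
  closed terms, which keeps the final \<open>K\<close> independent of the input.\<close>

definition rule_cost :: nat where
  "rule_cost = cost rule_pre + cost rule_post + (6 + cost body_com)"

lemma body_com_simps [simp]: "loopfree body_com" "writes body_com = {1, 6, 7, 8, 9, 19}"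
  by (auto simp: body_com_def)

lemma writes_rule_com [simp]: "writes rule_com = {1, 2, 6, 7, 8, 9, 19, 26}"
  by (auto simp: rule_com_def rule_pre_def rule_post_def)

lemma rel_body_com:
  assumes rel: "rel s S" and k: "k < length c" "s 19 0 = k" and j: "s 18 0 = j"
    and lits: "lits_at s (s 15 0) c"
  shows "rel (run body_com s) (if k = j then S else conj_step (compl (c ! k)) S)"
    "run body_com s 19 0 = Suc k"
proof -
  let ?e = "Read 2 (Add (Add (Read 0 (lit_pos 19)) (Read 0 (lit_pos 19)))
          (neg (Read 0 (Add (lit_pos 19) (Const 1)))))"
  have "aval (Read 0 (Add (lit_pos 19) (Const 1))) s = of_bool (snd (c ! k))"
    "aval (Read 0 (lit_pos 19)) s = fst (c ! k)"
    using lits k by (simp_all add: lit_pos_def lits_at_def)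
  then have "aval (Add (Add (Read 0 (lit_pos 19)) (Read 0 (lit_pos 19)))
          (neg (Read 0 (Add (lit_pos 19) (Const 1))))) s = litkey (compl (c ! k))"
    using aval_neg by (simp add: litkey_def)
  then have "aval ?e s = s 2 (litkey (compl (c ! k)))" by simp
  also have "\<dots> = cur S (compl (c ! k))" using rel unfolding rel_def by blast
  finally have "rel (run (conj_com ?e) s) (conj_step (compl (c ! k)) S)"
    by (intro rel_conj_com[OF rel]) (auto simp: lit_pos_def)
  then show "rel (run body_com s) (if k = j then S else conj_step (compl (c ! k)) S)"
    using rel k j by (simp add: body_com_def)
  have "run (conj_com ?e) s 19 = s 19" by (rule run_frame) auto
  then show "run body_com s 19 0 = Suc k"
    using k by (simp add: body_com_def upd_apply)
qed

lemma rule_body_Suc: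
  "rule_body c j (Suc k) S = (if k = j then rule_body c j k S else conj_step (compl (c ! k)) (rule_body c j k S))"
  by (simp add: rule_body_def)

lemma runs_rule_com:
  assumes rel: "rel s S" and T: "s 10 0 = T" and len: "s 17 0 = length c" and j: "s 18 0 = j"
    and lits: "lits_at s (s 15 0) c"
  shows "runs rule_com s (rule_cost * Suc (length c)) (\<lambda>s'. rel s' (rule_step T c j S))"
proof -
  let ?A = "{1, 6, 7, 8, 9, 19} :: nat set"
  let ?s1 = "run rule_pre s"
  let ?S1 = "S\<lparr>acc := T\<rparr>"
  define I where "I k s' \<longleftrightarrow> rel s' (rule_body c j k ?S1) \<and> s' 19 0 = k \<and> frame ?A s s'" for k s'
  have "rel ?s1 ?S1"
    using rel T by (simp add: rule_pre_def rel_def upd_apply)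
  then have I0: "I 0 ?s1"
    by (simp add: I_def rule_body_def) (simp add: rule_pre_def upd_apply)
  have step: "I (Suc k) (run body_com s')" if "k < length c" "I k s'" for k s'
  proof -
    have fr: "frame ?A s s'" and r: "rel s' (rule_body c j k ?S1)" "s' 19 0 = k"
      using that(2) by (auto simp: I_def)
    then have "s' 18 0 = j" "lits_at s' (s' 15 0) c" using j lits by (simp_all add: lits_at_def)
    note b = rel_body_com[OF r(1) that(1) r(2) this]
    have "frame ?A s (run body_com s')" using fr run_frame[of body_com _ s'] by simp
    then show ?thesis using b unfolding I_def rule_body_Suc by simp
  qed
  have "runs (While (Less (reg 19) (reg 17)) body_com) ?s1
      (Suc (length c) * (1 + bcost (Less (reg 19) (reg 17)) + cost body_com)) (I (length c))"
  proof (rule runs_While_const[where I = I, OF I0])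
    fix k s' assume "k < length c" "I k s'"
    then show "btest (Less (reg 19) (reg 17)) s'" by (simp add: I_def len)
  next
    fix k s' assume "k < length c" "I k s'"
    then show "runs body_com s' (cost body_com) (I (Suc k))" by (intro runs_loopfree step) simp_all
  next
    fix s' assume "I (length c) s'"
    then show "\<not> btest (Less (reg 19) (reg 17)) s'" by (simp add: I_def len)
  qed
  then have loop: "runs (While (Less (reg 19) (reg 17)) body_com) ?s1
      (Suc (length c) * (6 + cost body_com)) (I (length c))"
    by (rule runs_conseq) (simp_all add: algebra_simps)
  have post: "rel (run rule_post s') (rule_step T c j S)" if "I (length c) s'" for s'
  proof -
    have fr: "frame ?A s s'" and r: "rel s' (rule_body c j (length c) ?S1)"
      using that by (auto simp: I_def)
    let ?c = "Cond (Less (reg 18) (reg 17))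
       (set_reg 26 (Add (Add (Read 0 (lit_pos 18)) (Read 0 (lit_pos 18))) (Read 0 (Add (lit_pos 18) (Const 1)))))
       (set_reg 26 (Add (Add (reg 10) (Const 1)) (Add (reg 10) (Const 1))))"
    have "rel (run ?c s') (rule_body c j (length c) ?S1)" using r by simp
    moreover have "aval (reg 26) (run ?c s') = litkey (rule_head T c j)"
      using fr T len j lits
      by (simp add: upd_apply rule_head_def litkey_def lit_pos_def lits_at_def)
    ultimately show ?thesis
      unfolding rule_post_def rule_step_def run.simps by (intro rel_disj_com) auto
  qed
  have lf: "loopfree rule_pre" "loopfree rule_post" by (simp_all add: rule_pre_def rule_post_def)
  have "runs (While (Less (reg 19) (reg 17)) body_com) ?s1 (Suc (length c) * (6 + cost body_com))
      (\<lambda>s'. rel (run rule_post s') (rule_step T c j S))"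
    by (rule runs_conseq[OF loop order_refl post])
  then have "runs rule_com s (cost rule_pre + (Suc (length c) * (6 + cost body_com) + cost rule_post))
      (\<lambda>s'. rel s' (rule_step T c j S))"
    unfolding rule_com_def by (intro runs_prefix[OF lf(1)] runs_suffix[OF lf(2)])
  then show ?thesis
    by (rule runs_conseq) (simp_all add: rule_cost_def algebra_simps)
qed

definition clause_pre :: com where
  "clause_pre = Seq (set_reg 17 (Read 0 (reg 15))) (Seq (incr 15) (set_reg 18 (Const 0)))"

definition clause_post :: com where
  "clause_post = set_reg 15 (Add (reg 15) (Add (reg 17) (reg 17)))"

definition clause_com :: com where
  "clause_com = Seq clause_pre
     (Seq (While (Less (reg 18) (Add (reg 17) (Const 1))) (Seq rule_com (incr 18))) clause_post)"

definition clause_cost :: nat where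
  "clause_cost = cost clause_pre + cost clause_post + 2 * (8 + rule_cost + cost (incr 18))"

lemma writes_clause_com [simp]: "writes clause_com = {1, 2, 6, 7, 8, 9, 15, 17, 18, 19, 26}"
  by (auto simp: clause_com_def clause_pre_def clause_post_def)

lemma runs_clause_com:
  assumes rel: "rel s S" and T: "s 10 0 = T" and p: "s 15 0 = p" "s 0 p = length c"
    and lits: "lits_at s (Suc p) c"
  shows "runs clause_com s (clause_cost * (Suc (length c) * Suc (length c)))
    (\<lambda>s'. rel s' (clause_step T c S) \<and> s' 15 0 = Suc (p + (length c + length c)))"
proof -
  let ?n = "length c"
  let ?A = "{1, 2, 6, 7, 8, 9, 18, 19, 26} :: nat set"
  let ?s1 = "run clause_pre s"
  let ?b = "Less (reg 18) (Add (reg 17) (Const 1))"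
  define I where "I k s' \<longleftrightarrow> rel s' (fold (rule_step T c) [0..<k] S) \<and> s' 18 0 = k \<and> frame ?A ?s1 s'" for k s'
  have s1: "rel ?s1 S" "?s1 17 0 = ?n" "?s1 15 0 = Suc p" "?s1 18 0 = 0" "?s1 0 = s 0" "?s1 10 = s 10"
    using rel p by (simp_all add: clause_pre_def upd_apply)
  have I0: "I 0 ?s1" using s1 by (simp add: I_def)
  let ?t = "rule_cost * Suc ?n + cost (incr 18)"
  have step: "runs (Seq rule_com (incr 18)) s' ?t (I (Suc k))" if "k < Suc ?n" "I k s'" for k s'
  proof (rule runs_suffix)
    have fr: "frame ?A ?s1 s'" and r: "rel s' (fold (rule_step T c) [0..<k] S)" "s' 18 0 = k"
      using that(2) by (auto simp: I_def)
    have "s' 10 0 = T" "s' 17 0 = ?n" "lits_at s' (s' 15 0) c"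
      using fr s1 T lits by (simp_all add: lits_at_def)
    from runs_frame[OF runs_rule_com[OF r(1) this(1,2) r(2) this(3)]]
    show "runs rule_com s' (rule_cost * Suc ?n) (\<lambda>s''. I (Suc k) (run (incr 18) s''))"
    proof (rule runs_conseq)
      fix s'' assume "rel s'' (rule_step T c k (fold (rule_step T c) [0..<k] S)) \<and> frame (writes rule_com) s' s''"
      then show "I (Suc k) (run (incr 18) s'')"
        using fr r(2) by (simp add: I_def upd_apply)
    qed simp
  qed simp
  have "runs (While ?b (Seq rule_com (incr 18))) ?s1 (Suc (Suc ?n) * (1 + bcost ?b + ?t)) (I (Suc ?n))"
  proof (rule runs_While_const[where I = I, OF I0 _ step])
    fix k s' assume "I k s'" "k < Suc ?n"
    then show "btest ?b s'" using s1 by (simp add: I_def)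
  next
    fix s' assume "I (Suc ?n) s'"
    then show "\<not> btest ?b s'" using s1 by (simp add: I_def)
  qed
  then have "runs (While ?b (Seq rule_com (incr 18))) ?s1 (Suc (Suc ?n) * (1 + bcost ?b + ?t))
    (\<lambda>s'. rel (run clause_post s') (clause_step T c S) \<and> run clause_post s' 15 0 = Suc (p + (?n + ?n)))"
    by (rule runs_conseq) (use s1 in \<open>auto simp: I_def clause_step_def clause_post_def upd_apply\<close>)
  then have "runs clause_com s (cost clause_pre + (Suc (Suc ?n) * (1 + bcost ?b + ?t) + cost clause_post))
    (\<lambda>s'. rel s' (clause_step T c S) \<and> s' 15 0 = Suc (p + (?n + ?n)))"
    unfolding clause_com_def
    by (intro runs_prefix runs_suffix) (auto simp: clause_pre_def clause_post_def)
  then show ?thesis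
  proof (rule runs_conseq)
    define d where "d = cost (incr 18)"
    have 1: "x \<le> x * (Suc ?n * Suc ?n)" for x by simp
    have "1 + bcost ?b + ?t \<le> (8 + rule_cost + d) * Suc ?n" by (simp add: d_def algebra_simps)
    \<comment> \<open>Both the number of heads and the length of a body enter, hence the square; the
      factor 2 covers the failing last test.\<close>
    then have "Suc (Suc ?n) * (1 + bcost ?b + ?t) \<le> (2 * Suc ?n) * ((8 + rule_cost + d) * Suc ?n)"
      by (intro mult_mono) auto
    also have "\<dots> = 2 * (8 + rule_cost + d) * (Suc ?n * Suc ?n)" by (simp only: ac_simps)
    finally have 2: "Suc (Suc ?n) * (1 + bcost ?b + ?t) \<le> 2 * (8 + rule_cost + d) * (Suc ?n * Suc ?n)" .
    have "cost clause_pre + (Suc (Suc ?n) * (1 + bcost ?b + ?t) + cost clause_post) \<le>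
        cost clause_pre * (Suc ?n * Suc ?n) + (2 * (8 + rule_cost + d) * (Suc ?n * Suc ?n)
          + cost clause_post * (Suc ?n * Suc ?n))"
      by (intro add_mono 1 2)
    also have "\<dots> = clause_cost * (Suc ?n * Suc ?n)"
      unfolding clause_cost_def d_def by (simp only: add_mult_distrib add_mult_distrib2 ac_simps)
    finally show "cost clause_pre + (Suc (Suc ?n) * (1 + bcost ?b + ?t) + cost clause_post) \<le>
        clause_cost * (Suc ?n * Suc ?n)" .
  qed
qed

definition word_at :: "store \<Rightarrow> nat \<Rightarrow> nat list \<Rightarrow> bool" where
  "word_at s p w \<longleftrightarrow> (\<forall>i<length w. s 0 (p + i) = w ! i)"

lemma word_at_Cons: "word_at s p (x # w) \<longleftrightarrow> s 0 p = x \<and> word_at s (Suc p) w"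
  unfolding word_at_def by (auto simp: nth_Cons less_Suc_eq_0_disj split: nat.splits)

lemma word_at_append: "word_at s p (u @ w) \<longleftrightarrow> word_at s p u \<and> word_at s (p + length u) w"
  by (induction u arbitrary: p) (auto simp: word_at_Cons, auto simp: word_at_def)

lemma lits_at_if_word_at: "word_at s p (concat (map lit_word c)) \<Longrightarrow> lits_at s p c"
proof (induction c arbitrary: p)
  case Nil
  then show ?case by (simp add: lits_at_def)
next
  case (Cons l c)
  have l: "s 0 p = fst l" "s 0 (Suc p) = of_bool (snd l)" and "lits_at s (Suc (Suc p)) c"
    using Cons by (simp_all add: lit_word_def word_at_Cons)
  then show ?case
    unfolding lits_at_def by (auto simp: nth_Cons less_Suc_eq_0_disj split: nat.splits)
qed

text \<open>Clauses have codes of different lengths, so there is no direct access to the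
  \<open>i\<close>-th one; register 15 moves along these offsets.\<close>

definition clause_offset :: "lit list list \<Rightarrow> nat \<Rightarrow> nat" where
  "clause_offset cs i = length (concat (map clause_word (take i cs)))"

lemma length_clause_word: "length (clause_word c) = Suc (length c + length c)"
proof -
  have "length (concat (map lit_word c)) = length c + length c"
    by (induction c) (simp_all add: lit_word_def)
  then show ?thesis by (simp add: clause_word_def)
qed

lemma clause_offset_Suc:
  "i < length cs \<Longrightarrow> clause_offset cs (Suc i) = Suc (clause_offset cs i + (length (cs ! i) + length (cs ! i)))"
  by (simp add: clause_offset_def take_Suc_conv_app_nth length_clause_word)

lemma word_at_clause:
  assumes w: "word_at s p (concat (map clause_word cs))" and i: "i < length cs"
  shows "s 0 (p + clause_offset cs i) = length (cs ! i)" "lits_at s (Suc (p + clause_offset cs i)) (cs ! i)"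
proof -
  have "concat (map clause_word cs) = concat (map clause_word (take i cs)) @
      clause_word (cs ! i) @ concat (map clause_word (drop (Suc i) cs))"
    by (subst id_take_nth_drop[OF i]) simp
  then have "word_at s (p + clause_offset cs i) (clause_word (cs ! i))"
    using w by (simp add: word_at_append clause_offset_def)
  then show "s 0 (p + clause_offset cs i) = length (cs ! i)"
    "lits_at s (Suc (p + clause_offset cs i)) (cs ! i)"
    using lits_at_if_word_at by (simp_all add: clause_word_def word_at_Cons)
qed

text \<open>The arrays that stay fixed while the circuits are written. The word before the clauses
  is that of the variables of the function, with its length replaced by \<open>T\<close>.\<close>

definition env :: "var list \<Rightarrow> var list \<Rightarrow> lit list list \<Rightarrow> nat \<Rightarrow> store \<Rightarrow> bool" where
  "env vs ws cs T s \<longleftrightarrow> word_at s 0 (T # vs) \<and>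
     word_at s (length vs + 2) (concat (map clause_word cs)) \<and>
     (\<forall>v. s 3 v = of_bool (v \<in> set vs)) \<and> (\<forall>i<length ws. s 5 i = ws ! i) \<and>
     s 10 0 = T \<and> s 11 0 = length vs \<and> s 12 0 = length cs \<and> s 13 0 = length vs + 2 \<and>
     s 14 0 = length ws"

lemma env_cong:
  "(\<And>a. a \<in> {0, 3, 5, 10, 11, 12, 13, 14} \<Longrightarrow> s' a = s a) \<Longrightarrow> env vs ws cs T s' = env vs ws cs T s"
  by (simp add: env_def word_at_def)

lemma env_frame:
  "env vs ws cs T s \<Longrightarrow> frame A s s' \<Longrightarrow> A \<inter> {0, 3, 5, 10, 11, 12, 13, 14} = {} \<Longrightarrow> env vs ws cs T s'"
  using env_cong[of s' s vs ws cs T] by blast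

text \<open>A bound for the gates of a round: a clause has one more head than literals, and each
  head takes at most that many gates, its disjunction included.\<close>

definition csize :: "lit list list \<Rightarrow> nat" where
  "csize cs = (\<Sum>c\<leftarrow>cs. Suc (length c) * Suc (length c))"

definition round_pre :: com where
  "round_pre = Seq (set_reg 15 (reg 13)) (set_reg 16 (Const 0))"

definition round_com :: com where
  "round_com = Seq round_pre (While (Less (reg 16) (reg 12)) (Seq clause_com (incr 16)))"

definition round_cost :: nat where
  "round_cost = cost round_pre + 6 + (6 + clause_cost + cost (incr 16))"

lemma writes_round_com [simp]: "writes round_com = {1, 2, 6, 7, 8, 9, 15, 16, 17, 18, 19, 26}"
  by (auto simp: round_com_def round_pre_def)

lemma runs_round_com:
  assumes rel: "rel s S" and env: "env vs ws cs T s"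
  shows "runs round_com s (round_cost * Suc (csize cs)) (\<lambda>s'. rel s' (round_step T cs S))"
proof -
  let ?A = "{1, 2, 6, 7, 8, 9, 15, 16, 17, 18, 19, 26} :: nat set"
  let ?p = "length vs + 2"
  let ?s1 = "run round_pre s"
  let ?b = "Less (reg 16) (reg 12)"
  define I where "I k s' \<longleftrightarrow> rel s' (fold (clause_step T) (take k cs) S) \<and> s' 16 0 = k \<and>
    s' 15 0 = ?p + clause_offset cs k \<and> frame ?A s s'" for k s'
  have T: "s 10 0 = T" and m: "s 12 0 = length cs" and p: "s 13 0 = ?p"
    and w: "word_at s ?p (concat (map clause_word cs))"
    using env by (simp_all add: env_def)
  have I0: "I 0 ?s1" using rel p by (simp add: I_def round_pre_def upd_apply clause_offset_def)
  let ?sq = "\<lambda>c :: lit list. Suc (length c) * Suc (length c)"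
  let ?t = "\<lambda>k. clause_cost * ?sq (cs ! k) + cost (incr 16)"
  have step: "runs (Seq clause_com (incr 16)) s' (?t k) (I (Suc k))" if k: "k < length cs" and Ik: "I k s'" for k s'
  proof (rule runs_suffix)
    have fr: "frame ?A s s'" and r: "rel s' (fold (clause_step T) (take k cs) S)" "s' 16 0 = k"
      "s' 15 0 = ?p + clause_offset cs k"
      using Ik by (auto simp: I_def)
    have "s' 10 0 = T" using fr T by simp
    moreover have "word_at s' ?p (concat (map clause_word cs))" using w fr by (simp add: word_at_def)
    note wa = word_at_clause[OF this k]
    ultimately have "runs clause_com s' (clause_cost * ?sq (cs ! k))
        (\<lambda>s''. rel s'' (clause_step T (cs ! k) (fold (clause_step T) (take k cs) S)) \<and>
          s'' 15 0 = Suc (?p + clause_offset cs k + (length (cs ! k) + length (cs ! k))))"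
      using runs_clause_com[OF r(1) _ r(3) wa] by blast
    from runs_frame[OF this] show "runs clause_com s' (clause_cost * ?sq (cs ! k)) (\<lambda>s''. I (Suc k) (run (incr 16) s''))"
    proof (rule runs_conseq)
      fix s'' assume "(rel s'' (clause_step T (cs ! k) (fold (clause_step T) (take k cs) S)) \<and>
          s'' 15 0 = Suc (?p + clause_offset cs k + (length (cs ! k) + length (cs ! k)))) \<and>
          frame (writes clause_com) s' s''"
      then show "I (Suc k) (run (incr 16) s'')"
        using fr r(2) k by (simp add: I_def upd_apply take_Suc_conv_app_nth clause_offset_Suc)
    qed simp
  qed simp
  have "runs (While ?b (Seq clause_com (incr 16))) ?s1
      ((\<Sum>k<length cs. 1 + bcost ?b + ?t k) + (1 + bcost ?b)) (I (length cs))"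
  proof (rule runs_While[where I = I, OF I0 _ step])
    fix k s' assume "I k s'" "k < length cs"
    then show "btest ?b s'" using m by (simp add: I_def)
  next
    fix s' assume "I (length cs) s'"
    then show "\<not> btest ?b s'" using m by (simp add: I_def)
  qed
  then have "runs round_com s (cost round_pre + ((\<Sum>k<length cs. 1 + bcost ?b + ?t k) + (1 + bcost ?b)))
      (I (length cs))"
    unfolding round_com_def by (intro runs_prefix) (auto simp: round_pre_def)
  then show ?thesis
  proof (rule runs_conseq)
    define d where "d = cost (incr 16)"
    \<comment> \<open>The constant part of an iteration is charged to its clause, whose square is at
      least 1.\<close>
    have "(\<Sum>k<length cs. 1 + bcost ?b + ?t k) \<le> (\<Sum>k<length cs. (6 + clause_cost + d) * ?sq (cs ! k))"
      by (rule sum_mono) (simp add: d_def algebra_simps)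
    also have "\<dots> = (6 + clause_cost + d) * (\<Sum>k<length cs. ?sq (cs ! k))"
      by (rule sum_distrib_left[symmetric])
    also have "(\<Sum>k<length cs. ?sq (cs ! k)) = csize cs"
      by (simp add: csize_def sum_list_sum_nth lessThan_atLeast0)
    finally have 1: "(\<Sum>k<length cs. 1 + bcost ?b + ?t k) \<le> (6 + clause_cost + d) * csize cs" .
    have "cost round_pre + ((\<Sum>k<length cs. 1 + bcost ?b + ?t k) + (1 + bcost ?b)) \<le>
        cost round_pre * Suc (csize cs) + ((6 + clause_cost + d) * Suc (csize cs) + 6 * Suc (csize cs))"
      by (intro add_mono order_trans[OF 1]) auto
    also have "\<dots> = round_cost * Suc (csize cs)"
      unfolding round_cost_def d_def by (simp only: add_mult_distrib add_mult_distrib2 ac_simps)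
    finally show "cost round_pre + ((\<Sum>k<length cs. 1 + bcost ?b + ?t k) + (1 + bcost ?b)) \<le>
        round_cost * Suc (csize cs)" .
  qed (simp add: I_def round_step_def)
qed

definition rounds_com :: com where
  "rounds_com = Seq (set_reg 22 (Const 0))
     (While (Less (reg 22) (Add (reg 14) (reg 14))) (Seq round_com (incr 22)))"

definition rounds_cost :: nat where
  "rounds_cost = cost (set_reg 22 (Const 0)) + 2 * (9 + round_cost + cost (incr 22))"

lemma writes_rounds_com [simp]: "writes rounds_com = {1, 2, 6, 7, 8, 9, 15, 16, 17, 18, 19, 22, 26}"
  by (auto simp: rounds_com_def)

lemma runs_rounds_com:
  assumes rel: "rel s S" and env: "env vs ws cs T s"
  shows "runs rounds_com s (rounds_cost * (Suc (length ws) * Suc (csize cs)))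
    (\<lambda>s'. rel s' ((round_step T cs ^^ (2 * length ws)) S))"
proof -
  let ?A = "{1, 2, 6, 7, 8, 9, 15, 16, 17, 18, 19, 22, 26} :: nat set"
  let ?n = "length ws" and ?m = "csize cs"
  let ?pre = "set_reg 22 (Const 0)"
  let ?s1 = "run ?pre s"
  let ?b = "Less (reg 22) (Add (reg 14) (reg 14))"
  define I where "I k s' \<longleftrightarrow> rel s' ((round_step T cs ^^ k) S) \<and> s' 22 0 = k \<and> frame ?A s s'" for k s'
  have n: "s 14 0 = ?n" using env by (simp add: env_def)
  have I0: "I 0 ?s1" using rel by (simp add: I_def upd_apply)
  let ?t = "round_cost * Suc ?m + cost (incr 22)"
  have step: "runs (Seq round_com (incr 22)) s' ?t (I (Suc k))" if "k < 2 * ?n" and Ik: "I k s'" for k s'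
  proof (rule runs_suffix)
    have fr: "frame ?A s s'" and r: "rel s' ((round_step T cs ^^ k) S)" "s' 22 0 = k"
      using Ik by (auto simp: I_def)
    have "env vs ws cs T s'" using env_frame[OF env fr] by simp
    from runs_frame[OF runs_round_com[OF r(1) this]]
    show "runs round_com s' (round_cost * Suc ?m) (\<lambda>s''. I (Suc k) (run (incr 22) s''))"
    proof (rule runs_conseq)
      fix s'' assume "rel s'' (round_step T cs ((round_step T cs ^^ k) S)) \<and> frame (writes round_com) s' s''"
      then show "I (Suc k) (run (incr 22) s'')"
        using fr r(2) by (simp add: I_def upd_apply)
    qed simp
  qed simp
  have "runs (While ?b (Seq round_com (incr 22))) ?s1 (Suc (2 * ?n) * (1 + bcost ?b + ?t)) (I (2 * ?n))"
  proof (rule runs_While_const[where I = I, OF I0 _ step])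
    fix k s' assume "I k s'" "k < 2 * ?n"
    then show "btest ?b s'" using n by (simp add: I_def)
  next
    fix s' assume "I (2 * ?n) s'"
    then show "\<not> btest ?b s'" using n by (simp add: I_def)
  qed
  then have "runs rounds_com s (cost ?pre + Suc (2 * ?n) * (1 + bcost ?b + ?t)) (I (2 * ?n))"
    unfolding rounds_com_def by (intro runs_prefix) auto
  then show ?thesis
  proof (rule runs_conseq)
    define d where "d = cost (incr 22)"
    have "1 + bcost ?b + ?t \<le> (9 + round_cost + d) * Suc ?m" by (simp add: d_def algebra_simps)
    then have 1: "Suc (2 * ?n) * (1 + bcost ?b + ?t) \<le> (2 * Suc ?n) * ((9 + round_cost + d) * Suc ?m)"
      by (intro mult_mono) auto
    have "cost ?pre + Suc (2 * ?n) * (1 + bcost ?b + ?t) \<le>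
        cost ?pre * (Suc ?n * Suc ?m) + (2 * Suc ?n) * ((9 + round_cost + d) * Suc ?m)"
      by (intro add_mono 1) simp
    also have "\<dots> = rounds_cost * (Suc ?n * Suc ?m)"
      unfolding rounds_cost_def d_def by (simp only: add_mult_distrib add_mult_distrib2 ac_simps)
    finally show "cost ?pre + Suc (2 * ?n) * (1 + bcost ?b + ?t) \<le> rounds_cost * (Suc ?n * Suc ?m)" .
  qed (simp add: I_def)
qed

text \<open>The signs \<open>b\<close> and \<open>d\<close> belong to the program text, so comparing
  them is a test between constants; only the variables are compared at run time.\<close>

definition init_lit_com :: "bool \<Rightarrow> bool \<Rightarrow> com" where
  "init_lit_com b d = Seq
     (Cond (Conj (Equal (reg 23) (Read 0 (reg 20))) (Neg (Equal (Const (of_bool d)) (Const (of_bool b)))))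
       (Seq (set_reg 24 (reg 10)) (set_reg 25 (Const 1)))
       (Cond (Equal (Read 3 (reg 23)) (Const 1))
         (Seq (set_reg 24 (reg 23)) (set_reg 25 (Const (of_bool d))))
         (Seq (set_reg 24 (reg 10)) (set_reg 25 (Const 0)))))
     (init_com (Add (Add (reg 23) (reg 23)) (Const (of_bool d))) (reg 24) (reg 25))"

definition init_var_com :: "bool \<Rightarrow> com" where
  "init_var_com b = Seq (set_reg 23 (Read 5 (reg 18)))
     (Seq (init_lit_com b False) (Seq (init_lit_com b True) (incr 18)))"

definition init_vars_com :: "bool \<Rightarrow> com" where
  "init_vars_com b = Seq (set_reg 18 (Const 0)) (While (Less (reg 18) (reg 14)) (init_var_com b))"

lemma init_com_simps [simp]:
  "loopfree (init_lit_com b d)" "writes (init_lit_com b d) = {1, 2, 6, 7, 8, 24, 25}"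
  "loopfree (init_var_com b)" "writes (init_var_com b) = {1, 2, 6, 7, 8, 18, 23, 24, 25}"
  "writes (init_vars_com b) = {1, 2, 6, 7, 8, 18, 23, 24, 25}"
  by (auto simp: init_lit_com_def init_var_com_def init_vars_com_def)

lemma rel_init_lit_com:
  assumes rel: "rel s S" and env: "env vs ws cs T s" and xv: "s 0 (s 20 0) = xv" and v: "s 23 0 = v"
  shows "rel (run (init_lit_com b d) s) (init_step T (set vs) (xv, b) (v, d) S)"
proof -
  let ?l = "if (v, d) = compl (xv, b) then (T, True) else if fst (v, d) \<in> set vs then (v, d) else (T, False)"
  let ?c = "Cond (Conj (Equal (reg 23) (Read 0 (reg 20))) (Neg (Equal (Const (of_bool d)) (Const (of_bool b)))))
       (Seq (set_reg 24 (reg 10)) (set_reg 25 (Const 1)))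
       (Cond (Equal (Read 3 (reg 23)) (Const 1))
         (Seq (set_reg 24 (reg 23)) (set_reg 25 (Const (of_bool d))))
         (Seq (set_reg 24 (reg 10)) (set_reg 25 (Const 0))))"
  have T: "s 10 0 = T" and mark: "s 3 v = of_bool (v \<in> set vs)" using env by (simp_all add: env_def)
  have lit: "run ?c s 24 0 = fst ?l" "run ?c s 25 0 = of_bool (snd ?l)"
    using T mark xv v by (cases b; cases d; simp add: upd_apply)+
  have fr: "run ?c s a = s a" if "a \<noteq> 24" "a \<noteq> 25" for a
    by (rule run_frame) (use that in auto)
  have "rel (run ?c s) S" using rel by simp
  then show ?thesis
    unfolding init_lit_com_def run.simps(2)
    by (rule rel_init_com[where l = ?l]) (use lit fr T v in \<open>simp_all add: denotes_def litkey_def del: run.simps\<close>)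
qed

definition init_vars_cost :: nat where
  "init_vars_cost = cost (set_reg 18 (Const 0)) + (6 + cost (init_var_com False) + cost (init_var_com True))"

lemma runs_init_vars_com:
  assumes rel: "rel s S" and env: "env vs ws cs T s" and xv: "s 0 (s 20 0) = xv"
  shows "runs (init_vars_com b) s (init_vars_cost * Suc (length ws))
    (\<lambda>s'. rel s' (fold (init_var T (set vs) (xv, b)) ws S))"
proof -
  let ?A = "{1, 2, 6, 7, 8, 18, 23, 24, 25} :: nat set"
  let ?n = "length ws"
  let ?pre = "set_reg 18 (Const 0)"
  let ?s1 = "run ?pre s"
  let ?b = "Less (reg 18) (reg 14)"
  define I where "I k s' \<longleftrightarrow> rel s' (fold (init_var T (set vs) (xv, b)) (take k ws) S) \<and> s' 18 0 = k \<and> frame ?A s s'"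
    for k s'
  have n: "s 14 0 = ?n" and ws: "\<And>i. i < ?n \<Longrightarrow> s 5 i = ws ! i" using env by (simp_all add: env_def)
  have I0: "I 0 ?s1" using rel by (simp add: I_def upd_apply)
  have step: "I (Suc k) (run (init_var_com b) s')" if k: "k < ?n" and Ik: "I k s'" for k s'
  proof -
    let ?U = "fold (init_var T (set vs) (xv, b)) (take k ws) S"
    have fr: "frame ?A s s'" and r: "rel s' ?U" "s' 18 0 = k"
      using Ik by (auto simp: I_def)
    define t1 where "t1 = run (set_reg 23 (Read 5 (reg 18))) s'"
    define t2 where "t2 = run (init_lit_com b False) t1"
    define t3 where "t3 = run (init_lit_com b True) t2"
    have r1: "rel t1 ?U" and v1: "t1 23 0 = ws ! k" and f1: "frame {23} s' t1"
      using r ws[OF k] fr by (simp_all add: t1_def upd_apply)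
    have f2: "frame {1, 2, 6, 7, 8, 24, 25} t1 t2" and f3: "frame {1, 2, 6, 7, 8, 24, 25} t2 t3"
      unfolding t2_def t3_def using run_frame[of "init_lit_com b _"] by simp_all
    have fs1: "frame ?A s t1" using fr f1 by simp
    have e1: "env vs ws cs T t1" using env_frame[OF env fs1] by simp
    have e2: "env vs ws cs T t2" using env_frame[OF e1 f2] by simp
    have x1: "t1 0 (t1 20 0) = xv" using xv fs1 by simp
    have x2: "t2 0 (t2 20 0) = xv" using x1 f2 by simp
    have v2: "t2 23 0 = ws ! k" using v1 f2 by simp
    have r2: "rel t2 (init_step T (set vs) (xv, b) (ws ! k, False) ?U)"
      unfolding t2_def by (rule rel_init_lit_com[OF r1 e1 x1 v1])
    have "rel t3 (init_var T (set vs) (xv, b) (ws ! k) ?U)"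
      unfolding t3_def init_var_def[of _ _ _ "ws ! k"] by (rule rel_init_lit_com[OF r2 e2 x2 v2])
    moreover have "run (init_var_com b) s' = run (incr 18) t3"
      by (simp add: init_var_com_def t1_def t2_def t3_def)
    moreover have "t3 18 0 = k" using f1 f2 f3 r(2) by simp
    moreover have "frame ?A s t3" using fs1 f2 f3 by simp
    ultimately show ?thesis using k by (simp add: I_def upd_apply take_Suc_conv_app_nth)
  qed
  have "runs (While ?b (init_var_com b)) ?s1 (Suc ?n * (1 + bcost ?b + cost (init_var_com b))) (I ?n)"
  proof (rule runs_While_const[where I = I, OF I0])
    fix k s' assume "k < ?n" "I k s'"
    then show "btest ?b s'" using n by (simp add: I_def)
  next
    fix k s' assume "k < ?n" "I k s'"
    then show "runs (init_var_com b) s' (cost (init_var_com b)) (I (Suc k))"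
      by (intro runs_loopfree step) simp_all
  next
    fix s' assume "I ?n s'"
    then show "\<not> btest ?b s'" using n by (simp add: I_def)
  qed
  then have "runs (init_vars_com b) s (cost ?pre + Suc ?n * (1 + bcost ?b + cost (init_var_com b))) (I ?n)"
    unfolding init_vars_com_def by (intro runs_prefix) auto
  then show ?thesis
  proof (rule runs_conseq)
    have "1 + bcost ?b + cost (init_var_com b) \<le> 6 + cost (init_var_com False) + cost (init_var_com True)"
      by (cases b) auto
    then have "Suc ?n * (1 + bcost ?b + cost (init_var_com b)) \<le>
        Suc ?n * (6 + cost (init_var_com False) + cost (init_var_com True))"
      by (rule mult_le_mono2)
    then have "cost ?pre + Suc ?n * (1 + bcost ?b + cost (init_var_com b)) \<le>
        cost ?pre * Suc ?n + Suc ?n * (6 + cost (init_var_com False) + cost (init_var_com True))"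
      by (intro add_mono) auto
    also have "\<dots> = init_vars_cost * Suc ?n"
      unfolding init_vars_cost_def by (simp only: add_mult_distrib add_mult_distrib2 ac_simps)
    finally show "cost ?pre + Suc ?n * (1 + bcost ?b + cost (init_var_com b)) \<le> init_vars_cost * Suc ?n" .
  qed (simp add: I_def)
qed

definition final_com :: "bool \<Rightarrow> com" where
  "final_com b = Seq
     (emit [Const 3, Read 2 (Add (Add (reg 10) (Const 1)) (Add (reg 10) (Const 1))), Const 0,
            Read 0 (reg 20), Const (of_bool b), Add (reg 10) (Const 1), Const 0])
     (incr 7)"

lemma final_com_simps [simp]: "loopfree (final_com b)" "writes (final_com b) = {1, 6, 7}"
  by (auto simp: final_com_def)

lemma rel_final_com:
  assumes rel: "rel s S" and T: "s 10 0 = T" and xv: "s 0 (s 20 0) = xv"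
  shows "rel (run (final_com b) s) (final_step T (xv, b) S)"
proof -
  let ?es = "[Const 3, Read 2 (Add (Add (reg 10) (Const 1)) (Add (reg 10) (Const 1))), Const 0,
            Read 0 (reg 20), Const (of_bool b), Add (reg 10) (Const 1), Const 0]"
  let ?d = "[(cur S (Suc T, False), False), (xv, b), (Suc T, False)]"
  have em: "emitted s (out S)" and "s 2 (litkey (Suc T, False)) = cur S (Suc T, False)"
    using rel unfolding rel_def by blast+
  then have "map (\<lambda>e. aval e s) ?es = clause_word ?d"
    using T xv by (simp add: clause_word_def lit_word_def litkey_def)
  moreover have "emitted_word (run (emit ?es) s)
      (concat (map clause_word (out S)) @ map (\<lambda>e. aval e s) ?es)"
    using em by (intro emitted_word_emit) (auto simp: emitted_def)
  ultimately have ew: "emitted_word (run (emit ?es) s) (concat (map clause_word (out S @ [?d])))"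
    by simp
  have fr: "run (emit ?es) s a = s a" if "a \<notin> {1, 6}" for a by (rule run_emit_frame[OF that])
  have "emitted (run (final_com b) s) (out S @ [?d])"
    using ew em fr[of 7] unfolding final_com_def emitted_def emitted_word_def
    by (simp add: upd_apply)
  moreover have "run (final_com b) s a = s a" if "a \<notin> {1, 6, 7}" for a
    by (rule run_frame) (use that in simp_all)
  ultimately show ?thesis using rel by (simp add: rel_def final_step_def)
qed

definition circuit_com :: "bool \<Rightarrow> com" where
  "circuit_com b = Seq (init_vars_com b) (Seq rounds_com (final_com b))"

definition circuit_cost :: nat where
  "circuit_cost = init_vars_cost + rounds_cost + cost (final_com False) + cost (final_com True)"

lemma writes_circuit_com [simp]:
  "writes (circuit_com b) = {1, 2, 6, 7, 8, 9, 15, 16, 17, 18, 19, 22, 23, 24, 25, 26}"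
  by (auto simp: circuit_com_def)

lemma runs_circuit_com:
  assumes rel: "rel s S" and env: "env vs ws cs T s" and xv: "s 0 (s 20 0) = xv"
  shows "runs (circuit_com b) s (circuit_cost * (Suc (length ws) * Suc (csize cs)))
    (\<lambda>s'. rel s' (circuit T (set vs) ws cs (xv, b) S))"
proof -
  let ?n = "Suc (length ws)" and ?m = "Suc (csize cs)"
  let ?S1 = "fold (init_var T (set vs) (xv, b)) ws S"
  let ?S2 = "(round_step T cs ^^ (2 * length ws)) ?S1"
  have "runs (circuit_com b) s (init_vars_cost * ?n + (rounds_cost * (?n * ?m) + cost (final_com b)))
    (\<lambda>s'. rel s' (circuit T (set vs) ws cs (xv, b) S))"
    unfolding circuit_com_def
  proof (rule runs_Seq[OF runs_frame[OF runs_init_vars_com[OF rel env xv]]])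
    fix s1 assume "rel s1 ?S1 \<and> frame (writes (init_vars_com b)) s s1"
    then have r1: "rel s1 ?S1" and f1: "frame {1, 2, 6, 7, 8, 18, 23, 24, 25} s s1" by simp_all
    have e1: "env vs ws cs T s1" using env_frame[OF env f1] by simp
    have x1: "s1 0 (s1 20 0) = xv" using xv f1 by simp
    show "runs (Seq rounds_com (final_com b)) s1 (rounds_cost * (?n * ?m) + cost (final_com b))
      (\<lambda>s'. rel s' (circuit T (set vs) ws cs (xv, b) S))"
    proof (rule runs_suffix)
      from runs_frame[OF runs_rounds_com[OF r1 e1]]
      show "runs rounds_com s1 (rounds_cost * (?n * ?m))
        (\<lambda>s'. rel (run (final_com b) s') (circuit T (set vs) ws cs (xv, b) S))"
      proof (rule runs_conseq)
        fix s2 assume "rel s2 ?S2 \<and> frame (writes rounds_com) s1 s2"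
        then have r2: "rel s2 ?S2"
          and f2: "frame {1, 2, 6, 7, 8, 9, 15, 16, 17, 18, 19, 22, 26} s1 s2" by simp_all
        have "s2 10 0 = T" "s2 0 (s2 20 0) = xv" using f2 e1 x1 by (simp_all add: env_def)
        then show "rel (run (final_com b) s2) (circuit T (set vs) ws cs (xv, b) S)"
          unfolding circuit_def by (rule rel_final_com[OF r2])
      qed simp
    qed simp
  qed
  then show ?thesis
  proof (rule runs_conseq)
    have "cost (final_com b) \<le> cost (final_com False) + cost (final_com True)" by (cases b) auto
    also have "\<dots> \<le> (cost (final_com False) + cost (final_com True)) * (?n * ?m)" by simp
    finally have 1: "cost (final_com b) \<le> (cost (final_com False) + cost (final_com True)) * (?n * ?m)" .
    have 2: "init_vars_cost * ?n \<le> init_vars_cost * (?n * ?m)" by (intro mult_le_mono2) simp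
    have "init_vars_cost * ?n + (rounds_cost * (?n * ?m) + cost (final_com b)) \<le>
        init_vars_cost * (?n * ?m) + (rounds_cost * (?n * ?m)
          + (cost (final_com False) + cost (final_com True)) * (?n * ?m))"
      by (intro add_mono 1 2 order_refl)
    also have "\<dots> = circuit_cost * (?n * ?m)"
      unfolding circuit_cost_def by (simp only: add_mult_distrib add_mult_distrib2 ac_simps)
    finally show "init_vars_cost * ?n + (rounds_cost * (?n * ?m) + cost (final_com b)) \<le>
        circuit_cost * (?n * ?m)" .
  qed
qed

text \<open>Cell 0 of the input, once the number of variables, now holds \<open>T\<close>; a loop
  over the cells 0 to n(f) therefore treats \<open>T\<close> and the variables of the function
  alike.\<close>

definition main_com :: com where
  "main_com = While (Less (reg 20) (Add (reg 11) (Const 1)))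
     (Seq (circuit_com False) (Seq (circuit_com True) (incr 20)))"

definition main_cost :: nat where
  "main_cost = 2 * (8 + 2 * circuit_cost + cost (incr 20))"

lemma runs_main_com:
  assumes rel: "rel s S" and env: "env vs ws cs T s" and i: "s 20 0 = 0"
  shows "runs main_com s (main_cost * (Suc (length vs) * (Suc (length ws) * Suc (csize cs))))
    (\<lambda>s'. rel s' (fold (circuits T (set vs) ws cs) (T # vs) S))"
proof -
  let ?A = "{1, 2, 6, 7, 8, 9, 15, 16, 17, 18, 19, 20, 22, 23, 24, 25, 26} :: nat set"
  let ?B = "?A - {20}"
  let ?n = "length vs" and ?m = "Suc (length ws) * Suc (csize cs)"
  let ?b = "Less (reg 20) (Add (reg 11) (Const 1))"
  let ?c = "Seq (circuit_com False) (Seq (circuit_com True) (incr 20))"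
  define I where "I k s' \<longleftrightarrow> rel s' (fold (circuits T (set vs) ws cs) (take k (T # vs)) S) \<and>
    s' 20 0 = k \<and> frame ?A s s'" for k s'
  have n: "s 11 0 = ?n" using env by (simp add: env_def)
  have xs: "s 0 k = (T # vs) ! k" if "k < Suc ?n" for k
    using env that by (auto simp: env_def word_at_def)
  have I0: "I 0 s" using rel i by (simp add: I_def)
  let ?t = "circuit_cost * ?m + (circuit_cost * ?m + cost (incr 20))"
  have step: "runs ?c s' ?t (I (Suc k))" if k: "k < Suc ?n" and Ik: "I k s'" for k s'
  proof -
    define U where "U = fold (circuits T (set vs) ws cs) (take k (T # vs)) S"
    define v where "v = (T # vs) ! k"
    have fr: "frame ?A s s'" and r: "rel s' U" "s' 20 0 = k"
      using Ik by (auto simp: I_def U_def)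
    have e: "env vs ws cs T s'" using env_frame[OF env fr] by simp
    have x: "s' 0 (s' 20 0) = v" using fr r(2) xs[OF k] by (simp add: v_def)
    show ?thesis
    proof (rule runs_Seq[OF runs_frame[OF runs_circuit_com[OF r(1) e x]]])
      fix s1 assume "rel s1 (circuit T (set vs) ws cs (v, False) U) \<and> frame (writes (circuit_com False)) s' s1"
      then have r1: "rel s1 (circuit T (set vs) ws cs (v, False) U)" and f1: "frame ?B s' s1"
        by simp_all
      have e1: "env vs ws cs T s1" using env_frame[OF e f1] by simp
      have x1: "s1 0 (s1 20 0) = v" using x f1 by simp
      show "runs (Seq (circuit_com True) (incr 20)) s1 (circuit_cost * ?m + cost (incr 20)) (I (Suc k))"
      proof (rule runs_suffix)
        from runs_frame[OF runs_circuit_com[OF r1 e1 x1]]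
        show "runs (circuit_com True) s1 (circuit_cost * ?m) (\<lambda>s''. I (Suc k) (run (incr 20) s''))"
        proof (rule runs_conseq)
          fix s2 assume "rel s2 (circuit T (set vs) ws cs (v, True) (circuit T (set vs) ws cs (v, False) U)) \<and>
            frame (writes (circuit_com True)) s1 s2"
          then have r2: "rel s2 (circuits T (set vs) ws cs v U)" and f2: "frame ?B s1 s2"
            by (simp_all add: circuits_def)
          have "fold (circuits T (set vs) ws cs) (take (Suc k) (T # vs)) S = circuits T (set vs) ws cs v U"
            using take_Suc_conv_app_nth[of k "T # vs"] k by (simp add: U_def v_def del: take_Suc_Cons)
          moreover have "s2 20 0 = k" using f1 f2 r(2) by simp
          moreover have "frame ?A s s2" using fr f1 f2 by simp
          ultimately show "I (Suc k) (run (incr 20) s2)"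
            using r2 by (simp add: I_def upd_apply del: take_Suc_Cons)
        qed simp
      qed simp
    qed
  qed
  have "runs (While ?b ?c) s (Suc (Suc ?n) * (1 + bcost ?b + ?t)) (I (Suc ?n))"
  proof (rule runs_While_const[where I = I, OF I0 _ step])
    fix k s' assume "I k s'" "k < Suc ?n"
    then show "btest ?b s'" using n by (simp add: I_def)
  next
    fix s' assume "I (Suc ?n) s'"
    then show "\<not> btest ?b s'" using n by (simp add: I_def)
  qed
  then show ?thesis
    unfolding main_com_def
  proof (rule runs_conseq)
    define d where "d = cost (incr 20)"
    have "1 + bcost ?b + ?t = 8 + (2 * circuit_cost * ?m + d)" by (simp add: d_def)
    also have "\<dots> \<le> 8 * ?m + (2 * circuit_cost * ?m + d * ?m)" by (intro add_mono) auto
    also have "\<dots> = (8 + 2 * circuit_cost + d) * ?m"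
      by (simp only: add_mult_distrib add_mult_distrib2 ac_simps)
    finally have "Suc (Suc ?n) * (1 + bcost ?b + ?t) \<le> (2 * Suc ?n) * ((8 + 2 * circuit_cost + d) * ?m)"
      by (intro mult_mono) auto
    also have "\<dots> = main_cost * (Suc ?n * ?m)"
      unfolding main_cost_def d_def by (simp only: ac_simps)
    finally show "Suc (Suc ?n) * (1 + bcost ?b + ?t) \<le> main_cost * (Suc ?n * ?m)" .
  qed (simp add: I_def)
qed

section \<open>Reading the input\<close>

definition uniq :: "nat list \<Rightarrow> nat list" where
  "uniq us = fold (\<lambda>u ws. if u \<in> set ws then ws else ws @ [u]) us []"

lemma uniq_Nil [simp]: "uniq [] = []"
  by (simp add: uniq_def)

lemma uniq_snoc: "uniq (us @ [u]) = (if u \<in> set (uniq us) then uniq us else uniq us @ [u])"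
  by (simp add: uniq_def)

lemma set_uniq [simp]: "set (uniq us) = set us"
  by (induction us rule: rev_induct) (auto simp: uniq_snoc)

lemma distinct_uniq: "distinct (uniq us)"
  by (induction us rule: rev_induct) (auto simp: uniq_snoc)

definition mark_pre :: com where
  "mark_pre = Seq (set_reg 11 (Read 0 (Const 0))) (set_reg 18 (Const 0))"

text \<open>The counter is advanced first, since the variables start in cell 1.\<close>

definition mark_body :: com where
  "mark_body = Seq (incr 18) (Write 3 (Read 0 (reg 18)) (Const 1))"

definition mark_com :: com where
  "mark_com = Seq mark_pre (While (Less (reg 18) (reg 11)) mark_body)"

definition mark_cost :: nat where
  "mark_cost = cost mark_pre + (6 + cost mark_body)"

lemma mark_com_simps [simp]: "writes mark_com = {3, 11, 18}"
  by (auto simp: mark_com_def mark_pre_def mark_body_def)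

text \<open>Fresh cells are 0, so only the variables of the function have to be marked; clearing an
  array would take time depending on the size of the variable numbers.\<close>

lemma runs_mark_com:
  assumes w: "word_at s 0 (length vs # vs)" and zero: "\<And>v. s 3 v = 0"
  shows "runs mark_com s (mark_cost * Suc (length vs))
    (\<lambda>s'. s' 11 0 = length vs \<and> (\<forall>v. s' 3 v = of_bool (v \<in> set vs)))"
proof -
  let ?n = "length vs"
  let ?s1 = "run mark_pre s"
  let ?b = "Less (reg 18) (reg 11)"
  define I where "I k s' \<longleftrightarrow> s' 18 0 = k \<and> s' 11 0 = ?n \<and> s' 0 = s 0 \<and>
    (\<forall>v. s' 3 v = of_bool (v \<in> set (take k vs)))"
    for k and s' :: store
  have n: "s 0 0 = ?n" and vs: "\<And>k. k < ?n \<Longrightarrow> s 0 (Suc k) = vs ! k"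
    using w by (auto simp: word_at_Cons, simp add: word_at_def)
  have I0: "I 0 ?s1" using n zero by (simp add: I_def mark_pre_def upd_apply)
  have step: "I (Suc k) (run mark_body s')" if "k < ?n" "I k s'" for k s'
    using that vs[of k] by (auto simp: I_def mark_body_def upd_apply take_Suc_conv_app_nth)
  have "runs (While ?b mark_body) ?s1 (Suc ?n * (1 + bcost ?b + cost mark_body)) (I ?n)"
  proof (rule runs_While_const[where I = I, OF I0])
    fix k s' assume "k < ?n" "I k s'"
    then show "runs mark_body s' (cost mark_body) (I (Suc k))"
      by (intro runs_loopfree step) (simp_all add: mark_body_def)
  qed (simp_all add: I_def)
  then have "runs mark_com s (cost mark_pre + Suc ?n * (1 + bcost ?b + cost mark_body)) (I ?n)"
    unfolding mark_com_def by (intro runs_prefix) (auto simp: mark_pre_def)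
  then show ?thesis
    by (rule runs_conseq) (simp_all add: I_def mark_cost_def algebra_simps)
qed

definition scan_body :: com where
  "scan_body = Seq (set_reg 23 (Read 0 (reg 15)))
     (Seq (Cond (Equal (Read 4 (reg 23)) (Const 0))
        (Seq (Write 4 (reg 23) (Const 1)) (Seq (Write 5 (reg 14) (reg 23)) (incr 14))) Skip)
     (Seq (set_reg 10 (Add (Add (reg 10) (reg 23)) (Const 1)))
     (Seq (set_reg 15 (Add (reg 15) (Const 2))) (incr 18))))"

definition scan_pre :: com where
  "scan_pre = Seq (set_reg 17 (Read 0 (reg 15))) (Seq (incr 15) (set_reg 18 (Const 0)))"

definition scan_com :: com where
  "scan_com = Seq scan_pre (While (Less (reg 18) (reg 17)) scan_body)"

definition scan_cost :: nat where
  "scan_cost = cost scan_pre + (6 + cost scan_body)"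

text \<open>Register 10 sums up all \<open>Suc v\<close>, with a fixed number of additions per
  occurrence; the total \<open>T\<close> exceeds every variable, and under unit cost its size does
  not count.\<close>

definition scanned :: "store \<Rightarrow> nat list \<Rightarrow> bool" where
  "scanned s us \<longleftrightarrow> s 14 0 = length (uniq us) \<and> (\<forall>i<length (uniq us). s 5 i = uniq us ! i) \<and>
     (\<forall>v. s 4 v = of_bool (v \<in> set us)) \<and> s 10 0 = sum_list (map Suc us)"

lemma scan_simps [simp]: "loopfree scan_body" "loopfree scan_pre"
  "writes scan_body = {4, 5, 10, 14, 15, 18, 23}" "writes scan_com = {4, 5, 10, 14, 15, 17, 18, 23}"
  by (auto simp: scan_body_def scan_pre_def scan_com_def)

lemma scanned_scan_body:
  assumes sc: "scanned s us" and v: "s 0 (s 15 0) = v"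
  shows "scanned (run scan_body s) (us @ [v])" "run scan_body s 15 0 = s 15 0 + 2"
    "run scan_body s 18 0 = Suc (s 18 0)"
proof -
  have 4: "s 4 v = of_bool (v \<in> set us)" using sc by (simp add: scanned_def)
  show "scanned (run scan_body s) (us @ [v])"
  proof (cases "v \<in> set us")
    case True
    then show ?thesis
      using sc v 4 by (auto simp: scan_body_def scanned_def upd_apply uniq_snoc)
  next
    case False
    then show ?thesis
      using sc v 4 by (auto simp: scan_body_def scanned_def upd_apply uniq_snoc nth_append less_Suc_eq)
  qed
  show "run scan_body s 15 0 = s 15 0 + 2" "run scan_body s 18 0 = Suc (s 18 0)"
    by (simp_all add: scan_body_def upd_apply)
qed

lemma runs_scan_com:
  assumes sc: "scanned s us" and p: "s 15 0 = p" "s 0 p = length c" and lits: "lits_at s (Suc p) c"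
  shows "runs scan_com s (scan_cost * Suc (length c))
    (\<lambda>s'. scanned s' (us @ map fst c) \<and> s' 15 0 = Suc (p + (length c + length c)))"
proof -
  let ?n = "length c"
  let ?s1 = "run scan_pre s"
  let ?b = "Less (reg 18) (reg 17)"
  define I where "I k s' \<longleftrightarrow> scanned s' (us @ map fst (take k c)) \<and> s' 18 0 = k \<and>
    s' 15 0 = Suc p + (k + k) \<and> s' 17 0 = ?n \<and> s' 0 = s 0" for k s'
  have I0: "I 0 ?s1" using sc p by (simp add: I_def scan_pre_def upd_apply scanned_def)
  have step: "I (Suc k) (run scan_body s')" if k: "k < ?n" and Ik: "I k s'" for k s'
  proof -
    have "s' 0 (s' 15 0) = fst (c ! k)" using Ik lits k by (simp add: I_def lits_at_def)
    moreover have "scanned s' (us @ map fst (take k c))" using Ik by (simp add: I_def)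
    ultimately have "scanned (run scan_body s') ((us @ map fst (take k c)) @ [fst (c ! k)])"
      "run scan_body s' 15 0 = s' 15 0 + 2" "run scan_body s' 18 0 = Suc (s' 18 0)"
      using scanned_scan_body by blast+
    moreover have "run scan_body s' a = s' a" if "a \<in> {0, 17}" for a
      by (rule run_frame) (use that in auto)
    ultimately show ?thesis using Ik k by (simp add: I_def take_Suc_conv_app_nth)
  qed
  have "runs (While ?b scan_body) ?s1 (Suc ?n * (1 + bcost ?b + cost scan_body)) (I ?n)"
  proof (rule runs_While_const[where I = I, OF I0])
    fix k s' assume "k < ?n" "I k s'"
    then show "runs scan_body s' (cost scan_body) (I (Suc k))"
      by (intro runs_loopfree step) simp_all
  qed (simp_all add: I_def)
  then have "runs scan_com s (cost scan_pre + Suc ?n * (1 + bcost ?b + cost scan_body)) (I ?n)"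
    unfolding scan_com_def by (intro runs_prefix) auto
  then show ?thesis
    by (rule runs_conseq) (simp_all add: I_def scan_cost_def algebra_simps)
qed

definition scans_pre :: com where
  "scans_pre = Seq (set_reg 12 (Read 0 (Add (reg 11) (Const 1))))
     (Seq (set_reg 13 (Add (reg 11) (Const 2))) (Seq (set_reg 15 (reg 13)) (set_reg 16 (Const 0))))"

definition scans_com :: com where
  "scans_com = Seq scans_pre (While (Less (reg 16) (reg 12)) (Seq scan_com (incr 16)))"

definition scans_cost :: nat where
  "scans_cost = cost scans_pre + 6 + (6 + scan_cost + cost (incr 16))"

lemma writes_scans_com [simp]: "writes scans_com = {4, 5, 10, 12, 13, 14, 15, 16, 17, 18, 23}"
  by (auto simp: scans_com_def scans_pre_def)

lemma runs_scans_com: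
  assumes sc: "scanned s []" and n: "s 11 0 = n"
    and w: "word_at s (n + 1) (length cs # concat (map clause_word cs))"
  shows "runs scans_com s (scans_cost * Suc (csize cs))
    (\<lambda>s'. scanned s' (map fst (concat cs)) \<and> s' 12 0 = length cs \<and> s' 13 0 = n + 2)"
proof -
  let ?p = "n + 2"
  let ?s1 = "run scans_pre s"
  let ?b = "Less (reg 16) (reg 12)"
  let ?t = "\<lambda>k. scan_cost * Suc (length (cs ! k)) + cost (incr 16)"
  define I where "I k s' \<longleftrightarrow> scanned s' (map fst (concat (take k cs))) \<and> s' 16 0 = k \<and>
    s' 15 0 = ?p + clause_offset cs k \<and> s' 12 0 = length cs \<and> s' 13 0 = ?p \<and> s' 0 = s 0" for k s'
  have m: "s 0 (n + 1) = length cs" and w': "word_at s ?p (concat (map clause_word cs))"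
    using w by (simp_all add: word_at_Cons)
  have I0: "I 0 ?s1"
    using sc m n by (simp add: I_def scans_pre_def upd_apply scanned_def clause_offset_def)
  have step: "runs (Seq scan_com (incr 16)) s' (?t k) (I (Suc k))" if k: "k < length cs" and Ik: "I k s'" for k s'
  proof (rule runs_suffix)
    have r: "scanned s' (map fst (concat (take k cs)))" "s' 16 0 = k"
      "s' 15 0 = ?p + clause_offset cs k" "s' 12 0 = length cs" "s' 13 0 = ?p" "s' 0 = s 0"
      using Ik by (simp_all add: I_def)
    have "word_at s' ?p (concat (map clause_word cs))" using w' r(6) by (simp add: word_at_def)
    note wa = word_at_clause[OF this k]
    from runs_frame[OF runs_scan_com[OF r(1,3) wa]]
    show "runs scan_com s' (scan_cost * Suc (length (cs ! k))) (\<lambda>s''. I (Suc k) (run (incr 16) s''))"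
    proof (rule runs_conseq)
      fix s'' assume "(scanned s'' (map fst (concat (take k cs)) @ map fst (cs ! k)) \<and>
          s'' 15 0 = Suc (?p + clause_offset cs k + (length (cs ! k) + length (cs ! k)))) \<and>
          frame (writes scan_com) s' s''"
      then show "I (Suc k) (run (incr 16) s'')"
        using r k by (simp add: I_def upd_apply take_Suc_conv_app_nth clause_offset_Suc scanned_def)
    qed simp
  qed simp
  have "runs (While ?b (Seq scan_com (incr 16))) ?s1
      ((\<Sum>k<length cs. 1 + bcost ?b + ?t k) + (1 + bcost ?b)) (I (length cs))"
    by (rule runs_While[where I = I, OF I0 _ step]) (simp_all add: I_def)
  then have "runs scans_com s (cost scans_pre + ((\<Sum>k<length cs. 1 + bcost ?b + ?t k) + (1 + bcost ?b)))
      (I (length cs))"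
    unfolding scans_com_def by (intro runs_prefix) (auto simp: scans_pre_def)
  then show ?thesis
  proof (rule runs_conseq)
    let ?sq = "\<lambda>c :: lit list. Suc (length c) * Suc (length c)"
    define d where "d = cost (incr 16)"
    have "(\<Sum>k<length cs. 1 + bcost ?b + ?t k) \<le> (\<Sum>k<length cs. (6 + scan_cost + d) * ?sq (cs ! k))"
      by (rule sum_mono) (simp add: d_def algebra_simps)
    also have "\<dots> = (6 + scan_cost + d) * (\<Sum>k<length cs. ?sq (cs ! k))"
      by (rule sum_distrib_left[symmetric])
    also have "(\<Sum>k<length cs. ?sq (cs ! k)) = csize cs"
      by (simp add: csize_def sum_list_sum_nth lessThan_atLeast0)
    finally have 1: "(\<Sum>k<length cs. 1 + bcost ?b + ?t k) \<le> (6 + scan_cost + d) * csize cs" .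
    have "cost scans_pre + ((\<Sum>k<length cs. 1 + bcost ?b + ?t k) + (1 + bcost ?b)) \<le>
        cost scans_pre * Suc (csize cs) + ((6 + scan_cost + d) * Suc (csize cs) + 6 * Suc (csize cs))"
      by (intro add_mono order_trans[OF 1]) auto
    also have "\<dots> = scans_cost * Suc (csize cs)"
      unfolding scans_cost_def d_def by (simp only: add_mult_distrib add_mult_distrib2 ac_simps)
    finally show "cost scans_pre + ((\<Sum>k<length cs. 1 + bcost ?b + ?t k) + (1 + bcost ?b)) \<le>
        scans_cost * Suc (csize cs)" .
  qed (simp add: I_def)
qed

text \<open>Register 7 counts in advance the two unit clauses written next. Cell 0 of the input can
  be overwritten because register 11 keeps the number of variables.\<close>

definition start_regs :: com where
  "start_regs = Seq (Write 5 (reg 14) (Add (reg 10) (Const 1))) (Seq (incr 14)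
     (Seq (Write 0 (Const 0) (reg 10)) (Seq (set_reg 8 (Add (reg 10) (Const 2)))
     (Seq (set_reg 6 (Const 1)) (set_reg 7 (Const 2))))))"

definition start_com :: com where
  "start_com = Seq start_regs
     (emit [Const 1, reg 10, Const 1, Const 1, Add (reg 10) (Const 1), Const 1])"

lemma loopfree_start_com [simp]: "loopfree start_com"
  by (simp add: start_com_def start_regs_def)

lemma start_com_correct:
  assumes T: "s 10 0 = T" and ws: "s 14 0 = length ws" "\<forall>i<length ws. s 5 i = ws ! i"
    and w: "word_at s 0 (n # vs)" "word_at s (length vs + 2) (concat (map clause_word cs))"
    and mark: "\<forall>v. s 3 v = of_bool (v \<in> set vs)"
    and regs: "s 11 0 = length vs" "s 12 0 = length cs" "s 13 0 = length vs + 2"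
    and zero: "s 9 0 = 0" "\<And>i. s 2 i = 0" "s 20 0 = 0"
  shows "rel (run start_com s) (start T)" "env vs (ws @ [Suc T]) cs T (run start_com s)"
    "run start_com s 20 0 = 0"
proof -
  let ?es = "[Const 1, reg 10, Const 1, Const 1, Add (reg 10) (Const 1), Const 1]"
  let ?s1 = "run start_regs s"
  have fr: "run start_com s a = ?s1 a" if "a \<notin> {1, 6}" for a
    unfolding start_com_def run.simps by (rule run_emit_frame[OF that])
  have T1: "?s1 10 0 = T" using T by (simp add: start_regs_def upd_apply)
  have "emitted_word ?s1 []" by (simp add: emitted_word_def start_regs_def upd_apply)
  then have "emitted_word (run (emit ?es) ?s1) ([] @ map (\<lambda>e. aval e ?s1) ?es)"
    by (rule emitted_word_emit) simp
  moreover have "[] @ map (\<lambda>e. aval e ?s1) ?es = concat (map clause_word (out (start T)))"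
    using T1 by (simp add: start_def clause_word_def lit_word_def)
  ultimately have "emitted_word (run start_com s) (concat (map clause_word (out (start T))))"
    by (simp add: start_com_def)
  moreover have "?s1 7 0 = 2" "?s1 8 0 = Suc (Suc T)" "?s1 9 0 = 0" "?s1 2 = s 2"
    using T zero by (simp_all add: start_regs_def upd_apply)
  ultimately show "rel (run start_com s) (start T)"
    using zero fr unfolding rel_def emitted_def by (simp add: start_def)
  have "env vs (ws @ [Suc T]) cs T ?s1"
    using T ws w mark regs
    by (auto simp: env_def start_regs_def upd_apply word_at_Cons nth_append less_Suc_eq word_at_def)
  moreover have "env vs (ws @ [Suc T]) cs T (run start_com s) = env vs (ws @ [Suc T]) cs T ?s1"
    by (rule env_cong) (auto intro: fr)
  ultimately show "env vs (ws @ [Suc T]) cs T (run start_com s)" by simp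
  show "run start_com s 20 0 = 0" using fr[of 20] zero by (simp add: start_regs_def upd_apply)
qed

definition program :: com where
  "program = Seq mark_com (Seq scans_com (Seq start_com (Seq main_com (Write 1 (Const 0) (reg 7)))))"

lemma runs_program:
  fixes vs :: "var list" and cs :: "lit list list"
  defines "us \<equiv> map fst (concat cs)"
  defines "T \<equiv> sum_list (map Suc us)"
  defines "S \<equiv> fold (circuits T (set vs) (uniq us @ [Suc T]) cs) (T # vs) (start T)"
  shows "runs program (input_store ((length vs # vs) @ length cs # concat (map clause_word cs)))
    (mark_cost * Suc (length vs) + (scans_cost * Suc (csize cs) + (cost start_com +
      (main_cost * (Suc (length vs) * (Suc (Suc (length (uniq us))) * Suc (csize cs))) +
        cost (Write 1 (Const 0) (reg 7))))))
    (\<lambda>s. has_output s (length (out S) # concat (map clause_word (out S))))"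
proof -
  let ?w = "concat (map clause_word cs)"
  define s0 where "s0 = input_store ((length vs # vs) @ length cs # ?w)"
  let ?n = "length vs"
  have "word_at s0 0 ((?n # vs) @ length cs # ?w)" by (simp add: word_at_def s0_def input_store_def)
  then have w0: "word_at s0 0 (?n # vs)" "word_at s0 (?n + 1) (length cs # ?w)"
    by (simp_all add: word_at_append del: append_Cons)
  have zero0: "s0 a i = 0" if "a \<noteq> 0" for a i using that by (simp add: s0_def input_store_def)
  show ?thesis
    unfolding program_def s0_def[symmetric]
  proof (rule runs_Seq[OF runs_frame[OF runs_mark_com[OF w0(1)]]])
    fix s1 assume "(s1 11 0 = ?n \<and> (\<forall>v. s1 3 v = of_bool (v \<in> set vs))) \<and> frame (writes mark_com) s0 s1"
    then have n1: "s1 11 0 = ?n" and mark1: "\<forall>v. s1 3 v = of_bool (v \<in> set vs)"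
      and f1: "frame {3, 11, 18} s0 s1" by simp_all
    have sc1: "scanned s1 []" using f1 zero0 by (simp add: scanned_def)
    have w1: "word_at s1 (?n + 1) (length cs # ?w)" using w0(2) f1 by (simp add: word_at_def)
    let ?t = "main_cost * (Suc ?n * (Suc (Suc (length (uniq us))) * Suc (csize cs)))"
    show "runs (Seq scans_com (Seq start_com (Seq main_com (Write 1 (Const 0) (reg 7))))) s1
      (scans_cost * Suc (csize cs) + (cost start_com + (?t + cost (Write 1 (Const 0) (reg 7)))))
      (\<lambda>s. has_output s (length (out S) # concat (map clause_word (out S))))"
    proof (rule runs_Seq[OF runs_frame[OF runs_scans_com[OF sc1 n1 w1]]])
      fix s2 assume "(scanned s2 (map fst (concat cs)) \<and> s2 12 0 = length cs \<and> s2 13 0 = ?n + 2) \<and>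
        frame (writes scans_com) s1 s2"
      then have sc2: "scanned s2 us" and r2: "s2 12 0 = length cs" "s2 13 0 = ?n + 2"
        and f2: "frame {4, 5, 10, 12, 13, 14, 15, 16, 17, 18, 23} s1 s2" by (simp_all add: us_def)
      have f02: "s2 a = s0 a" if "a \<in> {0, 2, 9, 20}" for a using that f1 f2 by auto
      have z2: "s2 9 0 = 0" "\<And>i. s2 2 i = 0" "s2 20 0 = 0" using f02 zero0 by simp_all
      have w2: "word_at s2 0 (?n # vs)" "word_at s2 (?n + 2) ?w"
        using w0 f02 by (simp_all add: word_at_Cons, simp_all add: word_at_def)
      have "\<forall>v. s2 3 v = of_bool (v \<in> set vs)" "s2 11 0 = ?n" using mark1 n1 f2 by simp_all
      note st = start_com_correct[OF _ _ _ w2 this(1,2) r2 z2, of T "uniq us"]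
      have st: "rel (run start_com s2) (start T)" "env vs (uniq us @ [Suc T]) cs T (run start_com s2)"
        "run start_com s2 20 0 = 0"
        using st sc2 by (simp_all add: scanned_def T_def)
      show "runs (Seq start_com (Seq main_com (Write 1 (Const 0) (reg 7)))) s2
        (cost start_com + (?t + cost (Write 1 (Const 0) (reg 7))))
        (\<lambda>s. has_output s (length (out S) # concat (map clause_word (out S))))"
      proof (intro runs_prefix runs_suffix)
        from runs_main_com[OF st]
        show "runs main_com (run start_com s2) ?t
          (\<lambda>s'. has_output (run (Write 1 (Const 0) (reg 7)) s') (length (out S) # concat (map clause_word (out S))))"
        proof (rule runs_conseq)
          fix s' assume "rel s' (fold (circuits T (set vs) (uniq us @ [Suc T]) cs) (T # vs) (start T))"
          then have "emitted s' (out S)" by (simp add: rel_def S_def)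
          \<comment> \<open>Cell 0, left free so far, receives the number of clauses.\<close>
          then show "has_output (run (Write 1 (Const 0) (reg 7)) s') (length (out S) # concat (map clause_word (out S)))"
            by (auto simp: has_output_def emitted_def emitted_word_def upd_apply nth_Cons split: nat.splits)
        qed simp
      qed simp_all
    qed
  qed (simp add: zero0)
qed

section \<open>The time bound in terms of the clause length\<close>

lemma csize_le:
  assumes "distinct (map set cs)" "\<forall>c\<in>set cs. distinct c" "\<forall>c\<in>set cs. card (set c) \<le> p"
  shows "csize cs \<le> 1 + 4 * p * nlits (set ` set cs)"
proof -
  have dist: "distinct cs" and inj: "inj_on set (set cs)" using assms(1) by (auto simp: distinct_map)
  have card: "card (set c) = length c" if "c \<in> set cs" for c
    using that assms(2) by (simp add: distinct_card)
  \<comment> \<open>A nonempty clause satisfies \<open>|C| + 1 \<le> 2 |C|\<close>, whence the 4;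
    one of the two factors \<open>|C|\<close> is then bounded by \<open>p\<close>. The empty clause
    occurs at most once and accounts for the summand 1.\<close>
  have "Suc (length c) * Suc (length c) \<le> (if c = [] then 1 else 0) + 4 * p * length c"
    if c: "c \<in> set cs" for c
  proof (cases "c = []")
    case False
    then have "Suc (length c) \<le> 2 * length c" by (cases c) auto
    then have "Suc (length c) * Suc (length c) \<le> (2 * length c) * (2 * length c)"
      by (intro mult_mono) auto
    also have "\<dots> = 4 * length c * length c" by simp
    also have "\<dots> \<le> 4 * p * length c"
      using assms(3) c card[OF c] by (intro mult_mono) auto
    finally show ?thesis by simp
  qed simp
  then have "csize cs \<le> (\<Sum>c\<in>set cs. (if c = [] then 1 else 0) + 4 * p * length c)"
    unfolding csize_def sum_list_distinct_conv_sum_set[OF dist] by (rule sum_mono)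
  also have "\<dots> = (\<Sum>c\<in>set cs. if c = [] then 1 else 0) + 4 * p * (\<Sum>c\<in>set cs. length c)"
    by (simp add: sum.distrib sum_distrib_left)
  also have "(\<Sum>c\<in>set cs. if c = [] then 1 else 0) \<le> (1 :: nat)" by simp
  also have "(\<Sum>c\<in>set cs. length c) = nlits (set ` set cs)"
    unfolding nlits_def sum.reindex[OF inj] using card by simp
  finally show ?thesis by simp
qed

text \<open>Each parameter enters the bound as at least 1, since the program takes time also for a
  function without variables or a clause-set without literals.\<close>

theorem theorem6p7:
  "\<exists>(prog :: com) (K :: nat). \<forall>(p :: nat) (f :: boolfun) (F :: clause set) wV wF.
     boolean_function f \<and> UR_representation F f \<and> (\<forall>C\<in>F. card C \<le> p) \<and>
     codes_var_set wV (bvars f) \<and> codes_clause_set wF F \<longrightarrow>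
     (\<exists>t s F' wF'.
        exec prog (input_store (wV @ wF)) t s \<and>
        t \<le> K * (max 1 (card (bvars f)) * max 1 p * max 1 (nvars F) * max 1 (nlits F)) \<and>
        has_output s wF' \<and> codes_clause_set wF' F' \<and>
        forcing_representation F' f)"
proof -
  define k where "k = cost (Write 1 (Const 0) (reg 7))"
  \<comment> \<open>36 is the product of 2, 3 and 6, the factors lost when \<open>n(f) + 1\<close>,
    \<open>n(F) + 2\<close> and \<open>csize cs + 1\<close> are bounded by multiples of the
    parameters.\<close>
  define K where "K = 36 * (mark_cost + scans_cost + cost start_com + main_cost + k)"
  have "\<exists>t s F' wF'. exec program (input_store (wV @ wF)) t s \<and>
        t \<le> K * (max 1 (card (bvars f)) * max 1 p * max 1 (nvars F) * max 1 (nlits F)) \<and>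
        has_output s wF' \<and> codes_clause_set wF' F' \<and> forcing_representation F' f"
    if UR: "UR_representation F f" and p: "\<forall>C\<in>F. card C \<le> p"
      and wV: "codes_var_set wV (bvars f)" and wF: "codes_clause_set wF F" for p f F wV wF
  proof -
    obtain vs where vs: "distinct vs" "set vs = bvars f" "wV = length vs # vs"
      using wV by (auto simp: codes_var_set_def)
    obtain cs where cs: "\<forall>c\<in>set cs. distinct c" "distinct (map set cs)" "set (map set cs) = F"
      "wF = length cs # concat (map clause_word cs)"
      using wF unfolding codes_clause_set_def by blast
    define us where "us = map fst (concat cs)"
    define T where "T = sum_list (map Suc us)"
    define S where "S = fold (circuits T (set vs) (uniq us @ [Suc T]) cs) (T # vs) (start T)"
    have F: "F = set ` set cs" using cs(3) by simp
    have us_vars: "set us = vars F" by (auto simp: us_def vars_def F image_iff)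
    have below: "v < T" if "v \<in> vars F" for v
    proof -
      have "Suc v \<in> set (map Suc us)" using that us_vars by simp
      then have "Suc v \<le> T" unfolding T_def by (rule member_le_sum_list) simp
      then show ?thesis by simp
    qed
    have V: "bvars f \<subseteq> vars F" using UR by (simp add: UR_representation_def CNF_representation_def)
    interpret simulation "set vs" cs T "uniq us @ [Suc T]" F
      using F below V us_vars cs(1) vs(2) by unfold_locales auto
    have "set (T # vs) = insert T (set vs)" by simp
    note gen = generated_forcing[OF UR vs(2) this S_def]
    let ?w = "length (out S) # concat (map clause_word (out S))"
    have out: "codes_clause_set ?w (clset S)"
      unfolding codes_clause_set_def using gen(2,3) by (intro exI[of _ "out S"]) (simp add: clset_def)
    let ?n = "card (bvars f)" and ?m = "nvars F" and ?l = "nlits F"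
    have n: "length vs = ?n" using vs distinct_card by metis
    have m: "length (uniq us) = ?m" using distinct_card[OF distinct_uniq, of us] us_vars by (simp add: nvars_def)
    define t where "t = mark_cost * Suc ?n + (scans_cost * Suc (csize cs) + (cost start_com +
      (main_cost * (Suc ?n * (Suc (Suc ?m) * Suc (csize cs))) + k)))"
    have "runs program (input_store (wV @ wF)) t (\<lambda>s. has_output s ?w)"
      using runs_program[of vs cs] unfolding t_def k_def vs(3) cs(4) S_def T_def us_def
        n[symmetric] m[unfolded us_def, symmetric] by simp
    then obtain t' s where exec: "exec program (input_store (wV @ wF)) t' s" "t' \<le> t" "has_output s ?w"
      unfolding runs_def by blast
    define N where "N = max 1 ?n" define P where "P = max 1 p"
    define M where "M = max 1 ?m" define L where "L = max 1 ?l"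
    have pos: "N \<ge> 1" "P \<ge> 1" "M \<ge> 1" "L \<ge> 1" by (simp_all add: N_def P_def M_def L_def)
    have "csize cs \<le> 1 + 4 * p * ?l"
      unfolding F by (rule csize_le) (use cs p in auto)
    also have "4 * p * ?l \<le> 4 * P * L" by (intro mult_mono) (simp_all add: P_def L_def)
    finally have "Suc (csize cs) \<le> 2 + 4 * (P * L)" by simp
    moreover have PL: "1 \<le> P * L" using pos by simp
    ultimately have c: "Suc (csize cs) \<le> 6 * (P * L)" by linarith
    have n2: "Suc ?n \<le> 2 * N" and m3: "Suc (Suc ?m) \<le> 3 * M" by (simp_all add: N_def M_def)
    define Q where "Q = N * P * M * L"
    have Q1: "1 \<le> Q" using pos by (simp add: Q_def)
    have "Suc ?n * (Suc (Suc ?m) * Suc (csize cs)) \<le> (2 * N) * ((3 * M) * (6 * (P * L)))"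
      by (intro mult_mono n2 m3 c) auto
    also have "\<dots> = 36 * Q" by (simp add: Q_def)
    finally have a1: "Suc ?n * (Suc (Suc ?m) * Suc (csize cs)) \<le> 36 * Q" .
    \<comment> \<open>The left side of \<open>a1\<close> is a product of positive numbers, so each
      factor inherits the bound.\<close>
    have a2: "Suc ?n \<le> 36 * Q"
      using a1 by (rule order_trans[rotated]) simp
    have a3: "Suc (csize cs) \<le> 36 * Q"
      using a1 by (rule order_trans[rotated]) simp
    have a4: "x \<le> x * (36 * Q)" for x using Q1 by simp
    have "t \<le> mark_cost * (36 * Q) + (scans_cost * (36 * Q) + (cost start_com * (36 * Q) +
      (main_cost * (36 * Q) + k * (36 * Q))))"
      unfolding t_def by (intro add_mono mult_le_mono2 a1 a2 a3 a4)
    also have "\<dots> = K * Q" unfolding K_def by (simp only: add_mult_distrib add_mult_distrib2 ac_simps)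
    finally have "t' \<le> K * Q" using exec(2) by simp
    then show ?thesis
      using exec out gen(1) unfolding Q_def N_def P_def M_def L_def by blast
  qed
  then show ?thesis by blast
qed

end
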